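(* Let $g$ be a loxodromic element of ${\rm Sp}(n,1)$ with $M_g<1$ and with fixed points $u,v\in\partial{\bf H}^n_{\mathbb H}$. Let $h$ be any other element of ${\rm Sp}(n,1)$. Suppose that one of the following conditions holds: (1) $\displaystyle \bigl|[h(u),v,u,h(v)]\bigr|^{1/2}<\frac{1-M_g}{M_g}$; (2) $\displaystyle \bigl|[h(u),u,v,h(v)]\bigr|^{1/2}<\frac{1-M_g}{M_g}$; (3) $\displaystyle \bigl|[u,v,h(u),h(v)]\bigr|^{1/2}<1-M_g$; (4) $\displaystyle \bigl|[h(u),u,v,h(v)]\bigr|+\bigl|[h(u),v,u,h(v)]\bigr|<\frac{2(1-M_g)}{M_g^2}$. Then the group $\langle g,h\rangle$ is either elementary or not discrete.
   Context: Let $\mathbb H$ be the quaternions, $n$ a positive integer, and $\mathbb H^{n,1}$ the right quaternionic vector space of column vectors with $n+1$ quaternionic entries, with the Hermitian form $\langle {\bf z},{\bf w}\rangle=\overline{w}_1z_1+\cdots+\overline{w}_{n-1}z_{n-1}-(\overline{w}_nz_{n+1}+\overline{w}_{n+1}z_n)$. ${\rm Sp}(n,1)$ is the group of linear automorphisms (matrices acting on the left) preserving this form. Let $V_0=\{{\bf z}\ne 0:\langle {\bf z},{\bf z}\rangle=0\}$, $V_-=\{{\bf z}:\langle {\bf z},{\bf z}\rangle<0\}$, and let $\mathbb P$ be the right projection ${\bf z}\mapsto[{\bf z}]$, where ${\bf z}\sim{\bf z}\lambda$ for $\lambda\in\mathbb H\setminus\{0\}$. Quaternionic hyperbolic space is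 ${\bf H}^n_{\mathbb H}=\mathbb P(V_-)$, with boundary $\partial{\bf H}^n_{\mathbb H}=\mathbb P(V_0)$; ${\rm Sp}(n,1)$ acts on both. An element $g\in{\rm Sp}(n,1)$ is loxodromic if it has exactly two fixed points in ${\bf H}^n_{\mathbb H}\cup\partial{\bf H}^n_{\mathbb H}$, and both lie in $\partial{\bf H}^n_{\mathbb H}$. Such $g$ is conjugate in ${\rm Sp}(n,1)$ to ${\rm diag}(\lambda_1,\ldots,\lambda_{n-1},\lambda_n,\overline{\lambda}_n^{-1})$ with $\lambda_i\in\mathbb H$, $|\lambda_i|=1$ for $1\le i\le n-1$, and $|\lambda_n|>1$. Define the conjugacy invariants $$\delta(g)=\max_{1\le i\le n-1}|\lambda_i-1|,\qquad M_g=2\delta(g)+|\lambda_n-1|+|\overline{\lambda}_n^{-1}-1|$$ (a maximum over an empty index set is $0$). For $z_1,z_2,w_1,w_2\in{\bf H}^n_{\mathbb H}\cup\partial{\bf H}^n_{\mathbb H}$ with lifts ${\bf z}_i\in\mathbb P^{-1}(z_i)$, ${\bf w}_i\in\mathbb P^{-1}(w_i)$, the absolute value of the quaternionic cross-ratio is $$\bigl|[z_1,z_2,w_1,w_2]\bigr|=\frac{|\langle {\bf w}_1,{\bf z}_1\rangle|\,|\langle {\bf w}_2,{\bf z}_2\rangle|}{|\langle {\bf w}_1,{\bf z}_2\rangle|\,|\langle {\bf w}_2,{\bf z}_1\rangle|},$$ which is independent of the lifts. It is defined when the denominator is non-zero; condition (3) is understood to include that the cross-ratio appearing there is defined (those in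 the other conditions always are). A subgroup of ${\rm Sp}(n,1)$ is elementary if it has a finite orbit in ${\bf H}^n_{\mathbb H}\cup\partial{\bf H}^n_{\mathbb H}$. *)

theory Defs
  imports
    "HOL-Analysis.Inner_Product"
    "HOL-Analysis.Function_Topology"
    "HOL-Analysis.Isolated"
    "HOL-Algebra.Generated_Groups"
    "Jordan_Normal_Form.Matrix"
begin

section \<open>Quaternions\<close>

datatype quat = Quat (qRe: real) (qI: real) (qJ: real) (qK: real)

lemma quat_eq_iff: "p = q \<longleftrightarrow> qRe p = qRe q \<and> qI p = qI q \<and> qJ p = qJ q \<and> qK p = qK q"
  by (cases p; cases q) simp

instantiation quat :: ring_1
begin

definition "0 = Quat 0 0 0 0"

definition "1 = Quat 1 0 0 0"

definition "p + q = Quat (qRe p + qRe q) (qI p + qI q) (qJ p + qJ q) (qK p + qK q)"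

definition "- p = Quat (- qRe p) (- qI p) (- qJ p) (- qK p)"

definition "p - q = Quat (qRe p - qRe q) (qI p - qI q) (qJ p - qJ q) (qK p - qK q)"

definition "p * q =
  Quat (qRe p * qRe q - qI p * qI q - qJ p * qJ q - qK p * qK q)
       (qRe p * qI q + qI p * qRe q + qJ p * qK q - qK p * qJ q)
       (qRe p * qJ q - qI p * qK q + qJ p * qRe q + qK p * qI q)
       (qRe p * qK q + qI p * qJ q - qJ p * qI q + qK p * qRe q)"

instance
  by standard
    (simp_all add: quat_eq_iff zero_quat_def one_quat_def plus_quat_def uminus_quat_def
      minus_quat_def times_quat_def algebra_simps)

end

lemma quat_components [simp]:
  "qRe 0 = 0" "qI 0 = 0" "qJ 0 = 0" "qK 0 = 0"
  "qRe 1 = 1" "qI 1 = 0" "qJ 1 = 0" "qK 1 = 0"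
  "qRe (p + q) = qRe p + qRe q" "qI (p + q) = qI p + qI q"
  "qJ (p + q) = qJ p + qJ q" "qK (p + q) = qK p + qK q"
  "qRe (p - q) = qRe p - qRe q" "qI (p - q) = qI p - qI q"
  "qJ (p - q) = qJ p - qJ q" "qK (p - q) = qK p - qK q"
  "qRe (- p) = - qRe p" "qI (- p) = - qI p" "qJ (- p) = - qJ p" "qK (- p) = - qK p"
  "qRe (p * q) = qRe p * qRe q - qI p * qI q - qJ p * qJ q - qK p * qK q"
  "qI (p * q) = qRe p * qI q + qI p * qRe q + qJ p * qK q - qK p * qJ q"
  "qJ (p * q) = qRe p * qJ q - qI p * qK q + qJ p * qRe q + qK p * qI q"
  "qK (p * q) = qRe p * qK q + qI p * qJ q - qJ p * qI q + qK p * qRe q"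
  by (simp_all add: zero_quat_def one_quat_def plus_quat_def uminus_quat_def minus_quat_def
      times_quat_def)

definition qcnj :: "quat \<Rightarrow> quat"
  where "qcnj q = Quat (qRe q) (- qI q) (- qJ q) (- qK q)"

lemma qcnj_components [simp]:
  "qRe (qcnj q) = qRe q" "qI (qcnj q) = - qI q" "qJ (qcnj q) = - qJ q" "qK (qcnj q) = - qK q"
  by (simp_all add: qcnj_def)

instantiation quat :: scaleR
begin

definition "scaleR r q = Quat (r * qRe q) (r * qI q) (r * qJ q) (r * qK q)"

instance ..

end

lemma scaleR_components [simp]:
  "qRe (r *\<^sub>R q) = r * qRe q" "qI (r *\<^sub>R q) = r * qI q"
  "qJ (r *\<^sub>R q) = r * qJ q" "qK (r *\<^sub>R q) = r * qK q"
  by (simp_all add: scaleR_quat_def)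

instantiation quat :: real_inner
begin

definition "inner p q = qRe p * qRe q + qI p * qI q + qJ p * qJ q + qK p * qK q"

definition "norm (q :: quat) = sqrt (inner q q)"

definition "sgn (q :: quat) = q /\<^sub>R norm q"

definition "dist (p :: quat) q = norm (p - q)"

definition "(uniformity :: (quat \<times> quat) filter) = (INF e\<in>{0 <..}. principal {(p, q). dist p q < e})"

definition "open (U :: quat set) \<longleftrightarrow> (\<forall>p\<in>U. eventually (\<lambda>(p', q). p' = p \<longrightarrow> q \<in> U) uniformity)"

instance
proof
  fix p q r :: quat and a b :: real and U :: "quat set"
  show "a *\<^sub>R (p + q) = a *\<^sub>R p + a *\<^sub>R q" "(a + b) *\<^sub>R p = a *\<^sub>R p + b *\<^sub>R p"
    "a *\<^sub>R b *\<^sub>R p = (a * b) *\<^sub>R p" "1 *\<^sub>R p = p"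
    by (simp_all add: quat_eq_iff algebra_simps)
  show "inner p q = inner q p" "inner (p + q) r = inner p r + inner q r"
    "inner (a *\<^sub>R p) q = a * inner p q" "0 \<le> inner p p"
    by (simp_all add: inner_quat_def algebra_simps)
  have "inner p p = 0 \<longleftrightarrow> ((qRe p)\<^sup>2 + (qI p)\<^sup>2) + ((qJ p)\<^sup>2 + (qK p)\<^sup>2) = 0"
    by (simp add: inner_quat_def power2_eq_square add.assoc)
  also have "\<dots> \<longleftrightarrow> p = 0"
    by (subst add_nonneg_eq_0_iff) (auto simp: sum_power2_eq_zero_iff quat_eq_iff)
  finally show "inner p p = 0 \<longleftrightarrow> p = 0" .
qed (simp_all add: norm_quat_def sgn_quat_def dist_quat_def uniformity_quat_def open_quat_def)

end

lemma qcnj_mult_self: "qcnj q * q = (norm q)\<^sup>2 *\<^sub>R 1" "q * qcnj q = (norm q)\<^sup>2 *\<^sub>R 1"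
  by (simp_all add: quat_eq_iff norm_quat_def inner_quat_def)

instantiation quat :: real_normed_div_algebra
begin

definition "inverse q = qcnj q /\<^sub>R (norm q)\<^sup>2"

definition "p div q = p * inverse q" for p q :: quat

instance
proof
  fix p q :: quat and a :: real
  show "a *\<^sub>R p * q = a *\<^sub>R (p * q)" "p * a *\<^sub>R q = a *\<^sub>R (p * q)"
    by (simp_all add: quat_eq_iff algebra_simps)
  show "norm (p * q) = norm p * norm q"
    unfolding norm_quat_def inner_quat_def real_sqrt_mult [symmetric]
    by (rule arg_cong [where f = sqrt]) (simp add: algebra_simps)
  show "p div q = p * inverse q"
    by (simp add: divide_quat_def)
  have scl: "x * b *\<^sub>R y = b *\<^sub>R (x * y)" "b *\<^sub>R x * y = b *\<^sub>R (x * y)" for x y :: quat and b :: real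
    by (simp_all add: quat_eq_iff algebra_simps)
  show "inverse p * p = 1" "p * inverse p = 1" if "p \<noteq> 0"
    using that by (simp_all add: inverse_quat_def scl qcnj_mult_self)
  show "inverse (0 :: quat) = 0"
    by (simp add: inverse_quat_def quat_eq_iff)
qed

end

lemma qcnj_mult: "qcnj (p * q) = qcnj q * qcnj p"
  by (simp add: quat_eq_iff algebra_simps)

lemma qcnj_add: "qcnj (p + q) = qcnj p + qcnj q"
  by (simp add: quat_eq_iff)

lemma qcnj_diff: "qcnj (p - q) = qcnj p - qcnj q"
  by (simp add: quat_eq_iff)

lemma qcnj_qcnj [simp]: "qcnj (qcnj q) = q"
  by (simp add: quat_eq_iff)

lemma norm_qcnj [simp]: "norm (qcnj q) = norm q"
  by (simp add: norm_quat_def inner_quat_def)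

lemma qcnj_sum: "qcnj (\<Sum>i\<in>A. f i) = (\<Sum>i\<in>A. qcnj (f i))"
  by (induction A rule: infinite_finite_induct) (simp_all add: qcnj_add, simp_all add: quat_eq_iff)

section \<open>The Hermitian form and the group Sp(n,1)\<close>

text \<open>
  Vectors have \<open>n + 1\<close> entries, indexed from \<open>0\<close>; the two isotropic coordinates are those of
  index \<open>n - 1\<close> and \<open>n\<close>.  Throughout, \<open>n\<close> is meant to be positive.
\<close>

definition form :: "nat \<Rightarrow> quat vec \<Rightarrow> quat vec \<Rightarrow> quat"
  where "form n z w = (\<Sum>i<n - 1. qcnj (w $ i) * z $ i)
    - (qcnj (w $ (n - 1)) * z $ n + qcnj (w $ n) * z $ (n - 1))"

lemma qcnj_form: "qcnj (form n z w) = form n w z"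
  by (simp add: form_def qcnj_diff qcnj_sum qcnj_mult qcnj_add)

lemma form_self_real: "form n z z = of_real (qRe (form n z z))"
proof -
  have "qcnj (form n z z) = form n z z"
    by (rule qcnj_form)
  then show ?thesis
    by (simp add: quat_eq_iff of_real_def)
qed

definition Sp :: "nat \<Rightarrow> quat mat monoid"
  where "Sp n = \<lparr>carrier = {A \<in> carrier_mat (n + 1) (n + 1). invertible_mat A \<and>
      (\<forall>z\<in>carrier_vec (n + 1). \<forall>w\<in>carrier_vec (n + 1).
        form n (A *\<^sub>v z) (A *\<^sub>v w) = form n z w)},
    monoid.mult = (*), one = 1\<^sub>m (n + 1)\<rparr>"

section \<open>Quaternionic hyperbolic space and its boundary\<close>

definition V_null :: "nat \<Rightarrow> quat vec set"
  where "V_null n = {z \<in> carrier_vec (n + 1). z \<noteq> 0\<^sub>v (n + 1) \<and> form n z z = 0}"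

text \<open>\<open>form n z z\<close> is always real by \<open>form_self_real\<close>, so that its sign is the sign of its
  real part.\<close>

definition V_neg :: "nat \<Rightarrow> quat vec set"
  where "V_neg n = {z \<in> carrier_vec (n + 1). qRe (form n z z) < 0}"

definition rscale :: "quat vec \<Rightarrow> quat \<Rightarrow> quat vec"
  where "rscale z c = map_vec (\<lambda>x. x * c) z"

text \<open>A point of projective space is the set of all its lifts.\<close>

definition proj :: "quat vec \<Rightarrow> quat vec set"
  where "proj z = {rscale z c | c. c \<noteq> 0}"

definition hyp_space :: "nat \<Rightarrow> quat vec set set"
  where "hyp_space n = proj ` V_neg n"

definition hyp_boundary :: "nat \<Rightarrow> quat vec set set"
  where "hyp_boundary n = proj ` V_null n"

definition act :: "quat mat \<Rightarrow> quat vec set \<Rightarrow> quat vec set"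
  where "act A p = (*\<^sub>v) A ` p"

lemma act_proj:
  assumes "A \<in> carrier_mat m k" "z \<in> carrier_vec k"
  shows "act A (proj z) = proj (A *\<^sub>v z)"
proof -
  have "A *\<^sub>v rscale z c = rscale (A *\<^sub>v z) c" for c
    using assms by (auto simp: rscale_def scalar_prod_def sum_distrib_right mult.assoc)
  then show ?thesis
    by (auto simp: act_def proj_def image_iff) metis
qed

definition fixed_points :: "nat \<Rightarrow> quat mat \<Rightarrow> quat vec set set"
  where "fixed_points n g = {p \<in> hyp_space n \<union> hyp_boundary n. act g p = p}"

section \<open>The cross-ratio\<close>

definition lift_pt :: "quat vec set \<Rightarrow> quat vec"
  where "lift_pt p = (SOME z. z \<in> p)"

definition cross_ratio_abs ::
    "nat \<Rightarrow> quat vec set \<Rightarrow> quat vec set \<Rightarrow> quat vec set \<Rightarrow> quat vec set \<Rightarrow> real"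
  where "cross_ratio_abs n z1 z2 w1 w2 =
    (norm (form n (lift_pt w1) (lift_pt z1)) * norm (form n (lift_pt w2) (lift_pt z2))) /
    (norm (form n (lift_pt w1) (lift_pt z2)) * norm (form n (lift_pt w2) (lift_pt z1)))"

definition cross_ratio_defined ::
    "nat \<Rightarrow> quat vec set \<Rightarrow> quat vec set \<Rightarrow> quat vec set \<Rightarrow> quat vec set \<Rightarrow> bool"
  where "cross_ratio_defined n z1 z2 w1 w2 \<longleftrightarrow>
    norm (form n (lift_pt w1) (lift_pt z2)) * norm (form n (lift_pt w2) (lift_pt z1)) \<noteq> 0"

lemma form_rscale:
  assumes "n \<ge> 1" "z \<in> carrier_vec (n + 1)" "w \<in> carrier_vec (n + 1)"
  shows "form n (rscale z a) (rscale w b) = qcnj b * form n z w * a"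
  using assms
  by (simp add: form_def rscale_def qcnj_mult sum_distrib_left sum_distrib_right algebra_simps)

lemma lift_pt_proj: "\<exists>c. c \<noteq> 0 \<and> lift_pt (proj z) = rscale z c"
proof -
  have "rscale z 1 \<in> proj z"
    by (auto simp: proj_def)
  then have "lift_pt (proj z) \<in> proj z"
    unfolding lift_pt_def by (rule someI)
  then show ?thesis
    by (auto simp: proj_def)
qed

text \<open>Independence of the choice of lifts:\<close>

lemma cross_ratio_proj:
  assumes "n \<ge> 1" "z1 \<in> carrier_vec (n + 1)" "z2 \<in> carrier_vec (n + 1)"
    "w1 \<in> carrier_vec (n + 1)" "w2 \<in> carrier_vec (n + 1)"
  shows "cross_ratio_abs n (proj z1) (proj z2) (proj w1) (proj w2) =
      (norm (form n w1 z1) * norm (form n w2 z2)) / (norm (form n w1 z2) * norm (form n w2 z1))"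
    and "cross_ratio_defined n (proj z1) (proj z2) (proj w1) (proj w2) \<longleftrightarrow>
      norm (form n w1 z2) * norm (form n w2 z1) \<noteq> 0"
proof -
  obtain a b c d where nz: "a \<noteq> 0" "b \<noteq> 0" "c \<noteq> 0" "d \<noteq> 0"
    and "lift_pt (proj z1) = rscale z1 a" "lift_pt (proj z2) = rscale z2 b"
      "lift_pt (proj w1) = rscale w1 c" "lift_pt (proj w2) = rscale w2 d"
    using lift_pt_proj by metis
  note eqs = this(5-) form_rscale norm_mult norm_qcnj
  show "cross_ratio_abs n (proj z1) (proj z2) (proj w1) (proj w2) =
      (norm (form n w1 z1) * norm (form n w2 z2)) / (norm (form n w1 z2) * norm (form n w2 z1))"
    using nz assms by (simp add: cross_ratio_abs_def eqs field_simps)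
  show "cross_ratio_defined n (proj z1) (proj z2) (proj w1) (proj w2) \<longleftrightarrow>
      norm (form n w1 z2) * norm (form n w2 z1) \<noteq> 0"
    using nz assms by (simp add: cross_ratio_defined_def eqs)
qed

section \<open>Loxodromic elements and their invariants\<close>

definition loxodromic :: "nat \<Rightarrow> quat mat \<Rightarrow> bool"
  where "loxodromic n g \<longleftrightarrow> g \<in> carrier (Sp n) \<and>
    card (fixed_points n g) = 2 \<and> fixed_points n g \<subseteq> hyp_boundary n"

text \<open>
  \<open>l 0, \<dots>, l (n - 1)\<close> are \<open>\<lambda>\<^sub>1, \<dots>, \<lambda>\<^sub>n\<close>.  For loxodromic \<open>g\<close> such a family exists and is unique up
  to conjugating each entry by a quaternion and permuting the first \<open>n - 1\<close> of them; neither
  changes the two numbers below, so that they do not depend on the choice.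
\<close>

definition diagonal_form :: "nat \<Rightarrow> quat mat \<Rightarrow> (nat \<Rightarrow> quat) \<Rightarrow> bool"
  where "diagonal_form n g l \<longleftrightarrow> (\<forall>i<n - 1. norm (l i) = 1) \<and> norm (l (n - 1)) > 1 \<and>
    (\<exists>P\<in>carrier (Sp n). P \<otimes>\<^bsub>Sp n\<^esub> g \<otimes>\<^bsub>Sp n\<^esub> inv\<^bsub>Sp n\<^esub> P =
      mat_diag (n + 1) (\<lambda>i. if i < n then l i else inverse (qcnj (l (n - 1)))))"

definition eigenvalues_of :: "nat \<Rightarrow> quat mat \<Rightarrow> nat \<Rightarrow> quat"
  where "eigenvalues_of n g = (SOME l. diagonal_form n g l)"

text \<open>Inserting \<open>0\<close> only matters for \<open>n = 1\<close>, when there is nothing to maximise over.\<close>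

definition delta_inv :: "nat \<Rightarrow> quat mat \<Rightarrow> real"
  where "delta_inv n g = Max (insert 0 ((\<lambda>i. norm (eigenvalues_of n g i - 1)) ` {..<n - 1}))"

definition M_inv :: "nat \<Rightarrow> quat mat \<Rightarrow> real"
  where "M_inv n g = 2 * delta_inv n g + norm (eigenvalues_of n g (n - 1) - 1)
    + norm (inverse (qcnj (eigenvalues_of n g (n - 1))) - 1)"

section \<open>Elementary and discrete subgroups\<close>

definition elementary :: "nat \<Rightarrow> quat mat set \<Rightarrow> bool"
  where "elementary n G \<longleftrightarrow>
    (\<exists>p\<in>hyp_space n \<union> hyp_boundary n. finite ((\<lambda>A. act A p) ` G))"

text \<open>The type of matrices of arbitrary size carries no topology, so the topology of the matrix
  entries is taken from the product topology on functions.\<close>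

definition entries :: "quat mat \<Rightarrow> nat \<times> nat \<Rightarrow> quat"
  where "entries A = (\<lambda>(i, j). if i < dim_row A \<and> j < dim_col A then A $$ (i, j) else 0)"

definition discrete_group :: "quat mat set \<Rightarrow> bool"
  where "discrete_group G \<longleftrightarrow> discrete (entries ` G)"

end

theory Submission
  imports Defs "Jordan_Normal_Form.Spectral_Radius"
begin

text \<open>
  A loxodromic \<open>g\<close> is diagonalised: quasi-reflections of \<open>Sp(n,1)\<close> move its null eigenvectors
  \<open>U\<close>, \<open>W\<close> to the two isotropic basis vectors, and the eigenvectors of the definite block to the other
  basis vectors.  For \<open>h\<close> in \<open>Sp(n,1)\<close> let \<open>a, b, c, d\<close> be the absolute values of its corner entries
  \<open>\<langle>hU,W\<rangle>\<close>, \<open>\<langle>hW,W\<rangle>\<close>, \<open>\<langle>hU,U\<rangle>\<close>, \<open>\<langle>hW,U\<rangle>\<close>; the cross-ratios of the theorem are \<open>bc\<close>, \<open>ad\<close> and \<open>bc/ad\<close>.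
  With \<open>X = \<surd>(ad)\<close> and \<open>Y = \<surd>(bc)\<close>, Ptolemy's inequality gives \<open>\<bar>X - Y\<bar> \<le> 1\<close>, so that each of the
  four conditions implies \<open>X Y < (1 - M) / M\<^sup>2\<close>.

  Replacing \<open>h\<close> by \<open>h g h\<^sup>-\<^sup>1\<close> turns \<open>b\<close> and \<open>c\<close> into at most \<open>M a b\<close> and \<open>M c d\<close>.  Iterating,
  \<open>Y\<^sub>k \<longlonglongrightarrow> 0\<close>, and \<open>g\<^sup>-\<^sup>k h\<^sub>2\<^sub>k g\<^sup>k\<close> is a bounded sequence with off-diagonal corners tending to \<open>0\<close>.
  In a discrete group it has finite range, so eventually \<open>h\<^sub>2\<^sub>k\<close> fixes the fixed points of \<open>g\<close>;
  descending along the sequence, \<open>h\<close> preserves the set of these two points.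
\<close>

text \<open>The bound \<open>(1 - M) / M\<^sup>2\<close> arises as follows: one conjugation gives
  \<open>Y\<^sub>1 \<le> M X\<^sub>0 Y\<^sub>0\<close>, so the bound yields
  \<open>M (1 + Y\<^sub>1) < 1\<close>, and since \<open>X\<^sub>k \<le> 1 + Y\<^sub>k\<close>,
  every later step contracts \<open>Y\<close> by at least this factor. The factor \<open>M\<close>
  comes from nullity: for \<open>h g h\<^sup>-\<^sup>1\<close> the corner \<open>b\<close> is
  \<open>|\<langle>g y, y\<rangle>|\<close> with \<open>y = h\<^sup>-\<^sup>1 W\<close> null, so
  \<open>g\<close> may be replaced by \<open>g - 1\<close>, and Cauchy-Schwarz on the definite part
  contributes \<open>2 \<delta>\<close>. The obstacle is that only the product \<open>b c\<close> is
  contracted. The bound on \<open>a\<close> tends merely to \<open>L = |\<lambda>\<^sub>n|\<close>,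
  so \<open>b\<close> may grow like \<open>(M L)\<^sup>k\<close>. Conjugation by
  \<open>g\<^sup>k\<close> divides \<open>b\<close> by \<open>L\<^sup>2\<^sup>k\<close>, multiplies
  \<open>c\<close> by it and leaves \<open>a\<close> and \<open>d\<close> alone, hence its use
  before discreteness is invoked. In the descent, every term after \<open>h\<close> is a conjugate
  of \<open>g\<close> and cannot interchange the two points: its square would fix both, whereas
  \<open>g\<close> and its square have the same fixed points. Only \<open>h\<close> itself may
  interchange them, which still leaves a finite orbit.\<close>

unbundle no vec_syntax

text \<open>Keeps the dimension \<open>n + 1\<close> from being rewritten to \<open>Suc n\<close>.\<close>

declare One_nat_def [simp del]

section \<open>Conjugation, right scaling and sesquilinearity of the form\<close>

lemma qcnj_zero_iff [simp]: "qcnj q = 0 \<longleftrightarrow> q = 0"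
  by (auto simp: quat_eq_iff)

lemma qcnj_zero [simp]: "qcnj 0 = 0"
  by simp

lemma qcnj_one [simp]: "qcnj 1 = 1"
  by (simp add: quat_eq_iff)

lemma qcnj_minus [simp]: "qcnj (- q) = - qcnj q"
  by (simp add: quat_eq_iff)

lemma qcnj_inverse: "qcnj (inverse q) = inverse (qcnj q)"
proof (cases "q = 0")
  case False
  then have "qcnj (inverse q) * qcnj q = 1"
    by (simp flip: qcnj_mult)
  then show ?thesis
    by (metis inverse_inverse_eq inverse_unique)
qed simp

lemma rscale_dim [simp]: "dim_vec (rscale z c) = dim_vec z"
  by (simp add: rscale_def)

lemma rscale_carrier [simp]: "z \<in> carrier_vec m \<Longrightarrow> rscale z c \<in> carrier_vec m"
  by (simp add: rscale_def)

lemma rscale_index [simp]: "i < dim_vec z \<Longrightarrow> rscale z c $ i = z $ i * c"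
  by (simp add: rscale_def)

lemma rscale_rscale: "rscale (rscale z a) b = rscale z (a * b)"
  by (rule eq_vecI) (simp_all add: mult.assoc)

lemma rscale_one [simp]: "rscale z 1 = z"
  by (rule eq_vecI) simp_all

lemma mult_mat_vec_rscale:
  "A \<in> carrier_mat m k \<Longrightarrow> z \<in> carrier_vec k \<Longrightarrow> A *\<^sub>v rscale z c = rscale (A *\<^sub>v z) c"
  by (rule eq_vecI) (auto simp: scalar_prod_def sum_distrib_right mult.assoc)

lemma mat_eqI_vec:
  fixes A B :: "'a :: semiring_1 mat"
  assumes A: "A \<in> carrier_mat m k" and B: "B \<in> carrier_mat m k"
    and eq: "\<And>j. j < k \<Longrightarrow> A *\<^sub>v unit_vec k j = B *\<^sub>v unit_vec k j"
  shows "A = B"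
proof (rule eq_matI)
  fix i j assume ij: "i < dim_row B" "j < dim_col B"
  have "C $$ (i, j) = (C *\<^sub>v unit_vec k j) $ i" if "C \<in> carrier_mat m k" for C :: "'a mat"
    using that ij B by (auto simp: scalar_prod_right_unit)
  then show "A $$ (i, j) = B $$ (i, j)"
    using A B ij eq by (metis carrier_matD(2))
qed (use A B in auto)

lemma proj_rscale:
  assumes "c \<noteq> 0"
  shows "proj (rscale z c) = proj z"
proof -
  have "\<exists>c'. rscale z d = rscale z (c * c') \<and> c' \<noteq> 0" if "d \<noteq> 0" for d
    using assms that by (intro exI [of _ "inverse c * d"]) (simp flip: mult.assoc)
  then show ?thesis
    using assms by (fastforce simp: proj_def rscale_rscale)
qed

lemma proj_eq_iff: "proj z = proj w \<longleftrightarrow> (\<exists>c. c \<noteq> 0 \<and> z = rscale w c)"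
proof
  assume "proj z = proj w"
  moreover have "z \<in> proj z"
    unfolding proj_def using rscale_one [of z, symmetric] zero_neq_one by fastforce
  ultimately show "\<exists>c. c \<noteq> 0 \<and> z = rscale w c"
    by (auto simp: proj_def)
qed (auto simp: proj_rscale)

lemma form_add_left:
  "n \<ge> 1 \<Longrightarrow> x \<in> carrier_vec (n + 1) \<Longrightarrow> y \<in> carrier_vec (n + 1)
    \<Longrightarrow> form n (x + y) z = form n x z + form n y z"
  by (simp add: form_def algebra_simps sum.distrib)

lemma form_add_right:
  "n \<ge> 1 \<Longrightarrow> x \<in> carrier_vec (n + 1) \<Longrightarrow> y \<in> carrier_vec (n + 1)
    \<Longrightarrow> form n z (x + y) = form n z x + form n z y"
  by (simp add: form_def algebra_simps sum.distrib qcnj_add)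

lemma form_diff_left:
  "n \<ge> 1 \<Longrightarrow> x \<in> carrier_vec (n + 1) \<Longrightarrow> y \<in> carrier_vec (n + 1)
    \<Longrightarrow> form n (x - y) z = form n x z - form n y z"
  by (simp add: form_def algebra_simps sum_subtractf)

lemma form_diff_right:
  "n \<ge> 1 \<Longrightarrow> x \<in> carrier_vec (n + 1) \<Longrightarrow> y \<in> carrier_vec (n + 1)
    \<Longrightarrow> form n z (x - y) = form n z x - form n z y"
  by (simp add: form_def algebra_simps sum_subtractf qcnj_diff)

lemma form_rscale_left:
  "n \<ge> 1 \<Longrightarrow> x \<in> carrier_vec (n + 1) \<Longrightarrow> form n (rscale x a) y = form n x y * a"
  by (simp add: form_def sum_distrib_right algebra_simps)

lemma form_rscale_right:
  "n \<ge> 1 \<Longrightarrow> y \<in> carrier_vec (n + 1) \<Longrightarrow> form n x (rscale y a) = qcnj a * form n x y"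
  by (simp add: form_def sum_distrib_left algebra_simps qcnj_mult)

lemma norm_form_commute: "norm (form n x y) = norm (form n y x)"
  by (metis norm_qcnj qcnj_form)

lemma form_swap_eq_0: "form n x y = 0 \<longleftrightarrow> form n y x = 0"
  by (metis qcnj_form qcnj_zero_iff)

lemma form_unit_right:
  assumes "n \<ge> 1" "i < n + 1"
  shows "form n x (unit_vec (n + 1) i) =
    (if i < n - 1 then x $ i else if i = n - 1 then - x $ n else - x $ (n - 1))"
proof -
  have s: "(\<Sum>j<n - 1. qcnj (unit_vec (n + 1) i $ j) * x $ j) = (if i < n - 1 then x $ i else 0)"
  proof -
    have "(\<Sum>j<n - 1. qcnj (unit_vec (n + 1) i $ j) * x $ j) = (\<Sum>j<n - 1. if j = i then x $ i else 0)"
      using assms by (intro sum.cong) auto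
    then show ?thesis by simp
  qed
  show ?thesis
    unfolding form_def s using assms by auto
qed

lemma unit_vec_null:
  assumes "n \<ge> 1"
  shows "form n (unit_vec (n + 1) n) (unit_vec (n + 1) n) = 0"
    "form n (unit_vec (n + 1) (n - 1)) (unit_vec (n + 1) (n - 1)) = 0"
    "form n (unit_vec (n + 1) (n - 1)) (unit_vec (n + 1) n) = - 1"
    "form n (unit_vec (n + 1) n) (unit_vec (n + 1) (n - 1)) = - 1"
  using assms by (subst form_unit_right; auto)+

section \<open>The group Sp(n,1)\<close>

lemma Sp_simps [simp]:
  "monoid.mult (Sp n) = (*)" "one (Sp n) = 1\<^sub>m (n + 1)"
  by (simp_all add: Sp_def)

lemma Sp_carrierD:
  assumes "A \<in> carrier (Sp n)"
  shows "A \<in> carrier_mat (n + 1) (n + 1)"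
    and "z \<in> carrier_vec (n + 1) \<Longrightarrow> w \<in> carrier_vec (n + 1) \<Longrightarrow>
      form n (A *\<^sub>v z) (A *\<^sub>v w) = form n z w"
  using assms by (auto simp: Sp_def)

lemma Sp_carrierI:
  assumes A: "A \<in> carrier_mat (n + 1) (n + 1)" and B: "B \<in> carrier_mat (n + 1) (n + 1)"
    and "A * B = 1\<^sub>m (n + 1)" "B * A = 1\<^sub>m (n + 1)"
    and "\<And>z w. z \<in> carrier_vec (n + 1) \<Longrightarrow> w \<in> carrier_vec (n + 1) \<Longrightarrow>
      form n (A *\<^sub>v z) (A *\<^sub>v w) = form n z w"
  shows "A \<in> carrier (Sp n)"
proof -
  have "invertible_mat A"
    unfolding invertible_mat_def inverts_mat_def using assms by (auto intro!: exI [of _ B])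
  then show ?thesis using assms by (simp add: Sp_def)
qed

lemma Sp_inverse:
  assumes "A \<in> carrier (Sp n)"
  obtains B where "B \<in> carrier (Sp n)" "A * B = 1\<^sub>m (n + 1)" "B * A = 1\<^sub>m (n + 1)"
proof -
  have A: "A \<in> carrier_mat (n + 1) (n + 1)"
    using assms by (rule Sp_carrierD)
  from assms obtain B where B: "A * B = 1\<^sub>m (dim_row A)" "B * A = 1\<^sub>m (dim_row B)"
    by (auto simp: Sp_def invertible_mat_def inverts_mat_def)
  \<comment> \<open>The inverse provided by \<open>invertible_mat\<close> comes without dimensions;
    they are recovered by comparing column counts in the two products.\<close>
  have "dim_col (A * B) = dim_row A" "dim_col (B * A) = dim_row B"
    unfolding B by simp_all
  then have Bc: "B \<in> carrier_mat (n + 1) (n + 1)"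
    using A by auto
  have AB: "A *\<^sub>v (B *\<^sub>v z) = z" if "z \<in> carrier_vec (n + 1)" for z
    using that B A Bc by (metis assoc_mult_mat_vec carrier_matD(1) one_mult_mat_vec)
  have "form n (B *\<^sub>v z) (B *\<^sub>v w) = form n z w"
    if "z \<in> carrier_vec (n + 1)" "w \<in> carrier_vec (n + 1)" for z w
    using Sp_carrierD(2) [OF assms, of "B *\<^sub>v z" "B *\<^sub>v w"] that Bc by (simp add: AB)
  then have "B \<in> carrier (Sp n)"
    using A B Bc by (intro Sp_carrierI [of B n A]) auto
  with that show thesis using A B Bc by auto
qed

lemma Sp_group: "group (Sp n)"
proof (rule groupI)
  show "\<one>\<^bsub>Sp n\<^esub> \<in> carrier (Sp n)"
    by (auto intro!: Sp_carrierI [of _ n "1\<^sub>m (n + 1)"])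
next
  fix A B assume AB: "A \<in> carrier (Sp n)" "B \<in> carrier (Sp n)"
  note c = AB [THEN Sp_carrierD(1)]
  obtain A' where A': "A' \<in> carrier (Sp n)" "A * A' = 1\<^sub>m (n + 1)" "A' * A = 1\<^sub>m (n + 1)"
    using Sp_inverse AB by blast
  obtain B' where B': "B' \<in> carrier (Sp n)" "B * B' = 1\<^sub>m (n + 1)" "B' * B = 1\<^sub>m (n + 1)"
    using Sp_inverse AB by blast
  note c' = A'(1) [THEN Sp_carrierD(1)] B'(1) [THEN Sp_carrierD(1)]
  have "A * B * (B' * A') = A * (B * B') * A'" "B' * A' * (A * B) = B' * (A' * A) * B"
    using c c' by (simp_all add: assoc_mult_mat [of _ "n+1" "n+1" _ "n+1" _ "n+1"])
  then have "A * B * (B' * A') = 1\<^sub>m (n + 1)" "B' * A' * (A * B) = 1\<^sub>m (n + 1)"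
    using A' B' c c' by (simp_all add: right_mult_one_mat [of _ "n + 1"])
  then show "A \<otimes>\<^bsub>Sp n\<^esub> B \<in> carrier (Sp n)"
    using AB c c' by (auto intro!: Sp_carrierI [of _ n "B' * A'"] simp: Sp_carrierD(2)
      assoc_mult_mat_vec [of _ "n+1" "n+1" _ "n+1"])
  fix C assume "C \<in> carrier (Sp n)"
  then show "A \<otimes>\<^bsub>Sp n\<^esub> B \<otimes>\<^bsub>Sp n\<^esub> C = A \<otimes>\<^bsub>Sp n\<^esub> (B \<otimes>\<^bsub>Sp n\<^esub> C)"
    using c Sp_carrierD(1) by (auto intro!: assoc_mult_mat)
next
  fix A assume A: "A \<in> carrier (Sp n)"
  then show "\<one>\<^bsub>Sp n\<^esub> \<otimes>\<^bsub>Sp n\<^esub> A = A"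
    using Sp_carrierD(1) [OF A] by (simp add: left_mult_one_mat)
  show "\<exists>B\<in>carrier (Sp n). B \<otimes>\<^bsub>Sp n\<^esub> A = \<one>\<^bsub>Sp n\<^esub>"
    using A by (auto elim: Sp_inverse)
qed

lemma Sp_m_closed: "A \<in> carrier (Sp n) \<Longrightarrow> B \<in> carrier (Sp n) \<Longrightarrow> A * B \<in> carrier (Sp n)"
  using monoid.m_closed [OF group.is_monoid [OF Sp_group], of A n B] by simp

lemma Sp_inv_closed: "A \<in> carrier (Sp n) \<Longrightarrow> inv\<^bsub>Sp n\<^esub> A \<in> carrier (Sp n)"
  by (rule group.inv_closed [OF Sp_group])

lemma Sp_one_closed: "1\<^sub>m (n + 1) \<in> carrier (Sp n)"
  using monoid.one_closed [OF group.is_monoid [OF Sp_group], of n] by simp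

lemma Sp_mult_vec:
  "A \<in> carrier (Sp n) \<Longrightarrow> z \<in> carrier_vec (n + 1) \<Longrightarrow> A *\<^sub>v z \<in> carrier_vec (n + 1)"
  by (rule mult_mat_vec_carrier [OF Sp_carrierD(1)])

lemma Sp_mult_mult_vec:
  "A \<in> carrier (Sp n) \<Longrightarrow> B \<in> carrier (Sp n) \<Longrightarrow> z \<in> carrier_vec (n + 1) \<Longrightarrow>
    (A * B) *\<^sub>v z = A *\<^sub>v (B *\<^sub>v z)"
  by (rule assoc_mult_mat_vec [OF Sp_carrierD(1) Sp_carrierD(1)])

lemma Sp_inv_vec:
  assumes "A \<in> carrier (Sp n)" "z \<in> carrier_vec (n + 1)"
  shows "A *\<^sub>v (inv\<^bsub>Sp n\<^esub> A *\<^sub>v z) = z" "inv\<^bsub>Sp n\<^esub> A *\<^sub>v (A *\<^sub>v z) = z"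
proof -
  interpret group "Sp n" by (rule Sp_group)
  show "A *\<^sub>v (inv\<^bsub>Sp n\<^esub> A *\<^sub>v z) = z" "inv\<^bsub>Sp n\<^esub> A *\<^sub>v (A *\<^sub>v z) = z"
    using assms r_inv [of A] l_inv [of A] Sp_mult_mult_vec [of A n "inv\<^bsub>Sp n\<^esub> A" z]
      Sp_mult_mult_vec [of "inv\<^bsub>Sp n\<^esub> A" n A z] by simp_all
qed

lemma Sp_form_inv:
  assumes "A \<in> carrier (Sp n)" "z \<in> carrier_vec (n + 1)" "w \<in> carrier_vec (n + 1)"
  shows "form n (inv\<^bsub>Sp n\<^esub> A *\<^sub>v z) w = form n z (A *\<^sub>v w)"
    and "form n w (inv\<^bsub>Sp n\<^esub> A *\<^sub>v z) = form n (A *\<^sub>v w) z"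
proof -
  have i: "inv\<^bsub>Sp n\<^esub> A \<in> carrier (Sp n)"
    using assms Sp_group group.inv_closed by metis
  note iz = Sp_mult_vec [OF i assms(2)]
  show "form n (inv\<^bsub>Sp n\<^esub> A *\<^sub>v z) w = form n z (A *\<^sub>v w)"
    using Sp_carrierD(2) [OF assms(1) iz assms(3)] by (simp only: Sp_inv_vec [OF assms(1,2)])
  show "form n w (inv\<^bsub>Sp n\<^esub> A *\<^sub>v z) = form n (A *\<^sub>v w) z"
    using Sp_carrierD(2) [OF assms(1,3) iz] by (simp only: Sp_inv_vec [OF assms(1,2)])
qed

section \<open>Quasi-reflections\<close>

text \<open>The matrix of \<open>x \<mapsto> x + w c \<langle>x, w\<rangle>\<close>; the factor
  \<open>c\<close> stands between \<open>w\<close> and the form value because scalars act on the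
  right.\<close>

definition qref :: "nat \<Rightarrow> quat vec \<Rightarrow> quat \<Rightarrow> quat mat" where
  "qref n w c = mat (n + 1) (n + 1) (\<lambda>(i, j). (if i = j then 1 else 0)
     + w $ i * c * form n (unit_vec (n + 1) j) w)"

text \<open>Right linearity in the first argument, applied to \<open>x\<close> as a combination of
  basis vectors. This is what makes the columns of \<open>qref\<close> compute the intended
  map.\<close>

lemma form_expand:
  assumes "n \<ge> 1" "x \<in> carrier_vec (n + 1)"
  shows "(\<Sum>j<n + 1. form n (unit_vec (n + 1) j) w * x $ j) = form n x w"
proof -
  obtain m where m: "n = Suc m" using assms(1) by (cases n) auto
  have 1: "form n (unit_vec (n + 1) j) w = qcnj (w $ j)" if "j < m" for j
    using that m by (subst qcnj_form [symmetric], subst form_unit_right) auto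
  have 2: "form n (unit_vec (n + 1) m) w = - qcnj (w $ Suc m)"
    using m by (subst qcnj_form [symmetric], subst form_unit_right) auto
  have 3: "form n (unit_vec (n + 1) (Suc m)) w = - qcnj (w $ m)"
    using m by (subst qcnj_form [symmetric], subst form_unit_right) auto
  have "(\<Sum>j<n + 1. form n (unit_vec (n + 1) j) w * x $ j)
     = (\<Sum>j<m. form n (unit_vec (n + 1) j) w * x $ j)
       + form n (unit_vec (n + 1) m) w * x $ m + form n (unit_vec (n + 1) (Suc m)) w * x $ Suc m"
    using m by (simp add: One_nat_def)
  also have "(\<Sum>j<m. form n (unit_vec (n + 1) j) w * x $ j) = (\<Sum>j<m. qcnj (w $ j) * x $ j)"
    by (rule sum.cong) (simp_all add: 1)
  finally show ?thesis
    unfolding 2 3 using m by (simp add: form_def algebra_simps)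
qed

lemma qref_carrier [simp]: "qref n w c \<in> carrier_mat (n + 1) (n + 1)"
  by (simp add: qref_def)

lemma qref_vec:
  assumes "n \<ge> 1" "w \<in> carrier_vec (n + 1)" "x \<in> carrier_vec (n + 1)"
  shows "qref n w c *\<^sub>v x = x + rscale w (c * form n x w)"
proof (rule eq_vecI)
  fix i assume "i < dim_vec (x + rscale w (c * form n x w))"
  then have i: "i < n + 1" using assms by simp
  have "(qref n w c *\<^sub>v x) $ i =
      (\<Sum>j<n + 1. ((if i = j then 1 else 0) + w $ i * c * form n (unit_vec (n + 1) j) w) * x $ j)"
    using i assms by (simp add: qref_def scalar_prod_def atLeast0LessThan)
  also have "\<dots> = (\<Sum>j<n + 1. if i = j then x $ j else 0)
      + (\<Sum>j<n + 1. w $ i * c * (form n (unit_vec (n + 1) j) w * x $ j))"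
    by (subst sum.distrib [symmetric], rule sum.cong) (auto simp: distrib_right mult.assoc)
  also have "\<dots> = x $ i + w $ i * c * form n x w"
    using i assms by (simp add: form_expand flip: sum_distrib_left)
  finally show "(qref n w c *\<^sub>v x) $ i = (x + rscale w (c * form n x w)) $ i"
    using i assms by (simp add: mult.assoc)
qed (use assms in \<open>simp add: qref_def\<close>)

text \<open>Expanding \<open>\<langle>Tz, Ty\<rangle>\<close> leaves the error \<open>\<langle>w,
  y\<rangle> (c + qcnj c + qcnj c \<langle>w, w\<rangle> c) \<langle>z, w\<rangle>\<close>, which
  the hypothesis on \<open>c\<close> kills. As \<open>\<langle>w, w\<rangle>\<close> is real and
  \<open>c\<close> commutes with its conjugate, the same equation shows that
  \<open>qref n w (qcnj c)\<close> is the inverse.\<close>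

lemma qref_Sp:
  assumes n: "n \<ge> 1" and w: "w \<in> carrier_vec (n + 1)"
    and c: "c + qcnj c + qcnj c * form n w w * c = 0"
  shows "qref n w c \<in> carrier (Sp n)"
proof -
  have comm: "qcnj c * form n w w * c = c * form n w w * qcnj c"
    by (subst (1 2) form_self_real) (simp add: quat_eq_iff of_real_def algebra_simps)
  have c': "qcnj c + c + c * form n w w * qcnj c = 0"
    using c unfolding comm by (simp add: algebra_simps)
  have id: "qref n w a * qref n w b = 1\<^sub>m (n + 1)" if "a + b + a * form n w w * b = 0" for a b
  proof (rule mat_eqI_vec [of _ "n + 1" "n + 1"])
    fix j assume "j < n + 1"
    define x :: "quat vec" where "x = unit_vec (n + 1) j"
    have x: "x \<in> carrier_vec (n + 1)" by (simp add: x_def)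
    have "(qref n w a * qref n w b) *\<^sub>v x = qref n w a *\<^sub>v (qref n w b *\<^sub>v x)"
      using x by (intro assoc_mult_mat_vec [of _ "n + 1" "n + 1" _ "n + 1"]) auto
    also have "\<dots> = (x + rscale w (b * form n x w))
      + rscale w (a * form n (x + rscale w (b * form n x w)) w)"
      using n w x by (simp add: qref_vec)
    also have "\<dots> = x"
    proof (rule eq_vecI)
      fix i assume i: "i < dim_vec x"
      have "b * form n x w + a * form n (x + rscale w (b * form n x w)) w
          = (a + b + a * form n w w * b) * form n x w"
        using n w x by (simp add: form_add_left form_rscale_left algebra_simps)
      then have "b * form n x w + a * form n (x + rscale w (b * form n x w)) w = 0"
        using that by simp
      moreover have "(x + rscale w (b * form n x w)
          + rscale w (a * form n (x + rscale w (b * form n x w)) w)) $ i =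
        x $ i + w $ i * (b * form n x w + a * form n (x + rscale w (b * form n x w)) w)"
        using i w x by (simp add: distrib_left add.assoc)
      ultimately show "(x + rscale w (b * form n x w)
          + rscale w (a * form n (x + rscale w (b * form n x w)) w)) $ i = x $ i"
        by simp
    qed (use w x in simp)
    finally show "(qref n w a * qref n w b) *\<^sub>v unit_vec (n + 1) j = 1\<^sub>m (n + 1) *\<^sub>v unit_vec (n + 1) j"
      by (simp add: x_def)
  qed (auto simp: qref_def)
  show ?thesis
  proof (rule Sp_carrierI [of _ n "qref n w (qcnj c)"])
    show "qref n w c * qref n w (qcnj c) = 1\<^sub>m (n + 1)"
      using c comm by (intro id) simp
    show "qref n w (qcnj c) * qref n w c = 1\<^sub>m (n + 1)"
      using c by (intro id) (simp add: algebra_simps)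
  next
    fix z y :: "quat vec" assume z: "z \<in> carrier_vec (n + 1)" and y: "y \<in> carrier_vec (n + 1)"
    have "form n (qref n w c *\<^sub>v z) (qref n w c *\<^sub>v y) = form n z y
      + form n w y * (c + qcnj c + qcnj c * form n w w * c) * form n z w"
      using n w z y by (simp add: qref_vec form_add_left form_add_right form_rscale_left
        form_rscale_right qcnj_mult qcnj_form algebra_simps)
    then show "form n (qref n w c *\<^sub>v z) (qref n w c *\<^sub>v y) = form n z y"
      using c by simp
  qed simp_all
qed

text \<open>The quasi-reflection \<open>x \<mapsto> x + w c \<langle>x, w\<rangle>\<close> with \<open>w = y - x\<close> and \<open>c = \<langle>x, w\<rangle>\<^sup>-\<^sup>1\<close> is unitary
  precisely because \<open>x\<close> and \<open>y\<close> have the same norm.\<close>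

lemma Sp_move:
  assumes n: "n \<ge> 1" and x: "x \<in> carrier_vec (n + 1)" and y: "y \<in> carrier_vec (n + 1)"
    and eq: "form n x x = form n y y" and ne: "form n x y \<noteq> form n x x"
  obtains T where "T \<in> carrier (Sp n)" "T *\<^sub>v x = y"
    "\<And>z. z \<in> carrier_vec (n + 1) \<Longrightarrow> form n z (y - x) = 0 \<Longrightarrow> T *\<^sub>v z = z"
proof -
  define w where "w = y - x"
  define a where "a = form n x w"
  have w: "w \<in> carrier_vec (n + 1)" using x y by (simp add: w_def)
  have a: "a = form n x y - form n x x"
    using n x y by (simp add: a_def w_def form_diff_right)
  then have a0: "a \<noteq> 0" using ne by simp
  have ww: "form n w w = - a - qcnj a"
    unfolding a using n x y eq [symmetric]
    by (simp add: w_def form_diff_right form_diff_left qcnj_diff qcnj_form algebra_simps)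
  define c where "c = inverse a"
  have ca: "c * a = 1" "a * c = 1" "qcnj c * qcnj a = 1"
    using a0 by (simp_all add: c_def qcnj_inverse)
  have "qcnj c * form n w w * c = - (qcnj c * (a * c)) - (qcnj c * qcnj a) * c"
    by (simp add: ww algebra_simps)
  then have "c + qcnj c + qcnj c * form n w w * c = 0"
    unfolding ca by simp
  then have T: "qref n w c \<in> carrier (Sp n)"
    using n w by (intro qref_Sp)
  show thesis
  proof (rule that [OF T])
    show "qref n w c *\<^sub>v x = y"
      using n w x y by (simp add: qref_vec ca flip: a_def) (auto simp: w_def)
    show "qref n w c *\<^sub>v z = z" if "z \<in> carrier_vec (n + 1)" "form n z (y - x) = 0" for z
      using n w that by (auto simp: qref_vec simp flip: w_def)
  qed
qed

section \<open>Null vectors and transitivity of Sp(n,1) on them\<close>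

lemma form_self_expand:
  "form n z z = of_real (\<Sum>i<n - 1. (norm (z $ i))\<^sup>2)
     - (qcnj (z $ (n - 1)) * z $ n + qcnj (z $ n) * z $ (n - 1))"
proof -
  have "(norm q)\<^sup>2 *\<^sub>R 1 = (of_real ((norm q)\<^sup>2) :: quat)" for q :: quat
    by (simp add: of_real_def)
  then show ?thesis
    by (simp add: form_def qcnj_mult_self)
qed

lemma sum_norm_eq_0:
  fixes z :: "nat \<Rightarrow> quat"
  assumes "(\<Sum>i<m. (norm (z i))\<^sup>2) = 0" "i < m"
  shows "z i = 0"
proof -
  have "(norm (z i))\<^sup>2 = 0"
    using assms by (subst (asm) sum_nonneg_eq_0_iff) auto
  then show ?thesis by simp
qed

text \<open>Orthogonality to one isotropic basis vector kills the other isotropic coordinate. The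
  self-product is then a sum of squares, so nullity kills the definite coordinates too.\<close>

lemma null_orth_unit:
  assumes n: "n \<ge> 1" and z: "z \<in> carrier_vec (n + 1)" and "form n z z = 0"
    and k: "k = n - 1 \<or> k = n" and 0: "form n z (unit_vec (n + 1) k) = 0"
  shows "z = rscale (unit_vec (n + 1) k) (z $ k)"
proof -
  have zk: "z $ (if k = n then n - 1 else n) = 0"
    using 0 k n by (auto simp: form_unit_right split: if_splits)
  have "(\<Sum>i<n - 1. (norm (z $ i))\<^sup>2) = 0"
  proof -
    have "form n z z = of_real (\<Sum>i<n - 1. (norm (z $ i))\<^sup>2)"
      unfolding form_self_expand using zk k by (auto split: if_splits)
    then show ?thesis
      using assms(3) by (metis of_real_eq_0_iff)
  qed
  then have zi: "z $ i = 0" if "i < n - 1" for i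
    using that sum_norm_eq_0 [of "\<lambda>i. z $ i"] by blast
  show ?thesis
  proof (rule eq_vecI)
    fix i assume i: "i < dim_vec (rscale (unit_vec (n + 1) k) (z $ k))"
    then have "i < n - 1 \<or> i = n - 1 \<or> i = n"
      using n by simp linarith
    then consider "i < n - 1" | "i = k" | "i \<noteq> k" "i = (if k = n then n - 1 else n)"
      using k by (cases "k = n") auto
    then show "z $ i = rscale (unit_vec (n + 1) k) (z $ k) $ i"
      using i k n zi zk by cases (auto split: if_splits)
  qed (use z in simp)
qed

text \<open>A single quasi-reflection works unless \<open>z\<close> is orthogonal to the target; in
  that case \<open>z\<close> is a multiple of the target, and the detour through the other isotropic
  basis vector \<open>l\<close> consists of two admissible moves.\<close>

lemma Sp_move_null:
  assumes n: "n \<ge> 1" and z: "z \<in> V_null n" and k: "k = n - 1 \<or> k = n"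
  obtains T where "T \<in> carrier (Sp n)" "T *\<^sub>v z = unit_vec (n + 1) k"
proof -
  have zc: "z \<in> carrier_vec (n + 1)" "form n z z = 0" and z0: "z \<noteq> 0\<^sub>v (n + 1)"
    using z by (auto simp: V_null_def)
  have unull: "form n (unit_vec (n + 1) k) (unit_vec (n + 1) k) = 0"
    using unit_vec_null [OF n] k by auto
  show thesis
  proof (cases "form n z (unit_vec (n + 1) k) = 0")
    case False
    show thesis
      by (rule Sp_move [of n z "unit_vec (n + 1) k"]) (use n zc False unull that in auto)
  next
    case True
    define l where "l = (if k = n then n - 1 else n)"
    have l: "l = n - 1 \<or> l = n" and kl: "form n (unit_vec (n + 1) k) (unit_vec (n + 1) l) = -1"
      "form n (unit_vec (n + 1) l) (unit_vec (n + 1) k) = -1"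
      using unit_vec_null [OF n] k by (auto simp: l_def)
    have lnull: "form n (unit_vec (n + 1) l) (unit_vec (n + 1) l) = 0"
      using unit_vec_null [OF n] l by auto
    have ze: "z = rscale (unit_vec (n + 1) k) (z $ k)"
      by (rule null_orth_unit [OF n zc k True])
    have "z $ k \<noteq> 0"
    proof
      assume "z $ k = 0"
      then have "z = 0\<^sub>v (n + 1)"
        using ze by (metis (no_types, lifting) eq_vecI index_unit_vec(3) index_zero_vec mult_zero_right rscale_dim rscale_index)
      then show False using z0 by simp
    qed
    then have "form n z (unit_vec (n + 1) l) \<noteq> 0"
      by (subst ze) (simp add: form_rscale_left n kl)
    then obtain T1 where T1: "T1 \<in> carrier (Sp n)" "T1 *\<^sub>v z = unit_vec (n + 1) l"
      by (rule_tac Sp_move [of n z "unit_vec (n + 1) l"]) (use n zc lnull in auto)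
    obtain T2 where T2: "T2 \<in> carrier (Sp n)" "T2 *\<^sub>v unit_vec (n + 1) l = unit_vec (n + 1) k"
      by (rule Sp_move [of n "unit_vec (n + 1) l" "unit_vec (n + 1) k"]) (use n kl unull lnull in auto)
    have "T2 * T1 \<in> carrier (Sp n)"
      using T1 T2 by (simp add: Sp_m_closed)
    then show thesis
      by (rule that) (use T1 T2 zc in \<open>simp add: Sp_mult_mult_vec\<close>)
  qed
qed

text \<open>The value \<open>-1\<close> is that of the basis pair. Once \<open>z\<close> sits at the
  first basis vector \<open>e\<close>, both the image \<open>x\<close> of \<open>y\<close> and its
  target \<open>f\<close> have product \<open>-1\<close> with \<open>e\<close>, so
  \<open>f - x\<close> is orthogonal to \<open>e\<close> and the second quasi-reflection fixes
  \<open>e\<close>. If \<open>x\<close> is orthogonal to \<open>f\<close>, the normalisation already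
  forces \<open>x = f\<close>.\<close>

lemma Sp_move_pair:
  assumes n: "n \<ge> 1" and z: "z \<in> V_null n" and y: "y \<in> V_null n" and zy: "form n z y = -1"
  obtains T where "T \<in> carrier (Sp n)" "T *\<^sub>v z = unit_vec (n + 1) (n - 1)"
    "T *\<^sub>v y = unit_vec (n + 1) n"
proof -
  let ?e = "unit_vec (n + 1) (n - 1)" and ?f = "unit_vec (n + 1) n"
  have c: "z \<in> carrier_vec (n + 1)" "y \<in> carrier_vec (n + 1)" "form n y y = 0"
    using z y by (auto simp: V_null_def)
  obtain T1 where T1: "T1 \<in> carrier (Sp n)" "T1 *\<^sub>v z = ?e"
    using Sp_move_null [OF n z] by metis
  define x where "x = T1 *\<^sub>v y"
  have x: "x \<in> carrier_vec (n + 1)" "form n x x = 0" "form n ?e x = -1"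
    using T1 c zy Sp_carrierD(2) [OF T1(1)] by (auto simp: x_def Sp_mult_vec simp flip: T1(2))
  have "\<exists>T2 \<in> carrier (Sp n). T2 *\<^sub>v x = ?f \<and> T2 *\<^sub>v ?e = ?e"
  proof (cases "form n x ?f = 0")
    case False
    have "form n ?e (?f - x) = 0"
      using n x by (simp add: form_diff_right unit_vec_null)
    then show ?thesis
      by (rule_tac Sp_move [of n x ?f]) (use n x False unit_vec_null in auto)
  next
    case True
    then have xe: "x = rscale ?f (x $ n)"
      using null_orth_unit [OF n x(1,2), of n] by simp
    have "form n ?e x = - qcnj (x $ n)"
      by (subst xe) (simp add: form_rscale_right n unit_vec_null)
    then have "qcnj (x $ n) = qcnj 1" using x(3) by simp
    then have "x $ n = 1" by (metis qcnj_qcnj)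
    then have "x = ?f" using xe by simp
    moreover have "1\<^sub>m (n + 1) \<in> carrier (Sp n)"
      by (rule Sp_one_closed)
    ultimately show ?thesis
      by (intro bexI [of _ "1\<^sub>m (n + 1)"]) simp_all
  qed
  then obtain T2 where T2: "T2 \<in> carrier (Sp n)" "T2 *\<^sub>v x = ?f" "T2 *\<^sub>v ?e = ?e" by blast
  have "T2 * T1 \<in> carrier (Sp n)"
    using T1 T2 by (simp add: Sp_m_closed)
  then show thesis
    by (rule that) (use T1 T2 c in \<open>simp_all add: Sp_mult_mult_vec flip: x_def\<close>)
qed

section \<open>Quaternionic eigenvectors\<close>

text \<open>Together with \<open>qbeta\<close> the coordinates of
  \<open>q = \<alpha> + j \<beta>\<close>. With \<open>j\<close> on the left, right multiplication
  by a complex number multiplies both coordinates by it; the sign at \<open>qK\<close> in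
  \<open>qbeta\<close> reflects \<open>j i = - k\<close>.\<close>

definition qalpha :: "quat \<Rightarrow> complex" where "qalpha q = Complex (qRe q) (qI q)"
definition qbeta :: "quat \<Rightarrow> complex" where "qbeta q = Complex (qJ q) (- qK q)"

lemma qalpha_mult: "qalpha (p * q) = qalpha p * qalpha q - cnj (qbeta p) * qbeta q"
  and qbeta_mult: "qbeta (p * q) = cnj (qalpha p) * qbeta q + qbeta p * qalpha q"
  by (simp_all add: qalpha_def qbeta_def complex_eq_iff algebra_simps)

lemma qalpha_sum: "qalpha (\<Sum>i\<in>A. f i) = (\<Sum>i\<in>A. qalpha (f i))"
  by (induction A rule: infinite_finite_induct) (auto simp: qalpha_def complex_eq_iff)

lemma qbeta_sum: "qbeta (\<Sum>i\<in>A. f i) = (\<Sum>i\<in>A. qbeta (f i))"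
  by (induction A rule: infinite_finite_induct) (auto simp: qbeta_def complex_eq_iff)

lemma quat_eq_iff_alpha_beta: "p = q \<longleftrightarrow> qalpha p = qalpha q \<and> qbeta p = qbeta q"
  by (auto simp: qalpha_def qbeta_def quat_eq_iff)

text \<open>Writing quaternions as \<open>\<alpha> + j \<beta>\<close> with complex \<open>\<alpha>, \<beta>\<close>, a quaternionic matrix becomes a complex
  one of twice the size, and complex eigenvectors are right eigenvectors.\<close>

lemma quat_eigenvector:
  fixes F :: "nat \<Rightarrow> nat \<Rightarrow> quat"
  assumes m: "m > 0"
  shows "\<exists>x c. (\<exists>i<m. x i \<noteq> 0) \<and> (\<forall>i<m. (\<Sum>j<m. F i j * x j) = x i * c)"
proof -
  \<comment> \<open>The four blocks are the coefficients in \<open>qalpha_mult\<close> and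
    \<open>qbeta_mult\<close>: \<open>C\<close> sends the two coordinate vectors of \<open>x\<close>
    to those of \<open>F x\<close>.\<close>
  define C where "C = mat (2 * m) (2 * m) (\<lambda>(i, j).
    if i < m then if j < m then qalpha (F i j) else - cnj (qbeta (F i (j - m)))
    else if j < m then qbeta (F (i - m) j) else cnj (qalpha (F (i - m) (j - m))))"
  have C: "C \<in> carrier_mat (2 * m) (2 * m)" by (simp add: C_def)
  have "spectrum C \<noteq> {}" using spectrum_non_empty [OF C] m by simp
  then obtain k v where v: "eigenvector C v k"
    by (auto simp: spectrum_def eigenvalue_def)
  then have vc: "v \<in> carrier_vec (2 * m)" and v0: "v \<noteq> 0\<^sub>v (2 * m)" and ev: "C *\<^sub>v v = k \<cdot>\<^sub>v v"
    using C by (auto simp: eigenvector_def)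
  define x where "x i = Quat (Re (v $ i)) (Im (v $ i)) (Re (v $ (m + i))) (- Im (v $ (m + i)))" for i
  define c where "c = Quat (Re k) (Im k) 0 0"
  have xa: "qalpha (x i) = v $ i" "qbeta (x i) = v $ (m + i)" for i
    by (simp_all add: qalpha_def qbeta_def x_def)
  have ca: "qalpha c = k" "qbeta c = 0"
    by (simp_all add: qalpha_def qbeta_def c_def complex_eq_iff)
  have split: "(\<Sum>j<2 * m. f j) = (\<Sum>j<m. f j) + (\<Sum>j<m. f (m + j))" for f :: "nat \<Rightarrow> complex"
    using sum.nat_group [of f m 2] sum.atLeastLessThan_concat [of 0 m "2 * m" f]
      sum.shift_bounds_nat_ivl [of f 0 m m]
    by (simp add: atLeast0LessThan mult_2 add.commute)
  have Cv: "(\<Sum>j<2 * m. C $$ (i, j) * v $ j) = k * v $ i" if "i < 2 * m" for i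
    using arg_cong [OF ev, of "\<lambda>w. w $ i"] that C vc
    by (simp add: scalar_prod_def atLeast0LessThan)
  have "(\<Sum>j<m. F i j * x j) = x i * c" if i: "i < m" for i
    unfolding quat_eq_iff_alpha_beta qalpha_sum qbeta_sum
  proof
    show "(\<Sum>j<m. qalpha (F i j * x j)) = qalpha (x i * c)"
      using Cv [of i] i unfolding split
      by (simp add: C_def qalpha_mult xa ca sum_subtractf sum_negf algebra_simps)
    show "(\<Sum>j<m. qbeta (F i j * x j)) = qbeta (x i * c)"
      using Cv [of "m + i"] i unfolding split
      by (simp add: C_def qbeta_mult xa ca sum.distrib algebra_simps)
  qed
  moreover have "\<exists>i<m. x i \<noteq> 0"
  proof (rule ccontr)
    assume "\<not> ?thesis"
    then have 0: "v $ i = 0" "v $ (m + i) = 0" if "i < m" for i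
      using that xa [of i] by (auto simp: qalpha_def qbeta_def complex_eq_iff)
    have "v = 0\<^sub>v (2 * m)"
    proof (rule eq_vecI)
      fix i assume "i < dim_vec (0\<^sub>v (2 * m) :: complex vec)"
      then show "v $ i = 0\<^sub>v (2 * m) $ i"
        using 0(1) [of i] 0(2) [of "i - m"] by (cases "i < m") auto
    qed (use vc in simp)
    with v0 show False ..
  qed
  ultimately show ?thesis by blast
qed

section \<open>Diagonalisation of loxodromic elements\<close>

lemma Sp_rscale:
  "A \<in> carrier (Sp n) \<Longrightarrow> z \<in> carrier_vec (n + 1) \<Longrightarrow> A *\<^sub>v rscale z c = rscale (A *\<^sub>v z) c"
  by (rule mult_mat_vec_rscale [OF Sp_carrierD(1)])

lemma rscale_zero: "z \<in> carrier_vec m \<Longrightarrow> rscale z 0 = 0\<^sub>v m"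
  by (rule eq_vecI) auto

lemma Sp_eigen_nonzero:
  assumes A: "A \<in> carrier (Sp n)" and z: "z \<in> carrier_vec (n + 1)" "z \<noteq> 0\<^sub>v (n + 1)"
    and eq: "A *\<^sub>v z = rscale z c"
  shows "c \<noteq> 0"
proof
  assume "c = 0"
  then have "z = inv\<^bsub>Sp n\<^esub> A *\<^sub>v rscale z 0"
    using Sp_inv_vec(2) [OF A z(1)] eq by simp
  also have "\<dots> = rscale (inv\<^bsub>Sp n\<^esub> A *\<^sub>v z) 0"
    by (rule Sp_rscale [OF Sp_inv_closed [OF A] z(1)])
  also have "\<dots> = 0\<^sub>v (n + 1)"
    by (rule rscale_zero [OF Sp_mult_vec [OF Sp_inv_closed [OF A] z(1)]])
  finally show False using z by simp
qed

lemma Sp_mult_nonzero: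
  assumes "A \<in> carrier (Sp n)" "z \<in> carrier_vec (n + 1)" "z \<noteq> 0\<^sub>v (n + 1)"
  shows "A *\<^sub>v z \<noteq> 0\<^sub>v (n + 1)"
proof
  assume "A *\<^sub>v z = 0\<^sub>v (n + 1)"
  then have "A *\<^sub>v z = rscale z 0" using assms by (simp add: rscale_zero)
  then show False using Sp_eigen_nonzero [OF assms] by blast
qed

lemma Sp_V_null: "A \<in> carrier (Sp n) \<Longrightarrow> z \<in> V_null n \<Longrightarrow> A *\<^sub>v z \<in> V_null n"
  by (auto simp: V_null_def Sp_mult_vec Sp_mult_nonzero Sp_carrierD(2))

lemma Sp_V_neg: "A \<in> carrier (Sp n) \<Longrightarrow> z \<in> V_neg n \<Longrightarrow> A *\<^sub>v z \<in> V_neg n"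
  by (auto simp: V_neg_def Sp_mult_vec Sp_carrierD(2))

lemma unit_vec_nonzero: "i < m \<Longrightarrow> unit_vec m i \<noteq> (0\<^sub>v m :: 'a :: zero_neq_one vec)"
  by (metis index_unit_vec(1) index_zero_vec(1) zero_neq_one)

lemma form_unit_unit:
  assumes "n \<ge> 1" "i < n - 1"
  shows "form n (unit_vec (n + 1) i) (unit_vec (n + 1) i) = 1"
  using assms by (subst form_unit_right) auto

text \<open>One step of the diagonalisation: \<open>k\<close> marks the first coordinate of the definite part that
  is not yet known to be an eigendirection.\<close>

lemma Sp_eigen_step:
  assumes n: "n \<ge> 1" and g: "g \<in> carrier (Sp n)" and k: "k < n - 1"
    and ev: "\<And>i. i \<in> {..<k} \<union> {n - 1, n} \<Longrightarrow>
      \<exists>c. g *\<^sub>v unit_vec (n + 1) i = rscale (unit_vec (n + 1) i) c"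
  obtains S c where "S \<in> carrier (Sp n)"
    "\<And>i. i \<in> {..<k} \<union> {n - 1, n} \<Longrightarrow> S *\<^sub>v unit_vec (n + 1) i = unit_vec (n + 1) i"
    "g *\<^sub>v (S *\<^sub>v unit_vec (n + 1) k) = rscale (S *\<^sub>v unit_vec (n + 1) k) c"
proof -
  let ?I = "{..<k} \<union> {n - 1, n}"
  let ?e = "\<lambda>i. unit_vec (n + 1) i :: quat vec"
  have Il: "i < n + 1" if "i \<in> ?I" for i
    using that k by auto
  have gc: "g \<in> carrier_mat (n + 1) (n + 1)" by (rule Sp_carrierD(1) [OF g])
  \<comment> \<open>The complement of the known eigendirections is \<open>g\<close>-invariant, since
    \<open>g\<close> scales each of them by a nonzero factor.\<close>
  have perp: "form n (g *\<^sub>v x) (?e i) = 0"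
    if x: "x \<in> carrier_vec (n + 1)" "form n x (?e i) = 0" and i: "i \<in> ?I" for x i
  proof -
    obtain c where c: "g *\<^sub>v ?e i = rscale (?e i) c" using ev i by blast
    have "c \<noteq> 0" by (rule Sp_eigen_nonzero [OF g _ _ c]) (use Il [OF i] unit_vec_nonzero in auto)
    have "form n (g *\<^sub>v x) (g *\<^sub>v ?e i) = 0"
      using Sp_carrierD(2) [OF g x(1), of "?e i"] x by simp
    then show ?thesis
      using \<open>c \<noteq> 0\<close> n by (simp add: c form_rscale_right)
  qed
  \<comment> \<open>Pairing with an isotropic basis vector reads off the coordinate of the other
    one, so the complement consists of the vectors supported in \<open>{k..<n - 1}\<close>, where
    the form is positive definite.\<close>
  have supp: "(\<forall>i\<in>?I. form n x (?e i) = 0) \<longleftrightarrow> (\<forall>i<n + 1. i \<notin> {k..<n - 1} \<longrightarrow> x $ i = 0)" (is "?L \<longleftrightarrow> ?R") for x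
  proof
    assume L: ?L
    show ?R
    proof (intro allI impI)
      fix i assume i: "i < n + 1" "i \<notin> {k..<n - 1}"
      then consider "i < k" | "i = n - 1" | "i = n" by fastforce
      then show "x $ i = 0"
      proof cases
        case 1
        then show ?thesis using L [rule_format, of i] n k by (simp add: form_unit_right)
      next
        case 2
        then show ?thesis using L [rule_format, of n] n k by (simp add: form_unit_right split: if_splits)
      next
        case 3
        then show ?thesis using L [rule_format, of "n - 1"] n k by (simp add: form_unit_right)
      qed
    qed
  next
    assume R: ?R
    show ?L
      using n k R by (auto simp: form_unit_right)
  qed
  define m where "m = n - 1 - k"
  have m: "m > 0" using k by (simp add: m_def)
  \<comment> \<open>An eigenvector of the block of \<open>g\<close> on the remaining definite
    indices. Extended by zero it is one of \<open>g\<close>, because invariance of the complement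
    makes the other entries of \<open>g x\<close> vanish.\<close>
  obtain x' c j0 where j0: "j0 < m" "x' j0 \<noteq> 0"
    and ev': "\<And>i. i < m \<Longrightarrow> (\<Sum>j<m. g $$ (k + i, k + j) * x' j) = x' i * c"
    using quat_eigenvector [OF m, of "\<lambda>i j. g $$ (k + i, k + j)"] by auto
  define x where "x = vec (n + 1) (\<lambda>i. if i \<in> {k..<n - 1} then x' (i - k) else 0)"
  have x: "x \<in> carrier_vec (n + 1)" by (simp add: x_def)
  have xI: "form n x (?e i) = 0" if "i \<in> ?I" for i
    using supp [of x] that by (auto simp: x_def)
  have gx: "g *\<^sub>v x = rscale x c"
  proof (rule eq_vecI)
    fix i assume "i < dim_vec (rscale x c)"
    then have i: "i < n + 1" by (simp add: x_def)
    show "(g *\<^sub>v x) $ i = rscale x c $ i"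
    proof (cases "i \<in> {k..<n - 1}")
      case True
      have "(g *\<^sub>v x) $ i = (\<Sum>j<n + 1. g $$ (i, j) * x $ j)"
        using gc x i by (simp add: scalar_prod_def atLeast0LessThan)
      also have "\<dots> = (\<Sum>j\<in>{k..<n - 1}. g $$ (i, j) * x $ j)"
        by (rule sum.mono_neutral_right) (auto simp: x_def)
      also have "\<dots> = (\<Sum>j\<in>{0 + k..<m + k}. g $$ (i, j) * x' (j - k))"
        using k by (intro sum.cong) (auto simp: x_def m_def)
      also have "\<dots> = (\<Sum>j<m. g $$ (k + (i - k), k + j) * x' j)"
        unfolding sum.shift_bounds_nat_ivl using True by (simp add: atLeast0LessThan add.commute)
      also have "\<dots> = x' (i - k) * c"
        using True by (intro ev') (auto simp: m_def)
      finally show ?thesis using True i by (simp add: x_def)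
    next
      case False
      have "\<forall>i\<in>?I. form n (g *\<^sub>v x) (?e i) = 0"
        using perp [OF x] xI by blast
      then have "(g *\<^sub>v x) $ i = 0"
        using supp [of "g *\<^sub>v x"] False i by blast
      then show ?thesis using False i by (auto simp: x_def)
    qed
  qed (use gc x in auto)
  have pos: "form n w w = of_real (\<Sum>i<n - 1. (norm (w $ i))\<^sup>2)"
    if "\<And>i. i \<in> ?I \<Longrightarrow> form n w (?e i) = 0" for w
    unfolding form_self_expand using supp [of w] that k by auto
  define r where "r = (\<Sum>i<n - 1. (norm (x $ i))\<^sup>2)"
  have fx: "form n x x = of_real r" unfolding r_def using pos xI by blast
  have "r \<noteq> 0"
  proof
    assume "r = 0"
    then have "x $ (k + j0) = 0"
      using sum_norm_eq_0 [of "\<lambda>i. x $ i" "n - 1" "k + j0"] j0(1) by (simp add: r_def m_def)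
    moreover have "k + j0 < n - 1" using j0 by (simp add: m_def)
    ultimately show False using j0 by (simp add: x_def)
  qed
  then have r: "r > 0" unfolding r_def by (simp add: less_le sum_nonneg)
  \<comment> \<open>Normalises the self-product to \<open>1\<close>. A real factor commutes with
    \<open>c\<close>, so the eigenvalue is unchanged.\<close>
  define s where "s = 1 / sqrt r"
  have s: "s * r * s = 1" using r by (simp add: s_def)
  define y where "y = rscale x (of_real s)"
  have y: "y \<in> carrier_vec (n + 1)" using x by (simp add: y_def)
  have yI: "form n y (?e i) = 0" if "i \<in> ?I" for i
    using xI [OF that] n x by (simp add: y_def form_rscale_left)
  have cnj_real: "qcnj (of_real a) = of_real a" for a
    by (simp add: quat_eq_iff of_real_def)
  have "form n y y = of_real (s * r * s)"
    using n x by (simp add: y_def form_rscale_left form_rscale_right fx cnj_real mult.assoc)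
  then have fy: "form n y y = 1" using s by simp
  have "of_real s * c = c * of_real s" by (simp add: of_real_def)
  then have gy: "g *\<^sub>v y = rscale y c"
    using g x gx by (simp add: y_def Sp_rscale [of _ n] rscale_rscale)
  have fk: "form n (?e k) (?e k) = 1" using n k by (rule form_unit_unit)
  have ekI: "form n (?e k) (?e i) = 0" if "i \<in> ?I" for i
    using n k that by (auto simp: form_unit_right)
  have "\<exists>S\<in>carrier (Sp n). S *\<^sub>v ?e k = y \<and> (\<forall>i\<in>?I. S *\<^sub>v ?e i = ?e i)"
  proof (cases "form n (?e k) y = 1")
    case False
    have "form n (?e i) (y - ?e k) = 0" if "i \<in> ?I" for i
      using yI [OF that] ekI [OF that] n y by (subst form_swap_eq_0) (simp add: form_diff_left)
    then show ?thesis
      by (rule_tac Sp_move [of n "?e k" y]) (use n y False fy fk in \<open>auto\<close>)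
  next
    \<comment> \<open>Here no quasi-reflection is available, but \<open>y - ?e k\<close> is a null
      vector in the definite complement and hence zero.\<close>
    case True
    define w where "w = y - ?e k"
    have w: "w \<in> carrier_vec (n + 1)" using y by (simp add: w_def)
    have "form n y (?e k) = qcnj (form n (?e k) y)" by (simp add: qcnj_form)
    then have ww: "form n w w = 0"
      using True n y fy fk by (simp add: w_def form_diff_left form_diff_right)
    have wI: "form n w (?e i) = 0" if "i \<in> ?I" for i
      using yI [OF that] ekI [OF that] n y by (simp add: w_def form_diff_left)
    have "(\<Sum>i<n - 1. (norm (w $ i))\<^sup>2) = 0"
      using pos [of w] wI ww by (metis of_real_eq_0_iff)
    then have "w $ i = 0" if "i < n - 1" for i
      using that sum_norm_eq_0 [of "\<lambda>i. w $ i"] by blast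
    moreover have "w $ i = 0" if "i < n + 1" "i \<notin> {k..<n - 1}" for i
      using supp [of w] wI that by blast
    ultimately have w0: "w $ i = 0" if "i < n + 1" for i
      using that by (cases "i < n - 1") auto
    have "y = ?e k"
    proof (rule eq_vecI)
      fix i assume "i < dim_vec (?e k)"
      then show "y $ i = ?e k $ i"
        using w0 [of i] y by (simp add: w_def)
    qed (use y in simp)
    then show ?thesis
      by (intro bexI [of _ "1\<^sub>m (n + 1)"]) (auto simp: Sp_one_closed)
  qed
  then show thesis using that gy by blast
qed

text \<open>The step is applied to \<open>g1\<close>, the conjugate of \<open>g\<close> by
  \<open>Q\<close>, for which the eigenvectors already found are basis vectors. Since
  \<open>S\<close> fixes these, \<open>Q * S\<close> retains them, including the two null ones, and
  adds one more.\<close>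

lemma Sp_eigenbasis:
  assumes n: "n \<ge> 1" and g: "g \<in> carrier (Sp n)" and Q0: "Q0 \<in> carrier (Sp n)"
    and ev0: "\<And>i. i \<in> {n - 1, n} \<Longrightarrow>
      \<exists>c. g *\<^sub>v (Q0 *\<^sub>v unit_vec (n + 1) i) = rscale (Q0 *\<^sub>v unit_vec (n + 1) i) c"
    and "k \<le> n - 1"
  shows "\<exists>Q\<in>carrier (Sp n). (\<forall>i\<in>{n - 1, n}. Q *\<^sub>v unit_vec (n + 1) i = Q0 *\<^sub>v unit_vec (n + 1) i) \<and>
    (\<forall>i<k. \<exists>c. g *\<^sub>v (Q *\<^sub>v unit_vec (n + 1) i) = rscale (Q *\<^sub>v unit_vec (n + 1) i) c)"
  using \<open>k \<le> n - 1\<close>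
proof (induction k)
  case 0
  then show ?case using Q0 by auto
next
  case (Suc k)
  let ?e = "\<lambda>i. unit_vec (n + 1) i :: quat vec"
  from Suc have k: "k < n - 1" by simp
  from Suc obtain Q where Q: "Q \<in> carrier (Sp n)"
    and Q1: "\<And>i. i \<in> {n - 1, n} \<Longrightarrow> Q *\<^sub>v ?e i = Q0 *\<^sub>v ?e i"
    and Q2: "\<And>i. i < k \<Longrightarrow> \<exists>c. g *\<^sub>v (Q *\<^sub>v ?e i) = rscale (Q *\<^sub>v ?e i) c"
    by (metis Suc_leD)
  define g1 where "g1 = inv\<^bsub>Sp n\<^esub> Q * (g * Q)"
  have g1: "g1 \<in> carrier (Sp n)"
    using g Q by (simp add: g1_def Sp_m_closed Sp_inv_closed)
  have g1v: "g1 *\<^sub>v z = inv\<^bsub>Sp n\<^esub> Q *\<^sub>v (g *\<^sub>v (Q *\<^sub>v z))" if "z \<in> carrier_vec (n + 1)" for z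
    using g Q that by (simp add: g1_def Sp_m_closed Sp_inv_closed Sp_mult_mult_vec [of _ n] Sp_mult_vec)
  have Qg1: "Q *\<^sub>v (g1 *\<^sub>v z) = g *\<^sub>v (Q *\<^sub>v z)" if "z \<in> carrier_vec (n + 1)" for z
    using g Q that by (simp add: g1v Sp_inv_vec [of _ n] Sp_mult_vec)
  have "\<exists>c. g1 *\<^sub>v ?e i = rscale (?e i) c" if "i \<in> {..<k} \<union> {n - 1, n}" for i
  proof -
    have "\<exists>c. g *\<^sub>v (Q *\<^sub>v ?e i) = rscale (Q *\<^sub>v ?e i) c"
      using that Q1 Q2 ev0 by (cases "i < k") auto
    then obtain c where "g *\<^sub>v (Q *\<^sub>v ?e i) = rscale (Q *\<^sub>v ?e i) c" by blast
    then have "g1 *\<^sub>v ?e i = rscale (?e i) c"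
      using Q by (simp add: g1v Sp_rscale [of _ n] Sp_inv_closed Sp_mult_vec Sp_inv_vec [of _ n])
    then show ?thesis ..
  qed
  then obtain S c where S: "S \<in> carrier (Sp n)"
    and S1: "\<And>i. i \<in> {..<k} \<union> {n - 1, n} \<Longrightarrow> S *\<^sub>v ?e i = ?e i"
    and S2: "g1 *\<^sub>v (S *\<^sub>v ?e k) = rscale (S *\<^sub>v ?e k) c"
    using Sp_eigen_step [OF n g1 k] by metis
  have QS: "(Q * S) *\<^sub>v ?e i = Q *\<^sub>v (S *\<^sub>v ?e i)" for i
    using Q S by (simp add: Sp_mult_mult_vec [of _ n])
  have "g *\<^sub>v (Q *\<^sub>v (S *\<^sub>v ?e k)) = rscale (Q *\<^sub>v (S *\<^sub>v ?e k)) c"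
    using Qg1 [of "S *\<^sub>v ?e k"] S2 S Q by (simp add: Sp_mult_vec Sp_rscale [of _ n])
  then have "\<exists>c. g *\<^sub>v ((Q * S) *\<^sub>v ?e i) = rscale ((Q * S) *\<^sub>v ?e i) c" if "i < Suc k" for i
    using that Q2 [of i] S1 [of i] by (cases "i = k") (auto simp: QS)
  then show ?case
    using Q S Q1 S1 by (intro bexI [of _ "Q * S"]) (auto simp: QS Sp_m_closed)
qed

text \<open>The signature allows no isotropic plane; after moving \<open>y\<close> to a basis vector
  this is \<open>null_orth_unit\<close>. It later converts a vanishing corner entry into a fixed
  boundary point.\<close>

lemma null_orth:
  assumes n: "n \<ge> 1" and z: "z \<in> V_null n" and y: "y \<in> V_null n" and 0: "form n z y = 0"
  shows "proj z = proj y"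
proof -
  let ?e = "unit_vec (n + 1) n :: quat vec"
  have c: "z \<in> carrier_vec (n + 1)" "y \<in> carrier_vec (n + 1)" "form n z z = 0" "z \<noteq> 0\<^sub>v (n + 1)"
    using z y by (auto simp: V_null_def)
  obtain T where T: "T \<in> carrier (Sp n)" "T *\<^sub>v y = ?e"
    using Sp_move_null [OF n y] by metis
  define b where "b = (T *\<^sub>v z) $ n"
  have "T *\<^sub>v z = rscale ?e b"
    unfolding b_def using T c 0 Sp_carrierD(2) [OF T(1) c(1) c(1)] Sp_carrierD(2) [OF T(1) c(1) c(2)]
    by (intro null_orth_unit [OF n]) (auto simp: Sp_mult_vec)
  then have "T *\<^sub>v z = T *\<^sub>v rscale y b" using T c by (simp add: Sp_rscale [of _ n])
  then have zb: "z = rscale y b" using T c Sp_inv_vec(2) by (metis rscale_carrier)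
  moreover have "b \<noteq> 0" using zb c rscale_zero by metis
  ultimately show ?thesis by (metis proj_rscale)
qed

lemma hyp_space_boundary_disjoint:
  assumes "n \<ge> 1" "z \<in> V_neg n" "proj z \<in> hyp_boundary n"
  shows False
proof -
  obtain y c where y: "y \<in> V_null n" "z = rscale y c"
    using assms(3) proj_eq_iff by (auto simp: hyp_boundary_def)
  then have "form n z z = 0"
    using assms(1) by (simp add: V_null_def form_rscale_left form_rscale_right)
  then show False using assms(2) by (simp add: V_neg_def)
qed

lemma form_eigen_pair:
  assumes n: "n \<ge> 1" and g: "g \<in> carrier (Sp n)"
    and z: "z \<in> carrier_vec (n + 1)" "g *\<^sub>v z = rscale z a"
    and y: "y \<in> carrier_vec (n + 1)" "g *\<^sub>v y = rscale y b"
    and zy: "form n z y = -1"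
  shows "b = inverse (qcnj a)"
proof -
  have "form n (g *\<^sub>v z) (g *\<^sub>v y) = -1"
    using Sp_carrierD(2) [OF g z(1) y(1)] zy by simp
  then have "qcnj b * a = 1"
    using n z y zy by (simp add: form_rscale_left form_rscale_right)
  then have "qcnj a * b = 1"
    by (metis qcnj_mult qcnj_qcnj qcnj_one)
  then show ?thesis by (metis inverse_unique)
qed

text \<open>The null eigenvectors become the two isotropic basis vectors, with the expanding one at
  index \<open>n - 1\<close>, as \<open>diagonal_form\<close> requires; hence the hypothesis on
  \<open>a\<close>.\<close>

lemma diagonal_form_from_pair:
  assumes n: "n \<ge> 1" and g: "g \<in> carrier (Sp n)"
    and z: "z \<in> V_null n" "g *\<^sub>v z = rscale z a"
    and y: "y \<in> V_null n" "g *\<^sub>v y = rscale y b"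
    and zy: "form n z y = -1" and a: "norm a > 1"
  shows "\<exists>l. diagonal_form n g l"
proof -
  interpret group "Sp n" by (rule Sp_group)
  let ?e = "\<lambda>i. unit_vec (n + 1) i :: quat vec"
  have c: "z \<in> carrier_vec (n + 1)" "y \<in> carrier_vec (n + 1)"
    using z y by (auto simp: V_null_def)
  have b: "b = inverse (qcnj a)"
    by (rule form_eigen_pair [OF n g c(1) z(2) c(2) y(2) zy])
  obtain T where T: "T \<in> carrier (Sp n)" "T *\<^sub>v z = ?e (n - 1)" "T *\<^sub>v y = ?e n"
    using Sp_move_pair [OF n z(1) y(1) zy] .
  define Q0 where "Q0 = inv\<^bsub>Sp n\<^esub> T"
  have Q0: "Q0 \<in> carrier (Sp n)" "Q0 *\<^sub>v ?e (n - 1) = z" "Q0 *\<^sub>v ?e n = y"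
    using T c by (auto simp: Q0_def Sp_inv_closed Sp_inv_vec [of _ n] simp flip: T(2,3))
  have "\<exists>c. g *\<^sub>v (Q0 *\<^sub>v ?e i) = rscale (Q0 *\<^sub>v ?e i) c" if "i \<in> {n - 1, n}" for i
    using that Q0 z y by auto
  from Sp_eigenbasis [OF n g Q0(1) this order_refl]
  obtain Q where Q: "Q \<in> carrier (Sp n)"
    and Q1: "\<And>i. i \<in> {n - 1, n} \<Longrightarrow> Q *\<^sub>v ?e i = Q0 *\<^sub>v ?e i"
    and Q2: "\<And>i. i < n - 1 \<Longrightarrow> \<exists>c. g *\<^sub>v (Q *\<^sub>v ?e i) = rscale (Q *\<^sub>v ?e i) c"
    by blast
  obtain l0 where l0: "g *\<^sub>v (Q *\<^sub>v ?e i) = rscale (Q *\<^sub>v ?e i) (l0 i)" if "i < n - 1" for i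
    using Q2 by metis
  define l where "l i = (if i < n - 1 then l0 i else a)" for i
  let ?d = "\<lambda>i. if i < n then l i else inverse (qcnj (l (n - 1)))"
  have gQ: "g *\<^sub>v (Q *\<^sub>v ?e i) = rscale (Q *\<^sub>v ?e i) (?d i)" if i: "i < n + 1" for i
  proof -
    from i n consider "i < n - 1" | "i = n - 1" | "i = n" "i \<noteq> n - 1" by linarith
    then show ?thesis
      using l0 [of i] Q1 [of i] Q0 z y b n by cases (auto simp: l_def)
  qed
  define P where "P = inv\<^bsub>Sp n\<^esub> Q"
  have P: "P \<in> carrier (Sp n)" "inv\<^bsub>Sp n\<^esub> P = Q"
    using Q by (auto simp: P_def Sp_inv_closed)
  have D: "P * g * Q = mat_diag (n + 1) ?d"
  proof (rule mat_eqI_vec)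
    show "P * g * Q \<in> carrier_mat (n + 1) (n + 1)"
      using P g Q by (intro Sp_carrierD(1) Sp_m_closed)
    fix j assume j: "j < n + 1"
    have "P * g * Q *\<^sub>v ?e j = P *\<^sub>v (g *\<^sub>v (Q *\<^sub>v ?e j))"
      using P g Q by (simp add: Sp_m_closed Sp_mult_mult_vec [of _ n] Sp_mult_vec)
    also have "\<dots> = rscale (?e j) (?d j)"
      using P Q j Sp_inv_vec(2) [OF Q] by (simp add: gQ Sp_rscale [of _ n] Sp_mult_vec P_def)
    also have "\<dots> = mat_diag (n + 1) ?d *\<^sub>v ?e j"
      using j by (intro eq_vecI) (auto simp: mat_diag_def scalar_prod_right_unit)
    finally show "P * g * Q *\<^sub>v ?e j = mat_diag (n + 1) ?d *\<^sub>v ?e j" .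
  qed simp
  have "norm (l i) = 1" if i: "i < n - 1" for i
  proof -
    have "form n (g *\<^sub>v (Q *\<^sub>v ?e i)) (g *\<^sub>v (Q *\<^sub>v ?e i)) = form n (?e i) (?e i)"
      using g Q by (simp add: Sp_carrierD(2) Sp_mult_vec)
    moreover have "g *\<^sub>v (Q *\<^sub>v ?e i) = rscale (Q *\<^sub>v ?e i) (l i)"
      using gQ [of i] less_imp_diff_less [of i n 1] i by (cases "i < n") auto
    ultimately have "qcnj (l i) * form n (Q *\<^sub>v ?e i) (Q *\<^sub>v ?e i) * l i = 1"
      using n i Q form_unit_unit [OF n i] by (simp add: form_rscale_left form_rscale_right Sp_mult_vec mult.assoc)
    then have "qcnj (l i) * l i = 1"
      using n i Q form_unit_unit [OF n i] by (simp add: Sp_carrierD(2))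
    then have "norm (qcnj (l i) * l i) = 1" by simp
    then show ?thesis
      using norm_ge_zero [of "l i"] by (simp add: norm_mult square_eq_1_iff)
  qed
  moreover have "norm (l (n - 1)) > 1" using a by (simp add: l_def)
  ultimately have "diagonal_form n g l"
    unfolding diagonal_form_def using P D by auto
  then show ?thesis by blast
qed

lemma act_proj_Sp: "A \<in> carrier (Sp n) \<Longrightarrow> z \<in> carrier_vec (n + 1) \<Longrightarrow> act A (proj z) = proj (A *\<^sub>v z)"
  by (rule act_proj [OF Sp_carrierD(1)])

text \<open>\<open>eigenvalues_of\<close>, and with it \<open>M_inv\<close>, is a choice that says
  something about \<open>g\<close> only once existence is known. The two fixed points provide null
  eigenvectors; the one with the larger eigenvalue is taken as the expanding direction.\<close>

lemma loxodromic_diagonal_form: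
  assumes n: "n \<ge> 1" and lox: "loxodromic n g"
  shows "\<exists>l. diagonal_form n g l"
proof -
  have g: "g \<in> carrier (Sp n)" and card: "card (fixed_points n g) = 2"
    and sub: "fixed_points n g \<subseteq> hyp_boundary n"
    using lox by (auto simp: loxodromic_def)
  obtain u v where uv: "fixed_points n g = {u, v}" "u \<noteq> v"
    using card by (auto simp: card_2_iff)
  obtain z y0 where zy0: "u = proj z" "z \<in> V_null n" "v = proj y0" "y0 \<in> V_null n"
    using sub uv by (auto simp: hyp_boundary_def)
  have c0: "y0 \<in> carrier_vec (n + 1)" "form n y0 y0 = 0"
    using zy0 by (auto simp: V_null_def)
  have ne: "form n z y0 \<noteq> 0" using null_orth [OF n] zy0 uv by blast
  \<comment> \<open>Makes the product with \<open>z\<close> equal to \<open>-1\<close>; the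
    conjugate is needed because the form is conjugate-linear in its second argument.\<close>
  define s where "s = - qcnj (inverse (form n z y0))"
  define y where "y = rscale y0 s"
  have s: "s \<noteq> 0" using ne by (simp add: s_def)
  have zy: "form n z y = -1"
    using n c0 ne by (simp add: y_def form_rscale_right s_def)
  then have "y \<noteq> 0\<^sub>v (n + 1)"
    using n form_rscale_right [OF n c0(1), of z 0] c0 by (auto simp: rscale_zero)
  then have y: "y \<in> V_null n"
    using n c0 by (simp add: V_null_def y_def form_rscale_left form_rscale_right)
  have v: "v = proj y" using zy0 s by (simp add: y_def proj_rscale)
  have z: "z \<in> V_null n" by fact
  have c: "z \<in> carrier_vec (n + 1)" "y \<in> carrier_vec (n + 1)"
    using z y by (auto simp: V_null_def)
  have "act g u = u" "act g v = v" using uv by (auto simp: fixed_points_def)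
  then have "proj (g *\<^sub>v z) = proj z" "proj (g *\<^sub>v y) = proj y"
    unfolding v zy0 using c g by (auto simp: act_proj_Sp [of _ n])
  then obtain a b where a: "a \<noteq> 0" "g *\<^sub>v z = rscale z a" and b: "b \<noteq> 0" "g *\<^sub>v y = rscale y b"
    unfolding proj_eq_iff by blast
  have ab: "b = inverse (qcnj a)"
    by (rule form_eigen_pair [OF n g c(1) a(2) c(2) b(2) zy])
  have yz: "form n y z = -1" using qcnj_form [of n z y] zy by simp
  consider "norm a > 1" | "norm a = 1" | "norm a < 1" by linarith
  then show ?thesis
  proof cases
    case 1
    then show ?thesis using diagonal_form_from_pair [OF n g z a(2) y b(2) zy] by blast
  next
    case 3
    have "norm b > 1" using 3 a by (simp add: ab norm_inverse one_less_inverse_iff)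
    then show ?thesis using diagonal_form_from_pair [OF n g y b(2) z a(2) yz] by blast
  next
    \<comment> \<open>Equal moduli would create a fixed point inside: \<open>|a| = 1\<close> gives
      \<open>b = a\<close>, so \<open>z + y\<close> is an eigenvector with self-product
      \<open>-2\<close>.\<close>
    case 2
    have "b = a"
      using 2 a(1) by (metis ab inverse_unique qcnj_mult_self(1) power_one scaleR_one)
    define w where "w = z + y"
    have w: "w \<in> carrier_vec (n + 1)" using c by (simp add: w_def)
    have "form n w w = - 1 - 1"
      using n c z y zy yz by (simp add: w_def form_add_left form_add_right V_null_def)
    then have "qRe (form n w w) = - 2" by (simp only: quat_components)
    then have wn: "w \<in> V_neg n" using w by (simp add: V_neg_def)
    have "g *\<^sub>v w = rscale z a + rscale y a"
      using c Sp_carrierD(1) [OF g] a b \<open>b = a\<close> by (simp add: w_def mult_add_distrib_mat_vec)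
    also have "\<dots> = rscale w a"
      using c by (intro eq_vecI) (auto simp: w_def distrib_right)
    finally have "proj w \<in> fixed_points n g"
      using w g wn a by (simp add: fixed_points_def act_proj_Sp [of _ n] proj_rscale hyp_space_def)
    then show ?thesis using sub hyp_space_boundary_disjoint [OF n wn] by blast
  qed
qed

section \<open>Bounded subsets of discrete subgroups\<close>

text \<open>Convergence in the product topology is pointwise, and \<open>entries\<close> vanishes
  off the index square. Elements other than the identity with entries ever closer to it would
  therefore converge to an isolated point.\<close>

lemma discrete_group_isolated_one:
  assumes disc: "discrete_group G" and G: "G \<subseteq> carrier_mat m m" and one: "1\<^sub>m m \<in> G"
  obtains e :: real where "e > 0"
    "\<And>A. A \<in> G \<Longrightarrow> (\<And>i j. i < m \<Longrightarrow> j < m \<Longrightarrow> norm (A $$ (i, j) - 1\<^sub>m m $$ (i, j)) < e) \<Longrightarrow> A = 1\<^sub>m m"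
proof (rule ccontr)
  let ?I = "1\<^sub>m m :: quat mat"
  assume "\<not> thesis"
  then have "\<exists>A\<in>G. (\<forall>i<m. \<forall>j<m. norm (A $$ (i, j) - ?I $$ (i, j)) < 1 / real (Suc k)) \<and> A \<noteq> ?I" for k
    using that [of "1 / real (Suc k)"] by fastforce
  then obtain A where A: "\<And>k. A k \<in> G" "\<And>k. A k \<noteq> ?I"
    and close: "\<And>k i j. i < m \<Longrightarrow> j < m \<Longrightarrow> norm (A k $$ (i, j) - ?I $$ (i, j)) < 1 / real (Suc k)"
    by metis
  have dims: "dim_row (A k) = m" "dim_col (A k) = m" for k
    using A(1) [of k] G by auto
  obtain T where T: "open T" "T \<inter> entries ` G = {entries ?I}"
    using disc one unfolding discrete_group_def discrete_def isolated_in_def by blast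
  have "(\<lambda>k. entries (A k) ij) \<longlonglongrightarrow> entries ?I ij" for ij
  proof (cases "fst ij < m \<and> snd ij < m")
    case True
    have "(\<lambda>k. A k $$ ij) \<longlonglongrightarrow> ?I $$ ij"
    proof (rule LIMSEQ_I)
      fix r :: real assume "r > 0"
      then obtain N where N: "1 / real (Suc N) < r"
        using nat_approx_posE by blast
      have "norm (A k $$ ij - ?I $$ ij) < r" if "k \<ge> N" for k
      proof -
        have "norm (A k $$ ij - ?I $$ ij) < 1 / real (Suc k)"
          using close [of "fst ij" "snd ij" k] True by simp
        also have "\<dots> \<le> 1 / real (Suc N)"
          using that by (intro divide_left_mono) auto
        finally show ?thesis using N by simp
      qed
      then show "\<exists>no. \<forall>k\<ge>no. norm (A k $$ ij - ?I $$ ij) < r" by blast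
    qed
    then show ?thesis
      using True by (cases ij) (simp add: entries_def dims)
  next
    case False
    then show ?thesis by (cases ij) (auto simp: entries_def dims)
  qed
  then have "limitin (product_topology (\<lambda>_. euclidean) UNIV) (\<lambda>k. entries (A k)) (entries ?I) sequentially"
    by (simp add: limitin_componentwise)
  then have "(\<lambda>k. entries (A k)) \<longlonglongrightarrow> entries ?I"
    by (simp add: euclidean_product_topology)
  then have "eventually (\<lambda>k. entries (A k) \<in> T) sequentially"
    using T by (metis IntD1 insertI1 topological_tendstoD)
  then obtain k where "entries (A k) \<in> T"
    by (auto simp: eventually_sequentially)
  then have eq: "entries (A k) = entries ?I"
    using T(2) A(1) [of k] by blast
  have "A k = ?I"
  proof (rule eq_matI)
    fix i j assume ij: "i < dim_row ?I" "j < dim_col ?I"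
    show "A k $$ (i, j) = ?I $$ (i, j)"
      using fun_cong [OF eq, of "(i, j)"] ij by (simp add: entries_def dims)
  qed (simp_all add: dims)
  then show False using A(2) by blast
qed

lemma mult_mat_entry_bound:
  fixes A B :: "quat mat"
  assumes A: "A \<in> carrier_mat m m" and B: "B \<in> carrier_mat m m"
    and a: "\<And>i j. i < m \<Longrightarrow> j < m \<Longrightarrow> norm (A $$ (i, j)) \<le> a"
    and b: "\<And>i j. i < m \<Longrightarrow> j < m \<Longrightarrow> norm (B $$ (i, j)) \<le> b"
    and ij: "i < m" "j < m"
  shows "norm ((A * B) $$ (i, j)) \<le> real m * (a * b)"
proof -
  have "(A * B) $$ (i, j) = (\<Sum>k<m. A $$ (i, k) * B $$ (k, j))"
    using A B ij by (simp add: scalar_prod_def atLeast0LessThan)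
  also have "norm \<dots> \<le> (\<Sum>k<m. a * b)"
  proof (rule sum_norm_le)
    fix k assume "k \<in> {..<m}"
    then show "norm (A $$ (i, k) * B $$ (k, j)) \<le> a * b"
      unfolding norm_mult using a [of i k] b [of k j] ij
      by (intro mult_mono) (auto intro: order_trans [OF norm_ge_zero])
  qed
  finally show ?thesis by simp
qed

lemma norm_quat_le: "norm q \<le> \<bar>qRe q\<bar> + \<bar>qI q\<bar> + \<bar>qJ q\<bar> + \<bar>qK q\<bar>"
proof -
  have "norm q \<le> norm (Quat (qRe q) 0 0 0) + norm (Quat 0 (qI q) 0 0) + norm (Quat 0 0 (qJ q) 0)
      + norm (Quat 0 0 0 (qK q))"
    by (rule order_trans [OF eq_refl norm_triangle_le [OF add_right_mono
      [OF norm_triangle_le [OF add_right_mono [OF norm_triangle_ineq]]]]])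
      (auto simp: plus_quat_def)
  then show ?thesis
    by (simp add: norm_quat_def inner_quat_def)
qed

lemma abs_component_le_norm: "\<bar>qRe q\<bar> \<le> norm q" "\<bar>qI q\<bar> \<le> norm q" "\<bar>qJ q\<bar> \<le> norm q" "\<bar>qK q\<bar> \<le> norm q"
  unfolding norm_quat_def inner_quat_def
  by (rule abs_le_square_iff [THEN iffD1, THEN order_trans, OF order_refl] real_le_rsqrt; simp add: power2_eq_square)+

lemma floor_eq_imp_close:
  assumes "\<lfloor>x / e\<rfloor> = \<lfloor>y / e\<rfloor>" "e > (0 :: real)"
  shows "\<bar>x - y\<bar> \<le> e"
proof -
  have "\<bar>x / e - y / e\<bar> \<le> 1" using assms(1) by linarith
  then show ?thesis
    using assms(2) by (simp add: field_simps abs_if split: if_splits)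
qed

text \<open>Pigeonhole: \<open>f\<close> records the grid cell of each real coordinate of each
  entry, and boundedness leaves finitely many records, so two distinct matrices share one.\<close>

lemma infinite_bounded_close:
  fixes S :: "quat mat set"
  assumes inf: "infinite S" and e: "e > (0 :: real)"
    and bd: "\<And>A i j. A \<in> S \<Longrightarrow> i < m \<Longrightarrow> j < m \<Longrightarrow> norm (A $$ (i, j)) \<le> C"
  obtains A B where "A \<in> S" "B \<in> S" "A \<noteq> B"
    "\<And>i j. i < m \<Longrightarrow> j < m \<Longrightarrow> norm (A $$ (i, j) - B $$ (i, j)) \<le> e"
proof -
  \<comment> \<open>A quarter, because \<open>norm_quat_le\<close> adds up the errors of the four
    real components.\<close>
  define r where "r = e / 4"
  have r: "r > 0" using e by (simp add: r_def)
  define q where "q z = (\<lfloor>qRe z / r\<rfloor>, \<lfloor>qI z / r\<rfloor>, \<lfloor>qJ z / r\<rfloor>, \<lfloor>qK z / r\<rfloor>)" for z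
  define f where "f A = restrict (\<lambda>(i, j). q (A $$ (i, j))) ({..<m} \<times> {..<m})" for A :: "quat mat"
  define I where "I = {\<lfloor>- C / r\<rfloor>..\<lfloor>C / r\<rfloor>}"
  have fl: "\<lfloor>x / r\<rfloor> \<in> I" if "\<bar>x\<bar> \<le> C" for x
  proof -
    have "- C \<le> x" "x \<le> C" using that by auto
    then have "- C / r \<le> x / r" "x / r \<le> C / r"
      using r by (intro divide_right_mono; simp)+
    then show ?thesis unfolding I_def by (auto intro: floor_mono)
  qed
  have "f A \<in> ({..<m} \<times> {..<m}) \<rightarrow>\<^sub>E (I \<times> I \<times> I \<times> I)" if A: "A \<in> S" for A
  proof -
    have "q (A $$ (i, j)) \<in> I \<times> I \<times> I \<times> I" if "i < m" "j < m" for i j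
      using bd [OF A that] abs_component_le_norm [of "A $$ (i, j)"]
      unfolding q_def by (auto intro!: fl)
    then show ?thesis by (auto simp: f_def PiE_iff extensional_def)
  qed
  moreover have "finite (({..<m} \<times> {..<m}) \<rightarrow>\<^sub>E (I \<times> I \<times> I \<times> I))"
    by (intro finite_PiE) (auto simp: I_def)
  ultimately have "finite (f ` S)" by (meson finite_subset image_subsetI)
  then obtain A0 where A0: "A0 \<in> S" "infinite {A \<in> S. f A = f A0}"
    using pigeonhole_infinite [OF inf] by blast
  obtain B where B: "B \<in> S" "f B = f A0" "B \<noteq> A0"
  proof -
    have "infinite ({A \<in> S. f A = f A0} - {A0})" using A0 by simp
    then have "{A \<in> S. f A = f A0} - {A0} \<noteq> {}" by (rule infinite_imp_nonempty)
    with that show thesis by blast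
  qed
  show thesis
  proof (rule that [OF A0(1) B(1) B(3) [symmetric]])
    fix i j assume ij: "i < m" "j < m"
    have "q (A0 $$ (i, j)) = q (B $$ (i, j))"
      using fun_cong [OF B(2), of "(i, j)"] ij by (simp add: f_def)
    then have "\<bar>qRe (A0 $$ (i, j)) - qRe (B $$ (i, j))\<bar> \<le> r" "\<bar>qI (A0 $$ (i, j)) - qI (B $$ (i, j))\<bar> \<le> r"
      "\<bar>qJ (A0 $$ (i, j)) - qJ (B $$ (i, j))\<bar> \<le> r" "\<bar>qK (A0 $$ (i, j)) - qK (B $$ (i, j))\<bar> \<le> r"
      using r by (auto simp: q_def intro!: floor_eq_imp_close)
    then show "norm (A0 $$ (i, j) - B $$ (i, j)) \<le> e"
      using norm_quat_le [of "A0 $$ (i, j) - B $$ (i, j)"] by (simp add: r_def)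
  qed
qed

text \<open>Two close elements \<open>A\<close>, \<open>B\<close> give
  \<open>A\<^sup>-\<^sup>1 B - 1 = A\<^sup>-\<^sup>1 (B - A)\<close>, which is small provided the
  inverses are bounded too; isolation of the identity then forces \<open>A = B\<close>.\<close>

lemma discrete_bounded_finite:
  assumes sub: "subgroup G (Sp n)" and disc: "discrete_group G" and S: "S \<subseteq> G"
    and bd: "\<And>A i j. A \<in> S \<Longrightarrow> i < n + 1 \<Longrightarrow> j < n + 1 \<Longrightarrow> norm (A $$ (i, j)) \<le> C"
    and bdi: "\<And>A i j. A \<in> S \<Longrightarrow> i < n + 1 \<Longrightarrow> j < n + 1 \<Longrightarrow> norm ((inv\<^bsub>Sp n\<^esub> A) $$ (i, j)) \<le> C"
  shows "finite S"
proof (rule ccontr)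
  assume inf: "infinite S"
  interpret group "Sp n" by (rule Sp_group)
  have GSp: "G \<subseteq> carrier (Sp n)" using sub by (rule subgroup.subset)
  then have Gc: "G \<subseteq> carrier_mat (n + 1) (n + 1)" using Sp_carrierD(1) by blast
  have "1\<^sub>m (n + 1) \<in> G" using subgroup.one_closed [OF sub] by simp
  then obtain e where e: "e > 0" and iso:
    "\<And>A. A \<in> G \<Longrightarrow> (\<And>i j. i < n + 1 \<Longrightarrow> j < n + 1 \<Longrightarrow>
      norm (A $$ (i, j) - 1\<^sub>m (n + 1) $$ (i, j)) < e) \<Longrightarrow> A = 1\<^sub>m (n + 1)"
    using discrete_group_isolated_one [OF disc Gc] by metis
  define C' where "C' = max C 1"
  define N where "N = real (n + 1)"
  \<comment> \<open>Chosen so that the product bound \<open>N * (C' * r)\<close> equals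
    \<open>e / 2\<close>.\<close>
  define r where "r = e / (2 * N * C')"
  have C': "C' > 0" by (simp add: C'_def)
  have N: "N > 0" by (simp add: N_def)
  have r: "r > 0" using e C' N by (simp add: r_def)
  obtain A B where AB: "A \<in> S" "B \<in> S" "A \<noteq> B" and close:
    "\<And>i j. i < n + 1 \<Longrightarrow> j < n + 1 \<Longrightarrow> norm (A $$ (i, j) - B $$ (i, j)) \<le> r"
    by (rule infinite_bounded_close [OF inf r bd]) (use that in auto)
  have AS: "A \<in> carrier (Sp n)" "B \<in> carrier (Sp n)" "A \<in> G" "B \<in> G" using AB S GSp by auto
  note c = AS(1,2) [THEN Sp_carrierD(1)]
  have iA: "inv\<^bsub>Sp n\<^esub> A \<in> carrier (Sp n)" using AS by simp
  note ic = iA [THEN Sp_carrierD(1)]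
  have iAA: "inv\<^bsub>Sp n\<^esub> A * A = 1\<^sub>m (n + 1)" using l_inv [OF AS(1)] by simp
  have "inv\<^bsub>Sp n\<^esub> A * B \<in> G"
    using AS subgroup.m_closed [OF sub, of "inv\<^bsub>Sp n\<^esub> A" B] subgroup.m_inv_closed [OF sub] by simp
  moreover have "norm ((inv\<^bsub>Sp n\<^esub> A * B) $$ (i, j) - 1\<^sub>m (n + 1) $$ (i, j)) < e"
    if ij: "i < n + 1" "j < n + 1" for i j
  proof -
    have "inv\<^bsub>Sp n\<^esub> A * (B - A) = inv\<^bsub>Sp n\<^esub> A * B - 1\<^sub>m (n + 1)"
      using c ic by (simp add: mult_minus_distrib_mat [of _ "n + 1" "n + 1" _ "n + 1"] iAA)
    then have "(inv\<^bsub>Sp n\<^esub> A * B) $$ (i, j) - 1\<^sub>m (n + 1) $$ (i, j) = (inv\<^bsub>Sp n\<^esub> A * (B - A)) $$ (i, j)"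
      using c ic ij by simp
    also have "norm \<dots> \<le> N * (C' * r)"
      unfolding N_def
    proof (rule mult_mat_entry_bound [OF ic _ _ _ ij])
      show "norm ((inv\<^bsub>Sp n\<^esub> A) $$ (i, j)) \<le> C'" if "i < n + 1" "j < n + 1" for i j
        using bdi [OF AB(1) that] by (simp add: C'_def)
      show "norm ((B - A) $$ (i, j)) \<le> r" if "i < n + 1" "j < n + 1" for i j
        using close [OF that] c that by (simp add: norm_minus_commute)
    qed (use c in auto)
    also have "\<dots> = e / 2" using C' N by (simp add: r_def)
    finally show ?thesis using e by simp
  qed
  ultimately have "inv\<^bsub>Sp n\<^esub> A * B = 1\<^sub>m (n + 1)" by (rule iso)
  then have "inv\<^bsub>Sp n\<^esub> A \<otimes>\<^bsub>Sp n\<^esub> B = \<one>\<^bsub>Sp n\<^esub>" by simp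
  then have "A = B" using AS by (metis inv_equality inv_inv iA)
  with AB show False by simp
qed

section \<open>Bounding a matrix of Sp(n,1) by its four corner entries\<close>

lemma sum_norm_square_le:
  "(\<Sum>i<n - 1. (norm (x $ i))\<^sup>2) \<le> norm (form n x x) + 2 * (norm (x $ (n - 1)) * norm (x $ n))"
proof -
  have "(\<Sum>i<n - 1. (norm (x $ i))\<^sup>2) = norm (of_real (\<Sum>i<n - 1. (norm (x $ i))\<^sup>2) :: quat)"
    by (simp only: norm_of_real) (simp add: sum_nonneg)
  also have "of_real (\<Sum>i<n - 1. (norm (x $ i))\<^sup>2) = form n x x
      + (qcnj (x $ (n - 1)) * x $ n + qcnj (x $ n) * x $ (n - 1))"
    by (simp add: form_self_expand)
  also have "norm \<dots> \<le> norm (form n x x) + (norm (qcnj (x $ (n - 1)) * x $ n)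
      + norm (qcnj (x $ n) * x $ (n - 1)))"
    by (intro norm_triangle_mono norm_triangle_ineq order_refl)
  finally show ?thesis by (simp add: norm_mult mult.commute)
qed

lemma norm_entry_le:
  assumes "i < n - 1"
  shows "(norm (x $ i))\<^sup>2 \<le> norm (form n x x) + 2 * (norm (x $ (n - 1)) * norm (x $ n))"
proof -
  have "(norm (x $ i))\<^sup>2 \<le> (\<Sum>i<n - 1. (norm (x $ i))\<^sup>2)"
    using assms by (intro member_le_sum) auto
  then show ?thesis using sum_norm_square_le [of x n] by linarith
qed

text \<open>The two isotropic columns are null, so their definite entries are controlled by the
  corners. A definite column has self-product \<open>1\<close>, and its isotropic entries are
  definite entries of null columns of the inverse.\<close>

lemma Sp_entries_bounded:
  assumes n: "n \<ge> 1" and F: "F \<in> carrier (Sp n)"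
    and C: "\<And>p q. p \<in> {n - 1, n} \<Longrightarrow> q \<in> {n - 1, n} \<Longrightarrow>
      norm (form n (F *\<^sub>v unit_vec (n + 1) p) (unit_vec (n + 1) q)) \<le> C"
    and ij: "i < n + 1" "j < n + 1"
  shows "norm (F $$ (i, j)) \<le> 1 + 8 * C"
proof -
  let ?e = "\<lambda>i. unit_vec (n + 1) i :: quat vec"
  have C0: "C \<ge> 0" using C [of n n] norm_ge_zero order_trans by blast
  have unull: "form n (?e p) (?e p) = 0" if "p \<in> {n - 1, n}" for p
    using that unit_vec_null [OF n] by auto
  have bd: "norm (x $ i) \<le> sqrt (N + 2 * (K * K)) + K"
    if x: "norm (form n x x) \<le> N" "norm (form n x (?e (n - 1))) \<le> K" "norm (form n x (?e n)) \<le> K"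
      and i: "i < n + 1" for x i N K
  proof -
    have K: "K \<ge> 0" using x(2) norm_ge_zero order_trans by blast
    have N: "N \<ge> 0" using x(1) norm_ge_zero order_trans by blast
    have xx: "norm (x $ (n - 1)) \<le> K" "norm (x $ n) \<le> K"
      using x(2,3) n by (auto simp: form_unit_right split: if_splits)
    show ?thesis
    proof (cases "i < n - 1")
      case True
      have "(norm (x $ i))\<^sup>2 \<le> norm (form n x x) + 2 * (norm (x $ (n - 1)) * norm (x $ n))"
        by (rule norm_entry_le [OF True])
      also have "\<dots> \<le> N + 2 * (K * K)"
        using x(1) xx K by (intro add_mono mult_left_mono mult_mono) auto
      finally have "norm (x $ i) \<le> sqrt (N + 2 * (K * K))" by (rule real_le_rsqrt)
      then show ?thesis using K by simp
    next
      case False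
      then have "i = n - 1 \<or> i = n" using i by linarith
      then have "norm (x $ i) \<le> K" using xx by auto
      moreover have "0 \<le> sqrt (N + 2 * (K * K))" using K N by simp
      ultimately show ?thesis by linarith
    qed
  qed
  have null_bd: "norm (x $ i) \<le> 3 * K"
    if x: "form n x x = 0" "norm (form n x (?e (n - 1))) \<le> K" "norm (form n x (?e n)) \<le> K"
      and i: "i < n + 1" for x i K
  proof -
    have K: "K \<ge> 0" using x(2) norm_ge_zero order_trans by blast
    have "sqrt (2 * (K * K)) \<le> 2 * K"
      using K by (intro real_le_lsqrt) (auto simp: power2_eq_square)
    then show ?thesis using bd [of x 0 K i] x i by simp
  qed
  define x where "x = F *\<^sub>v ?e j"
  have x: "x \<in> carrier_vec (n + 1)" using F by (simp add: x_def Sp_mult_vec)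
  have Fij: "F $$ (i, j) = x $ i"
    using Sp_carrierD(1) [OF F] ij by (simp add: x_def scalar_prod_right_unit)
  show ?thesis
  proof (cases "j < n - 1")
    case False
    then have j: "j \<in> {n - 1, n}" using ij by auto
    have "form n x x = 0" using F unull [OF j] by (simp add: x_def Sp_carrierD(2))
    then show ?thesis unfolding Fij
      using null_bd [of x C i] C [OF j] ij C0 by (fastforce simp: x_def)
  next
    case True
    text \<open>The last two entries of \<open>x\<close> are read off the inverse, whose corner entries are those of \<open>F\<close>.\<close>
    have xq: "norm (form n x (?e q)) \<le> 3 * C" if q: "q \<in> {n - 1, n}" for q
    proof -
      define y where "y = inv\<^bsub>Sp n\<^esub> F *\<^sub>v ?e q"
      have iF: "inv\<^bsub>Sp n\<^esub> F \<in> carrier (Sp n)" using F by (rule Sp_inv_closed)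
      have yy: "form n y y = 0"
        using iF unull [OF q] by (simp add: y_def Sp_carrierD(2))
      have yp: "norm (form n y (?e p)) \<le> C" if "p \<in> {n - 1, n}" for p
        using C [OF that q] F by (subst norm_form_commute) (simp add: y_def Sp_form_inv(2))
      have "form n x (?e q) = form n (?e j) y"
        using F by (simp add: x_def y_def Sp_form_inv(2))
      then have "norm (form n x (?e q)) = norm (form n y (?e j))"
        by (simp add: norm_form_commute)
      also have "\<dots> = norm (y $ j)" using n True by (simp add: form_unit_right)
      also have "\<dots> \<le> 3 * C" using null_bd [of y C j] yy yp ij by simp
      finally show ?thesis .
    qed
    have "norm (form n x x) \<le> 1"
      using F form_unit_unit [OF n True] by (simp add: x_def Sp_carrierD(2))
    then have "norm (x $ i) \<le> sqrt (1 + 2 * (3 * C * (3 * C))) + 3 * C"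
      using bd [of x 1 "3 * C" i] xq ij by simp
    \<comment> \<open>\<open>18 C\<^sup>2 \<le> 25 C\<^sup>2\<close>; together with the remaining
      \<open>3 * C\<close> this yields the constant \<open>8\<close>.\<close>
    also have "sqrt (1 + 2 * (3 * C * (3 * C))) \<le> 1 + 5 * C"
      using C0 by (intro real_le_lsqrt) (auto simp: power2_eq_square algebra_simps)
    finally show ?thesis unfolding Fij using C0 by simp
  qed
qed

section \<open>The recursive inequalities\<close>

text \<open>The ratio may vary with \<open>k\<close>, since the factors for the corners
  \<open>b\<close> and \<open>c\<close> are only known to converge. Eventually they lie below some
  \<open>r' < 1\<close> and the ratio test applies.\<close>

lemma ratio_tendsto_0:
  fixes s q :: "nat \<Rightarrow> real"
  assumes nn: "\<And>k. s k \<ge> 0" and step: "\<And>k. s (Suc k) \<le> q k * s k"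
    and q: "q \<longlonglongrightarrow> r" "r < 1"
  shows "s \<longlonglongrightarrow> 0"
proof -
  obtain r' where r': "r < r'" "r' < 1" using q(2) dense by blast
  then have "eventually (\<lambda>k. q k < r') sequentially" using q(1) by (simp add: order_tendstoD)
  then obtain N where N: "\<And>k. k \<ge> N \<Longrightarrow> q k < r'" by (auto simp: eventually_sequentially)
  have "norm (s (Suc k)) \<le> r' * norm (s k)" if "k \<ge> N" for k
    using step [of k] nn [of k] nn [of "Suc k"] mult_right_mono [OF less_imp_le [OF N [OF that]] nn [of k]]
    by simp
  then have "summable s" using summable_ratio_test [OF r'(2)] by blast
  then show ?thesis by (rule summable_LIMSEQ_zero)
qed

text \<open>Multiplying the recursions for \<open>b\<close> and \<open>c\<close> gives one for
  \<open>y = \<surd>(bc)\<close> alone, which drives \<open>y\<close> to \<open>0\<close>. The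
  bounds on \<open>a\<close> and \<open>d\<close> then tend to \<open>L\<close> and
  \<open>1 / L\<close>, so the growth factors of \<open>b\<close> and \<open>c\<close> are
  asymptotically at most \<open>M L\<close> and \<open>M / L\<close>; the weights
  \<open>L ^ k\<close> reduce both to \<open>M < 1\<close>.\<close>

lemma corner_sequences:
  fixes a b c d :: "nat \<Rightarrow> real" and L M :: real
  assumes nn: "\<And>k. a k \<ge> 0" "\<And>k. b k \<ge> 0" "\<And>k. c k \<ge> 0" "\<And>k. d k \<ge> 0"
    and M: "0 < M" "M < 1" and L: "L > 1"
    and X: "\<And>k. sqrt (a k * d k) \<le> 1 + sqrt (b k * c k)"
    and bs: "\<And>k. b (Suc k) \<le> M * (a k * b k)" and cs: "\<And>k. c (Suc k) \<le> M * (c k * d k)"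
    and as: "\<And>k. a (Suc k) \<le> 2 * sqrt (a k * d k) * sqrt (b k * c k) + L * (a k * d k) + b k * c k / L"
    and ds: "\<And>k. d (Suc k) \<le> 2 * sqrt (a k * d k) * sqrt (b k * c k) + L * (b k * c k) + a k * d k / L"
    and start: "M\<^sup>2 * (sqrt (a 0 * d 0) * sqrt (b 0 * c 0)) < 1 - M"
  shows "(\<lambda>k. b k / L ^ k) \<longlonglongrightarrow> 0" "(\<lambda>k. c k * L ^ k) \<longlonglongrightarrow> 0"
    "\<exists>C. \<forall>k. a k \<le> C \<and> d k \<le> C"
proof -
  define x where "x k = sqrt (a k * d k)" for k
  define y where "y k = sqrt (b k * c k)" for k
  have xy0: "x k \<ge> 0" "y k \<ge> 0" for k by (auto simp: x_def y_def nn)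
  have x2: "a k * d k = (x k)\<^sup>2" and y2: "b k * c k = (y k)\<^sup>2" for k
    by (simp_all add: x_def y_def nn)
  have x1: "x k \<le> 1 + y k" for k using X by (simp add: x_def y_def)
  have ys: "y (Suc k) \<le> M * x k * y k" for k
  proof -
    have "b (Suc k) * c (Suc k) \<le> (M * (a k * b k)) * (M * (c k * d k))"
      using bs [of k] cs [of k] nn M by (intro mult_mono) auto
    also have "\<dots> = M\<^sup>2 * (a k * d k) * (b k * c k)"
      by (simp add: power2_eq_square algebra_simps)
    also have "\<dots> = (M * x k * y k)\<^sup>2" by (simp add: x2 y2 power_mult_distrib)
    finally show ?thesis
      unfolding y_def [of "Suc k"] using M xy0 by (intro real_le_lsqrt) auto
  qed
  \<comment> \<open>Built from \<open>y 1\<close>, not \<open>y 0\<close>: the starting hypothesis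
    bounds \<open>M * x 0 * y 0\<close>, hence \<open>y 1\<close>, while \<open>y 0\<close> itself
    may be large.\<close>
  define r where "r = M * (1 + y 1)"
  have r: "r < 1"
  proof -
    have "M * y 1 \<le> M * (M * x 0 * y 0)" using ys [of 0] M by (intro mult_left_mono) (auto simp: One_nat_def)
    also have "\<dots> = M\<^sup>2 * (x 0 * y 0)" by (simp add: power2_eq_square)
    finally show ?thesis using start by (simp add: r_def algebra_simps x_def y_def)
  qed
  have r0: "r \<ge> 0" using M xy0 [of 1] by (simp add: r_def)
  have y1: "y (Suc k) \<le> y 1" for k
  proof (induction k)
    case (Suc k)
    have "y (Suc (Suc k)) \<le> M * x (Suc k) * y (Suc k)" by (rule ys)
    also have "\<dots> \<le> r * y (Suc k)"
      unfolding r_def using x1 [of "Suc k"] Suc xy0 M by (intro mult_right_mono mult_left_mono) auto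
    also have "\<dots> \<le> 1 * y (Suc k)" using r xy0 by (intro mult_right_mono) auto
    finally show ?case using Suc by simp
  qed (simp add: One_nat_def)
  have "(\<lambda>k. y (Suc k)) \<longlonglongrightarrow> 0"
  proof (rule ratio_tendsto_0 [where q = "\<lambda>_. r" and r = r])
    fix k
    have "y (Suc (Suc k)) \<le> M * x (Suc k) * y (Suc k)" by (rule ys)
    also have "\<dots> \<le> r * y (Suc k)"
      unfolding r_def using x1 [of "Suc k"] y1 [of k] xy0 M by (intro mult_right_mono mult_left_mono) auto
    finally show "y (Suc (Suc k)) \<le> r * y (Suc k)" .
  qed (use r xy0 in auto)
  then have ylim: "y \<longlonglongrightarrow> 0" by (simp add: filterlim_sequentially_Suc)
  \<comment> \<open>\<open>A\<close> and \<open>D\<close> are the right-hand sides of the recursions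
    for \<open>a\<close> and \<open>d\<close> with \<open>x k\<close> replaced by its bound
    \<open>1 + y k\<close>.\<close>
  define A where "A k = 2 * (1 + y k) * y k + L * (1 + y k)\<^sup>2 + (y k)\<^sup>2 / L" for k
  define D where "D k = 2 * (1 + y k) * y k + L * (y k)\<^sup>2 + (1 + y k)\<^sup>2 / L" for k
  have aA: "a (Suc k) \<le> A k" for k
  proof -
    have "a (Suc k) \<le> 2 * x k * y k + L * (x k)\<^sup>2 + (y k)\<^sup>2 / L"
      using as [of k] unfolding x2 y2 using xy0 by simp
    also have "\<dots> \<le> A k"
      unfolding A_def using x1 [of k] xy0 L
      by (intro add_mono mult_left_mono mult_right_mono power_mono order_refl) auto
    finally show ?thesis .
  qed
  have dD: "d (Suc k) \<le> D k" for k
  proof -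
    have "d (Suc k) \<le> 2 * x k * y k + L * (y k)\<^sup>2 + (x k)\<^sup>2 / L"
      using ds [of k] unfolding x2 y2 using xy0 by simp
    also have "\<dots> \<le> D k"
      unfolding D_def using x1 [of k] xy0 L
      by (intro add_mono mult_left_mono mult_right_mono divide_right_mono power_mono order_refl) auto
    finally show ?thesis .
  qed
  have Alim: "A \<longlonglongrightarrow> L"
  proof -
    have "A \<longlonglongrightarrow> 2 * (1 + 0) * 0 + L * (1 + 0)\<^sup>2 + 0\<^sup>2 / L"
      unfolding A_def by (intro tendsto_intros ylim) (use L in simp)
    then show ?thesis by simp
  qed
  have Dlim: "D \<longlonglongrightarrow> 1 / L"
  proof -
    have "D \<longlonglongrightarrow> 2 * (1 + 0) * 0 + L * 0\<^sup>2 + (1 + 0)\<^sup>2 / L"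
      unfolding D_def by (intro tendsto_intros ylim) (use L in simp)
    then show ?thesis by simp
  qed
  have "Bseq A" "Bseq D" using Alim Dlim by (auto intro: convergent_imp_Bseq convergentI)
  then obtain K1 K2 where K: "\<And>k. norm (A k) \<le> K1" "\<And>k. norm (D k) \<le> K2"
    by (metis Bseq_def)
  define C where "C = max (max (a 0) (d 0)) (max K1 K2)"
  have "a k \<le> C \<and> d k \<le> C" for k
  proof (cases k)
    case (Suc j)
    have "a k \<le> K1" "d k \<le> K2"
      using aA [of j] dD [of j] K(1) [of j] K(2) [of j] Suc by auto
    then show ?thesis by (simp add: C_def le_max_iff_disj)
  qed (simp add: C_def le_max_iff_disj)
  then show "\<exists>C. \<forall>k. a k \<le> C \<and> d k \<le> C" by blast
  have L0: "L ^ k > 0" for k using L by simp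
  have "(\<lambda>k. b (Suc k) / L ^ Suc k) \<longlonglongrightarrow> 0"
  proof (rule ratio_tendsto_0 [where q = "\<lambda>k. M * A k / L" and r = M])
    show "(\<lambda>k. M * A k / L) \<longlonglongrightarrow> M"
      by (rule tendsto_eq_intros Alim refl | use L in simp)+
    fix k
    show "b (Suc k) / L ^ Suc k \<ge> 0" by (rule divide_nonneg_pos [OF nn(2) L0])
    have "b (Suc (Suc k)) \<le> M * (A k * b (Suc k))"
      by (rule order_trans [OF bs mult_left_mono [OF mult_right_mono [OF aA nn(2)] less_imp_le [OF M(1)]]])
    then have "b (Suc (Suc k)) / L ^ Suc (Suc k) \<le> M * (A k * b (Suc k)) / L ^ Suc (Suc k)"
      using L0 [of "Suc (Suc k)"] by (intro divide_right_mono) auto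
    then show "b (Suc (Suc k)) / L ^ Suc (Suc k) \<le> M * A k / L * (b (Suc k) / L ^ Suc k)"
      by (simp add: mult.assoc)
  qed (use M in simp)
  then show "(\<lambda>k. b k / L ^ k) \<longlonglongrightarrow> 0" by (rule LIMSEQ_imp_Suc)
  have "(\<lambda>k. c (Suc k) * L ^ Suc k) \<longlonglongrightarrow> 0"
  proof (rule ratio_tendsto_0 [where q = "\<lambda>k. M * D k * L" and r = M])
    show "(\<lambda>k. M * D k * L) \<longlonglongrightarrow> M"
      by (rule tendsto_eq_intros Dlim refl | use L in simp)+
    fix k
    show "c (Suc k) * L ^ Suc k \<ge> 0" by (rule mult_nonneg_nonneg [OF nn(3) less_imp_le [OF L0]])
    have "c (Suc (Suc k)) \<le> M * (c (Suc k) * D k)"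
      by (rule order_trans [OF cs mult_left_mono [OF mult_left_mono [OF dD nn(3)] less_imp_le [OF M(1)]]])
    then have "c (Suc (Suc k)) * L ^ Suc (Suc k) \<le> M * (c (Suc k) * D k) * L ^ Suc (Suc k)"
      using L0 [of "Suc (Suc k)"] by (intro mult_right_mono) auto
    then show "c (Suc (Suc k)) * L ^ Suc (Suc k) \<le> M * D k * L * (c (Suc k) * L ^ Suc k)"
      by (simp add: algebra_simps)
  qed (use M in simp)
  then show "(\<lambda>k. c k * L ^ k) \<longlonglongrightarrow> 0" by (rule LIMSEQ_imp_Suc)
qed

text \<open>The finitely many values other than \<open>l\<close> form a closed set. This is how
  discreteness turns small corner entries into vanishing ones.\<close>

lemma finite_range_tendsto_eventually_eq:
  fixes s :: "nat \<Rightarrow> 'a :: t1_space"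
  assumes "finite (range s)" "s \<longlonglongrightarrow> l"
  shows "eventually (\<lambda>k. s k = l) sequentially"
proof -
  have "open (- (range s - {l}))" by (intro open_Compl finite_imp_closed finite_Diff assms(1))
  from topological_tendstoD [OF assms(2) this]
  have "eventually (\<lambda>k. s k \<in> - (range s - {l})) sequentially" by simp
  then show ?thesis by (rule eventually_mono) auto
qed

section \<open>Estimates for a diagonal element\<close>

lemma mat_diag_mult_vec:
  fixes f :: "nat \<Rightarrow> 'a :: semiring_0"
  assumes "x \<in> carrier_vec m" "i < m"
  shows "(mat_diag m f *\<^sub>v x) $ i = f i * x $ i"
proof -
  have "(mat_diag m f *\<^sub>v x) $ i = (\<Sum>j<m. (if i = j then f j else 0) * x $ j)"
    using assms by (simp add: mat_diag_def scalar_prod_def atLeast0LessThan)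
  also have "\<dots> = (\<Sum>j<m. if i = j then f j * x $ j else 0)"
    by (rule sum.cong) auto
  finally show ?thesis using assms by simp
qed

text \<open>\<open>\<langle>D x, y\<rangle>\<close> for the diagonal matrix \<open>D\<close> with
  definite entries \<open>m\<close> followed by \<open>p\<close> and \<open>q\<close>. It covers the
  form, its twist by \<open>g\<close> and their difference, so a single estimate serves all
  three.\<close>

definition twisted_form :: "nat \<Rightarrow> (nat \<Rightarrow> quat) \<Rightarrow> quat \<Rightarrow> quat \<Rightarrow> quat vec \<Rightarrow> quat vec \<Rightarrow> quat" where
  "twisted_form n m p q x y = (\<Sum>i<n - 1. qcnj (y $ i) * (m i * x $ i))
     - (qcnj (y $ (n - 1)) * (q * x $ n) + qcnj (y $ n) * (p * x $ (n - 1)))"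

lemma twisted_form_diff:
  "twisted_form n m p q x y - twisted_form n m' p' q' x y =
    twisted_form n (\<lambda>i. m i - m' i) (p - p') (q - q') x y"
  by (simp add: twisted_form_def algebra_simps sum_subtractf)

lemma form_eq_twisted_form: "form n x y = twisted_form n (\<lambda>_. 1) 1 1 x y"
  by (simp add: twisted_form_def form_def)

text \<open>Cauchy-Schwarz on the definite part, whose squared length for a null vector is at most
  twice the product of the two isotropic absolute values. The resulting factor \<open>2\<close> is
  the one in front of \<open>\<delta>\<close> in \<open>M\<close>.\<close>

lemma twisted_form_bound:
  assumes x: "form n x x = 0" and y: "form n y y = 0"
    and C: "C \<ge> 0" and m: "\<And>i. i < n - 1 \<Longrightarrow> norm (m i) \<le> C"
  shows "norm (twisted_form n m p q x y) \<le>
    C * (2 * sqrt ((norm (x $ (n - 1)) * norm (x $ n)) * (norm (y $ (n - 1)) * norm (y $ n))))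
    + norm p * (norm (x $ (n - 1)) * norm (y $ n)) + norm q * (norm (x $ n) * norm (y $ (n - 1)))"
proof -
  define X where "X = norm (x $ (n - 1)) * norm (x $ n)"
  define Y where "Y = norm (y $ (n - 1)) * norm (y $ n)"
  have L2: "L2_set (\<lambda>i. norm (z $ i)) {..<n - 1} \<le> sqrt (2 * (norm (z $ (n - 1)) * norm (z $ n)))"
    if "form n z z = 0" for z
    unfolding L2_set_def using sum_norm_square_le [of z n] that by simp
  have "norm (\<Sum>i<n - 1. qcnj (y $ i) * (m i * x $ i)) \<le> (\<Sum>i<n - 1. C * (norm (x $ i) * norm (y $ i)))"
  proof (rule sum_norm_le)
    fix i assume "i \<in> {..<n - 1}"
    then have "norm (m i) * (norm (x $ i) * norm (y $ i)) \<le> C * (norm (x $ i) * norm (y $ i))"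
      using m by (intro mult_right_mono) auto
    then show "norm (qcnj (y $ i) * (m i * x $ i)) \<le> C * (norm (x $ i) * norm (y $ i))"
      by (simp add: norm_mult mult_ac)
  qed
  also have "\<dots> = C * (\<Sum>i<n - 1. \<bar>norm (x $ i)\<bar> * \<bar>norm (y $ i)\<bar>)"
    by (simp add: sum_distrib_left)
  also have "\<dots> \<le> C * (L2_set (\<lambda>i. norm (x $ i)) {..<n - 1} * L2_set (\<lambda>i. norm (y $ i)) {..<n - 1})"
    using C by (intro mult_left_mono L2_set_mult_ineq)
  also have "\<dots> \<le> C * (sqrt (2 * X) * sqrt (2 * Y))"
    unfolding X_def Y_def using C by (intro mult_left_mono mult_mono L2 x y L2_set_nonneg) auto
  also have "sqrt (2 * X) * sqrt (2 * Y) = 2 * sqrt (X * Y)"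
    by (simp add: real_sqrt_mult)
  finally have S: "norm (\<Sum>i<n - 1. qcnj (y $ i) * (m i * x $ i)) \<le> C * (2 * sqrt (X * Y))" .
  have "norm (twisted_form n m p q x y) \<le> norm (\<Sum>i<n - 1. qcnj (y $ i) * (m i * x $ i))
      + (norm (qcnj (y $ (n - 1)) * (q * x $ n)) + norm (qcnj (y $ n) * (p * x $ (n - 1))))"
    unfolding twisted_form_def
    by (rule order_trans [OF norm_triangle_ineq4]) (intro add_left_mono norm_triangle_ineq)
  also have "\<dots> \<le> C * (2 * sqrt (X * Y)) + (norm q * (norm (x $ n) * norm (y $ (n - 1)))
      + norm p * (norm (x $ (n - 1)) * norm (y $ n)))"
    using S by (simp add: norm_mult mult_ac)
  finally show ?thesis unfolding X_def Y_def by simp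
qed

text \<open>Ptolemy's inequality for the Cygan metric.\<close>

lemma form_ptolemy:
  assumes n: "n \<ge> 1"
    and x: "x \<in> carrier_vec (n + 1)" "form n x x = 0" and y: "y \<in> carrier_vec (n + 1)" "form n y y = 0"
    and z: "z \<in> carrier_vec (n + 1)" "form n z z = 0" and w: "w \<in> carrier_vec (n + 1)" "form n w w = 0"
  shows "sqrt (norm (form n x y) * norm (form n z w)) \<le>
    sqrt (norm (form n x w) * norm (form n y z)) + sqrt (norm (form n x z) * norm (form n y w))"
proof (cases "form n z w = 0")
  case False
  define N where "N = norm (form n z w)"
  have N: "N > 0" using False by (simp add: N_def)
  \<comment> \<open>Rescaling makes \<open>z\<close>, \<open>w'\<close> a pair that can be moved to
    the isotropic basis vectors. The isotropic coordinates of \<open>T *\<^sub>v v\<close> then are,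
    in absolute value, the products of \<open>v\<close> with \<open>w\<close> (over
    \<open>N\<close>) and with \<open>z\<close>.\<close>
  define s where "s = - qcnj (inverse (form n z w))"
  define w' where "w' = rscale w s"
  have zw': "form n z w' = -1"
    using n w False by (simp add: w'_def form_rscale_right s_def)
  have w': "w' \<in> carrier_vec (n + 1)" "form n w' w' = 0"
    using n w by (simp_all add: w'_def form_rscale_right form_rscale_left)
  have fw': "norm (form n v w') = norm (form n v w) / N" for v
    using n w by (simp add: w'_def form_rscale_right s_def norm_mult norm_inverse N_def divide_inverse)
  have form0: "form n v (0\<^sub>v (n + 1)) = 0" "form n (0\<^sub>v (n + 1)) v = 0" for v
    using form_rscale_right [OF n z(1), of v 0] form_rscale_left [OF n z(1), of 0 v] z(1)
    by (simp_all add: rscale_zero)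
  have "z \<noteq> 0\<^sub>v (n + 1)" "w' \<noteq> 0\<^sub>v (n + 1)" using zw' form0 by auto
  then have "z \<in> V_null n" "w' \<in> V_null n" using z w' by (auto simp: V_null_def)
  then obtain T where T: "T \<in> carrier (Sp n)" "T *\<^sub>v z = unit_vec (n + 1) (n - 1)"
    "T *\<^sub>v w' = unit_vec (n + 1) n"
    using Sp_move_pair [OF n _ _ zw'] by blast
  have coords: "norm ((T *\<^sub>v v) $ (n - 1)) = norm (form n v w) / N" "norm ((T *\<^sub>v v) $ n) = norm (form n v z)"
    if v: "v \<in> carrier_vec (n + 1)" for v
  proof -
    have "form n v w' = form n (T *\<^sub>v v) (unit_vec (n + 1) n)"
      "form n v z = form n (T *\<^sub>v v) (unit_vec (n + 1) (n - 1))"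
      using T v z w' by (simp_all add: Sp_carrierD(2) flip: T(2,3))
    then show "norm ((T *\<^sub>v v) $ (n - 1)) = norm (form n v w) / N" "norm ((T *\<^sub>v v) $ n) = norm (form n v z)"
      unfolding fw' [symmetric] using n diff_less [of 1 n] by (simp_all add: form_unit_right split: if_splits)
  qed
  define A where "A = norm (form n x w) * norm (form n y z)"
  define B where "B = norm (form n x z) * norm (form n y w)"
  have AB: "A \<ge> 0" "B \<ge> 0" by (simp_all add: A_def B_def)
  have "norm (form n x y) = norm (twisted_form n (\<lambda>_. 1) 1 1 (T *\<^sub>v x) (T *\<^sub>v y))"
    using T x y by (simp add: Sp_carrierD(2) flip: form_eq_twisted_form)
  also have "\<dots> \<le> 1 * (2 * sqrt ((norm (form n x w) / N * norm (form n x z)) * (norm (form n y w) / N * norm (form n y z))))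
      + norm (1 :: quat) * (norm (form n x w) / N * norm (form n y z))
      + norm (1 :: quat) * (norm (form n x z) * (norm (form n y w) / N))"
    unfolding coords [OF x(1), symmetric] coords [OF y(1), symmetric]
    using T x y by (intro twisted_form_bound) (auto simp: Sp_carrierD(2))
  also have "\<dots> = 2 * sqrt (A / N * (B / N)) + A / N + B / N"
    by (simp add: A_def B_def mult_ac)
  also have "sqrt (A / N * (B / N)) = sqrt (A * B) / N"
    using N by (simp add: real_sqrt_divide)
  finally have "norm (form n x y) * N \<le> 2 * sqrt (A * B) + A + B"
    using N by (simp add: field_simps)
  \<comment> \<open>With all multipliers equal to \<open>1\<close>, the estimate is a perfect
    square.\<close>
  also have "\<dots> = (sqrt A + sqrt B)\<^sup>2"
    using AB by (simp add: power2_sum real_sqrt_mult)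
  finally show ?thesis
    unfolding A_def [symmetric] B_def [symmetric] N_def [symmetric]
    using AB by (intro real_le_lsqrt) auto
qed simp

text \<open>The complement of a null vector is positive semidefinite. This keeps interior points
  from being orthogonal to an eigenvector \<open>U\<close> or \<open>W\<close>.\<close>

lemma null_perp_nonneg:
  assumes n: "n \<ge> 1" and w: "w \<in> V_null n" and z: "z \<in> carrier_vec (n + 1)" and 0: "form n z w = 0"
  shows "qRe (form n z z) \<ge> 0"
proof -
  have wc: "w \<in> carrier_vec (n + 1)" using w by (simp add: V_null_def)
  obtain T where T: "T \<in> carrier (Sp n)" "T *\<^sub>v w = unit_vec (n + 1) n"
    using Sp_move_null [OF n w] by metis
  define x where "x = T *\<^sub>v z"
  have "form n x (unit_vec (n + 1) n) = 0"
    using T wc z 0 by (simp add: x_def Sp_carrierD(2) flip: T(2))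
  then have "x $ (n - 1) = 0" using n by (simp add: form_unit_right split: if_splits)
  then have "form n x x = of_real (\<Sum>i<n - 1. (norm (x $ i))\<^sup>2)"
    by (simp add: form_self_expand)
  then have "qRe (form n x x) = (\<Sum>i<n - 1. (norm (x $ i))\<^sup>2)"
    by (simp only: of_real_def) simp
  moreover have "form n x x = form n z z" using T z by (simp add: x_def Sp_carrierD(2))
  ultimately show ?thesis by (simp add: sum_nonneg)
qed

section \<open>The action on hyperbolic space together with its boundary\<close>

definition hyp_closure :: "nat \<Rightarrow> quat vec set set" where
  "hyp_closure n = hyp_space n \<union> hyp_boundary n"

lemma hyp_closureE:
  assumes "p \<in> hyp_closure n"
  obtains z where "p = proj z" "z \<in> carrier_vec (n + 1)" "z \<in> V_neg n \<or> z \<in> V_null n"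
  using assms by (auto simp: hyp_closure_def hyp_space_def hyp_boundary_def V_neg_def V_null_def)

lemma act_hyp_closure:
  assumes "A \<in> carrier (Sp n)" "p \<in> hyp_closure n"
  shows "act A p \<in> hyp_closure n"
proof -
  obtain z where z: "p = proj z" "z \<in> carrier_vec (n + 1)" "z \<in> V_neg n \<or> z \<in> V_null n"
    using assms(2) by (rule hyp_closureE)
  then show ?thesis
    using assms(1) Sp_V_null Sp_V_neg
    by (auto simp: act_proj_Sp [of _ n] hyp_closure_def hyp_space_def hyp_boundary_def)
qed

lemma act_mult:
  assumes "A \<in> carrier (Sp n)" "B \<in> carrier (Sp n)" "p \<in> hyp_closure n"
  shows "act (A * B) p = act A (act B p)"
proof -
  obtain z where z: "p = proj z" "z \<in> carrier_vec (n + 1)"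
    using assms(3) by (rule hyp_closureE)
  then show ?thesis
    using assms by (simp add: act_proj_Sp [of _ n] Sp_mult_mult_vec [of _ n] Sp_m_closed Sp_mult_vec)
qed

lemma act_one:
  assumes "p \<in> hyp_closure n"
  shows "act (1\<^sub>m (n + 1)) p = p"
  using assms by (rule hyp_closureE) (simp add: act_proj_Sp [of _ n] Sp_one_closed)

lemma act_inv:
  assumes "A \<in> carrier (Sp n)" "p \<in> hyp_closure n"
  shows "act A (act (inv\<^bsub>Sp n\<^esub> A) p) = p" "act (inv\<^bsub>Sp n\<^esub> A) (act A p) = p"
proof -
  obtain z where z: "p = proj z" "z \<in> carrier_vec (n + 1)"
    using assms(2) by (rule hyp_closureE)
  then show "act A (act (inv\<^bsub>Sp n\<^esub> A) p) = p" "act (inv\<^bsub>Sp n\<^esub> A) (act A p) = p"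
    using assms by (simp_all add: act_proj_Sp [of _ n] Sp_inv_vec [of _ n] Sp_inv_closed Sp_mult_vec)
qed

section \<open>Corner entries relative to the fixed points of a diagonalised element\<close>

locale diagonal_loxodromic =
  fixes n :: nat and g P :: "quat mat" and l :: "nat \<Rightarrow> quat" and \<delta> :: real
  assumes n: "n \<ge> 1" and g: "g \<in> carrier (Sp n)" and P: "P \<in> carrier (Sp n)"
    and unit: "\<And>i. i < n - 1 \<Longrightarrow> norm (l i) = 1" and expanding: "norm (l (n - 1)) > 1"
    and diag: "P * g * inv\<^bsub>Sp n\<^esub> P =
      mat_diag (n + 1) (\<lambda>i. if i < n then l i else inverse (qcnj (l (n - 1))))"
    and delta: "\<And>i. i < n - 1 \<Longrightarrow> norm (l i - 1) \<le> \<delta>" "\<delta> \<ge> 0"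
begin

definition "lam = l (n - 1)"
definition "mu = inverse (qcnj lam)"
definition "M = 2 * \<delta> + norm (lam - 1) + norm (mu - 1)"
definition "U = inv\<^bsub>Sp n\<^esub> P *\<^sub>v unit_vec (n + 1) (n - 1)"
definition "W = inv\<^bsub>Sp n\<^esub> P *\<^sub>v unit_vec (n + 1) n"
abbreviation "pU z \<equiv> norm (form n z U)"
abbreviation "pW z \<equiv> norm (form n z W)"

lemma norm_lam: "norm lam > 1" and norm_mu: "norm mu = 1 / norm lam"
  using expanding by (simp_all add: lam_def mu_def norm_inverse divide_inverse)

lemma M_pos: "M > 0"
proof -
  have "norm lam - 1 \<le> norm (lam - 1)" using norm_triangle_ineq2 [of lam 1] by simp
  then show ?thesis
    unfolding M_def using norm_lam delta(2) norm_ge_zero [of "mu - 1"] by linarith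
qed

lemma UW_carrier: "U \<in> carrier_vec (n + 1)" "W \<in> carrier_vec (n + 1)"
  using P by (simp_all add: U_def W_def Sp_mult_vec Sp_inv_closed)

lemma PUW: "P *\<^sub>v U = unit_vec (n + 1) (n - 1)" "P *\<^sub>v W = unit_vec (n + 1) n"
  using P by (simp_all add: U_def W_def Sp_inv_vec)

lemma form_UW: "form n U U = 0" "form n W W = 0" "form n U W = -1" "form n W U = -1"
  using P n by (simp_all add: U_def W_def Sp_carrierD(2) Sp_inv_closed unit_vec_null)

lemma UW_null: "U \<in> V_null n" "W \<in> V_null n"
proof -
  have "form n (0\<^sub>v (n + 1)) w = 0" if "w \<in> carrier_vec (n + 1)" for w
    using n form_rscale_left [OF n that, of 0 w] that form_rscale_left [of n "0\<^sub>v (n + 1)" 0 w]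
    by (metis mult_zero_right rscale_zero zero_carrier_vec)
  then have "U \<noteq> 0\<^sub>v (n + 1)" "W \<noteq> 0\<^sub>v (n + 1)"
    using UW_carrier form_UW by force+
  then show "U \<in> V_null n" "W \<in> V_null n"
    using UW_carrier form_UW by (auto simp: V_null_def)
qed

lemma P_coords:
  assumes "z \<in> carrier_vec (n + 1)"
  shows "(P *\<^sub>v z) $ (n - 1) = - form n z W" "(P *\<^sub>v z) $ n = - form n z U"
proof -
  have "form n z W = form n (P *\<^sub>v z) (unit_vec (n + 1) n)"
    "form n z U = form n (P *\<^sub>v z) (unit_vec (n + 1) (n - 1))"
    using assms P UW_carrier by (simp_all add: Sp_carrierD(2) flip: PUW)
  then show "(P *\<^sub>v z) $ (n - 1) = - form n z W" "(P *\<^sub>v z) $ n = - form n z U"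
    using n diff_less [of 1 n] by (simp_all add: form_unit_right split: if_splits)
qed

lemma P_g:
  assumes z: "z \<in> carrier_vec (n + 1)" and i: "i < n + 1"
  shows "(P *\<^sub>v (g *\<^sub>v z)) $ i = (if i < n then l i else mu) * (P *\<^sub>v z) $ i"
proof -
  have "P *\<^sub>v (g *\<^sub>v z) = (P * g * inv\<^bsub>Sp n\<^esub> P) *\<^sub>v (P *\<^sub>v z)"
    using z P g by (simp add: Sp_mult_mult_vec [of _ n] Sp_m_closed Sp_inv_closed Sp_mult_vec Sp_inv_vec)
  then show ?thesis
    unfolding diag using P z i by (simp add: mat_diag_mult_vec Sp_mult_vec mu_def lam_def)
qed

lemma form_g:
  assumes x: "x \<in> carrier_vec (n + 1)" and y: "y \<in> carrier_vec (n + 1)"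
  shows "form n (g *\<^sub>v x) y = twisted_form n l lam mu (P *\<^sub>v x) (P *\<^sub>v y)"
proof -
  have "form n (g *\<^sub>v x) y = form n (P *\<^sub>v (g *\<^sub>v x)) (P *\<^sub>v y)"
    using assms P g by (simp add: Sp_carrierD(2) Sp_mult_vec)
  also have "\<dots> = twisted_form n l lam mu (P *\<^sub>v x) (P *\<^sub>v y)"
  proof -
    have "(\<Sum>i<n - 1. qcnj ((P *\<^sub>v y) $ i) * (P *\<^sub>v (g *\<^sub>v x)) $ i)
      = (\<Sum>i<n - 1. qcnj ((P *\<^sub>v y) $ i) * (l i * (P *\<^sub>v x) $ i))"
      using x by (intro sum.cong) (auto simp: P_g)
    then show ?thesis
      using n x by (simp add: form_def twisted_form_def P_g lam_def)
  qed
  finally show ?thesis .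
qed

lemma form_P: "x \<in> carrier_vec (n + 1) \<Longrightarrow> y \<in> carrier_vec (n + 1) \<Longrightarrow>
    form n x y = twisted_form n (\<lambda>_. 1) 1 1 (P *\<^sub>v x) (P *\<^sub>v y)"
  using P by (simp flip: form_eq_twisted_form add: Sp_carrierD(2))

lemma g_eigen: "g *\<^sub>v U = rscale U lam" "g *\<^sub>v W = rscale W mu"
proof -
  have eq: "g *\<^sub>v z = rscale z c"
    if z: "z \<in> carrier_vec (n + 1)" and Pz: "P *\<^sub>v z = unit_vec (n + 1) i"
      and i: "i < n + 1" and c: "c = (if i < n then l i else mu)" for z c i
  proof -
    have "P *\<^sub>v (g *\<^sub>v z) = rscale (P *\<^sub>v z) c"
    proof (rule eq_vecI)
      fix j assume "j < dim_vec (rscale (P *\<^sub>v z) c)"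
      then have "j < n + 1" using P z Sp_carrierD(1) [OF P] by auto
      then show "(P *\<^sub>v (g *\<^sub>v z)) $ j = rscale (P *\<^sub>v z) c $ j"
        using i c by (simp only: P_g [OF z] Pz) auto
    qed (use P g z Sp_carrierD(1) [OF P] in auto)
    then have "P *\<^sub>v (g *\<^sub>v z) = P *\<^sub>v rscale z c" using P z by (simp add: Sp_rscale [of _ n])
    then show ?thesis
      using P g z Sp_inv_vec(2) [OF P] by (metis Sp_mult_vec rscale_carrier)
  qed
  show "g *\<^sub>v U = rscale U lam" "g *\<^sub>v W = rscale W mu"
    using n UW_carrier PUW by (intro eq; auto simp: lam_def)+
qed

text \<open>In the coordinates given by \<open>P\<close>, \<open>g - 1\<close> is diagonal with
  entries \<open>l i - 1\<close>, \<open>lam - 1\<close>, \<open>mu - 1\<close>. For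
  \<open>x = y\<close> the first bound is exactly \<open>M * (pW x * pU x)\<close>. The second
  estimates \<open>g\<close> itself, using that the definite eigenvalues have modulus
  \<open>1\<close>.\<close>

lemma form_g_bounds:
  assumes x: "x \<in> carrier_vec (n + 1)" "form n x x = 0"
    and y: "y \<in> carrier_vec (n + 1)" "form n y y = 0"
  defines "S \<equiv> sqrt ((pW x * pU x) * (pW y * pU y))"
  shows "norm (form n (g *\<^sub>v x) y - form n x y) \<le>
      \<delta> * (2 * S) + norm (lam - 1) * (pW x * pU y) + norm (mu - 1) * (pU x * pW y)" (is ?A)
    and "norm (form n (g *\<^sub>v x) y) \<le> 2 * S + norm lam * (pW x * pU y) + norm mu * (pU x * pW y)" (is ?B)
proof -
  have Px: "form n (P *\<^sub>v x) (P *\<^sub>v x) = 0" and Py: "form n (P *\<^sub>v y) (P *\<^sub>v y) = 0"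
    using P x y by (simp_all add: Sp_carrierD(2))
  note b = twisted_form_bound [OF Px Py, unfolded P_coords [OF x(1)] P_coords [OF y(1)] norm_minus_cancel,
    folded S_def]
  show ?A
    unfolding form_g [OF x(1) y(1)] form_P [OF x(1) y(1)] twisted_form_diff
    by (rule b) (use delta in auto)
  show ?B
    unfolding form_g [OF x(1) y(1)] using b [of 1 l lam mu] unit by simp
qed

text \<open>Moduli of the corner entries of \<open>h\<close> in the eigenbasis: \<open>ca\<close>
  and \<open>cd\<close> are diagonal, \<open>cb\<close> and \<open>cc\<close> off-diagonal.
  \<open>cb h = 0\<close> means that \<open>h\<close> fixes the class of \<open>W\<close>,
  \<open>cc h = 0\<close> the same for \<open>U\<close>.\<close>

definition "ca h = pW (h *\<^sub>v U)"
definition "cb h = pW (h *\<^sub>v W)"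
definition "cc h = pU (h *\<^sub>v U)"
definition "cd h = pU (h *\<^sub>v W)"

lemma corner_nonneg: "ca h \<ge> 0" "cb h \<ge> 0" "cc h \<ge> 0" "cd h \<ge> 0"
  by (simp_all add: ca_def cb_def cc_def cd_def)

lemma corner_inv:
  assumes "h \<in> carrier (Sp n)"
  shows "pW (inv\<^bsub>Sp n\<^esub> h *\<^sub>v U) = cd h" "pW (inv\<^bsub>Sp n\<^esub> h *\<^sub>v W) = cb h"
    "pU (inv\<^bsub>Sp n\<^esub> h *\<^sub>v U) = cc h" "pU (inv\<^bsub>Sp n\<^esub> h *\<^sub>v W) = ca h"
  using assms UW_carrier
  by (simp_all add: Sp_form_inv ca_def cb_def cc_def cd_def norm_form_commute [of _ U] norm_form_commute [of _ W])

text \<open>Ptolemy for the four null vectors \<open>U\<close>, \<open>W\<close>,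
  \<open>h U\<close>, \<open>h W\<close>; the products within each of the two pairs have modulus
  \<open>1\<close>.\<close>

lemma corner_product:
  assumes h: "h \<in> carrier (Sp n)"
  shows "sqrt (ca h * cd h) \<le> 1 + sqrt (cb h * cc h)"
    and "sqrt (cb h * cc h) \<le> 1 + sqrt (ca h * cd h)"
proof -
  have hU: "h *\<^sub>v U \<in> carrier_vec (n + 1)" "form n (h *\<^sub>v U) (h *\<^sub>v U) = 0"
    and hW: "h *\<^sub>v W \<in> carrier_vec (n + 1)" "form n (h *\<^sub>v W) (h *\<^sub>v W) = 0"
    and hUW: "norm (form n (h *\<^sub>v U) (h *\<^sub>v W)) = 1" "norm (form n (h *\<^sub>v W) (h *\<^sub>v U)) = 1"
    using h UW_carrier form_UW by (simp_all add: Sp_carrierD(2) Sp_mult_vec)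
  note U = UW_carrier(1) form_UW(1) and W = UW_carrier(2) form_UW(2)
  show "sqrt (ca h * cd h) \<le> 1 + sqrt (cb h * cc h)"
    using form_ptolemy [OF n hU W hW U] hUW form_UW
    by (simp add: ca_def cb_def cc_def cd_def norm_form_commute [of n W] mult.commute)
  show "sqrt (cb h * cc h) \<le> 1 + sqrt (ca h * cd h)"
    using form_ptolemy [OF n hW W hU U] hUW form_UW
    by (simp add: ca_def cb_def cc_def cd_def norm_form_commute [of n W] mult.commute)
qed

text \<open>\<open>\<langle>h' z, w\<rangle> = \<langle>g h\<^sup>-\<^sup>1 z, h\<^sup>-\<^sup>1
  w\<rangle>\<close>. For \<open>cb\<close> and \<open>cc\<close> both arguments come from the same
  null vector, so its zero self-product can be subtracted and \<open>g - 1\<close> gives the factor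
  \<open>M\<close>. For \<open>ca\<close> and \<open>cd\<close> they differ and only the bound for
  \<open>g\<close> applies.\<close>

lemma corner_conj:
  assumes h: "h \<in> carrier (Sp n)"
  defines "h' \<equiv> h * g * inv\<^bsub>Sp n\<^esub> h"
  shows "cb h' \<le> M * (ca h * cb h)" "cc h' \<le> M * (cc h * cd h)"
    "ca h' \<le> 2 * sqrt (ca h * cd h) * sqrt (cb h * cc h) + norm lam * (ca h * cd h) + cb h * cc h / norm lam"
    "cd h' \<le> 2 * sqrt (ca h * cd h) * sqrt (cb h * cc h) + norm lam * (cb h * cc h) + ca h * cd h / norm lam"
proof -
  define x where "x = inv\<^bsub>Sp n\<^esub> h *\<^sub>v U"
  define y where "y = inv\<^bsub>Sp n\<^esub> h *\<^sub>v W"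
  have ih: "inv\<^bsub>Sp n\<^esub> h \<in> carrier (Sp n)" using h by (rule Sp_inv_closed)
  have x: "x \<in> carrier_vec (n + 1)" "form n x x = 0" and y: "y \<in> carrier_vec (n + 1)" "form n y y = 0"
    using ih UW_carrier form_UW by (simp_all add: x_def y_def Sp_carrierD(2) Sp_mult_vec)
  have h'v: "form n (h' *\<^sub>v z) w = form n (g *\<^sub>v (inv\<^bsub>Sp n\<^esub> h *\<^sub>v z)) (inv\<^bsub>Sp n\<^esub> h *\<^sub>v w)"
    if "z \<in> carrier_vec (n + 1)" "w \<in> carrier_vec (n + 1)" for z w
    using that h g ih by (simp add: h'_def Sp_mult_mult_vec [of _ n] Sp_m_closed Sp_mult_vec Sp_form_inv)
  note v = corner_inv [OF h, folded x_def y_def]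
  have S: "sqrt ((cd h * cc h) * (cb h * ca h)) = sqrt (ca h * cd h) * sqrt (cb h * cc h)"
    "sqrt ((cb h * ca h) * (cd h * cc h)) = sqrt (ca h * cd h) * sqrt (cb h * cc h)"
    by (simp_all add: algebra_simps flip: real_sqrt_mult)
  have S': "sqrt ((cb h * ca h) * (cb h * ca h)) = cb h * ca h" "sqrt ((cd h * cc h) * (cd h * cc h)) = cd h * cc h"
    unfolding real_sqrt_abs2 by (simp_all add: corner_nonneg abs_mult)
  have "cb h' = norm (form n (g *\<^sub>v y) y - form n y y)"
    using y UW_carrier by (simp add: cb_def h'v y_def)
  then show "cb h' \<le> M * (ca h * cb h)"
    using form_g_bounds(1) [OF y y] unfolding v S' M_def by (simp add: algebra_simps)
  have "cc h' = norm (form n (g *\<^sub>v x) x - form n x x)"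
    using x UW_carrier by (simp add: cc_def h'v x_def)
  then show "cc h' \<le> M * (cc h * cd h)"
    using form_g_bounds(1) [OF x x] unfolding v S' M_def by (simp add: algebra_simps)
  have "ca h' = norm (form n (g *\<^sub>v x) y)" "cd h' = norm (form n (g *\<^sub>v y) x)"
    using UW_carrier by (simp_all add: ca_def cd_def h'v x_def y_def)
  then show "ca h' \<le> 2 * sqrt (ca h * cd h) * sqrt (cb h * cc h) + norm lam * (ca h * cd h) + cb h * cc h / norm lam"
    "cd h' \<le> 2 * sqrt (ca h * cd h) * sqrt (cb h * cc h) + norm lam * (cb h * cc h) + ca h * cd h / norm lam"
    using form_g_bounds(2) [OF x y] form_g_bounds(2) [OF y x] unfolding v S norm_mu
    by (simp_all add: mult_ac)
qed

text \<open>If \<open>g\<close> applied twice scales \<open>z\<close> by \<open>c\<close>, pairing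
  with \<open>U\<close> and \<open>W\<close> gives \<open>|lam|\<^sup>2 |c| = 1\<close> and
  \<open>|mu|\<^sup>2 |c| = 1\<close> unless a product vanishes; both together would force
  \<open>|lam| = 1\<close>. A vanishing product puts \<open>z\<close> on that eigenline. The square
  is needed to exclude interchanges of the two points.\<close>

lemma fixed_by_square:
  assumes p: "p \<in> hyp_closure n" and fixed: "act g (act g p) = p"
  shows "p \<in> {proj U, proj W}"
proof -
  obtain z where z: "p = proj z" "z \<in> carrier_vec (n + 1)" and zt: "z \<in> V_neg n \<or> z \<in> V_null n"
    using p by (rule hyp_closureE)
  have "proj (g *\<^sub>v (g *\<^sub>v z)) = proj z"
    using fixed z g by (simp add: act_proj_Sp [of _ n] Sp_mult_vec)
  then obtain c where c: "g *\<^sub>v (g *\<^sub>v z) = rscale z c" by (auto simp: proj_eq_iff)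
  have step: "norm k * norm (form n (g *\<^sub>v w) y) = norm (form n w y)"
    if "y \<in> carrier_vec (n + 1)" "g *\<^sub>v y = rscale y k" "w \<in> carrier_vec (n + 1)" for y k w
  proof -
    have "form n w y = qcnj k * form n (g *\<^sub>v w) y"
      using Sp_carrierD(2) [OF g that(3,1)] that n by (simp add: form_rscale_right)
    then show ?thesis by (simp add: norm_mult)
  qed
  have double: "norm k * (norm k * norm c) * norm (form n z y) = norm (form n z y)"
    if "y \<in> carrier_vec (n + 1)" "g *\<^sub>v y = rscale y k" for y k
  proof -
    have 1: "norm k * (norm (form n z y) * norm c) = norm (form n (g *\<^sub>v z) y)"
      using step [OF that, of "g *\<^sub>v z"] z g n by (simp add: c Sp_mult_vec form_rscale_left norm_mult)
    have "norm k * (norm k * norm c) * norm (form n z y) = norm k * (norm k * (norm (form n z y) * norm c))"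
      by simp
    then show ?thesis using step [OF that z(2)] unfolding 1 by simp
  qed
  have null: "z \<in> V_null n \<and> proj z = proj w" if "w \<in> V_null n" "form n z w = 0" for w
  proof -
    have "z \<in> V_null n"
      using null_perp_nonneg [OF n that(1) z(2) that(2)] zt by (auto simp: V_neg_def)
    then show ?thesis using null_orth [OF n _ that] by blast
  qed
  have "form n z U = 0 \<or> form n z W = 0"
  proof (rule ccontr)
    assume "\<not> ?thesis"
    then have "norm lam * (norm lam * norm c) = 1" "norm mu * (norm mu * norm c) = 1"
      using double [OF UW_carrier(1) g_eigen(1)] double [OF UW_carrier(2) g_eigen(2)] by auto
    then have "(norm lam)\<^sup>2 * norm c = 1" "norm c = (norm lam)\<^sup>2"
      using norm_lam unfolding norm_mu by (auto simp: power2_eq_square field_simps)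
    then have "(norm lam)\<^sup>2 * (norm lam)\<^sup>2 = 1" by simp
    moreover have "(norm lam)\<^sup>2 > 1" using norm_lam by simp
    ultimately show False using less_1_mult by fastforce
  qed
  then show ?thesis using null [OF UW_null(1)] null [OF UW_null(2)] z(1) by blast
qed

section \<open>Elements preserving the pair of fixed points\<close>

abbreviation "E \<equiv> {proj U, proj W}"

lemma E_closure: "E \<subseteq> hyp_closure n"
  using UW_null by (auto simp: hyp_closure_def hyp_boundary_def)

lemma g_fixes_E: "p \<in> E \<Longrightarrow> act g p = p"
proof -
  have "lam \<noteq> 0" "mu \<noteq> 0" using norm_lam by (auto simp: mu_def)
  then show "p \<in> E \<Longrightarrow> act g p = p"
    using g UW_carrier by (auto simp: act_proj_Sp [of _ n] g_eigen proj_rscale)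
qed

lemma E_distinct: "proj U \<noteq> proj W"
proof
  assume "proj U = proj W"
  then obtain c where "U = rscale W c" by (auto simp: proj_eq_iff)
  then have "form n U W = 0" using n UW_carrier form_UW by (simp add: form_rscale_left)
  then show False using form_UW by simp
qed

lemma fixed_points_g: "fixed_points n g = E"
proof
  show "fixed_points n g \<subseteq> E"
  proof
    fix p assume "p \<in> fixed_points n g"
    then have "p \<in> hyp_closure n" "act g p = p" by (simp_all add: fixed_points_def hyp_closure_def)
    then show "p \<in> E" using fixed_by_square [of p] by simp
  qed
  show "E \<subseteq> fixed_points n g"
  proof
    fix p assume p: "p \<in> E"
    then have "p \<in> hyp_closure n" using E_closure by blast
    then show "p \<in> fixed_points n g"
      using g_fixes_E [OF p] by (simp add: fixed_points_def hyp_closure_def)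
  qed
qed

text \<open>If the conjugate fixes \<open>p\<close>, then \<open>g\<close> fixes the preimage of
  \<open>p\<close> under \<open>h\<close>, which therefore lies in \<open>E\<close>; an injective
  self-map of a finite set is onto.\<close>

lemma conj_fixes_E:
  assumes h: "h \<in> carrier (Sp n)" and fixed: "\<And>p. p \<in> E \<Longrightarrow> act (h * g * inv\<^bsub>Sp n\<^esub> h) p = p"
  shows "act h ` E = E"
proof -
  have ih: "inv\<^bsub>Sp n\<^esub> h \<in> carrier (Sp n)" using h by (rule Sp_inv_closed)
  have "act (inv\<^bsub>Sp n\<^esub> h) p \<in> E" if p: "p \<in> E" for p
  proof -
    have pc: "p \<in> hyp_closure n" using p E_closure by blast
    have "act h (act g (act (inv\<^bsub>Sp n\<^esub> h) p)) = p"
      using fixed [OF p] pc h g ih by (simp add: act_mult [of _ n] Sp_m_closed act_hyp_closure)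
    then have "act g (act (inv\<^bsub>Sp n\<^esub> h) p) = act (inv\<^bsub>Sp n\<^esub> h) p"
      using pc h g ih act_inv(2) [OF h] by (metis act_hyp_closure)
    then show ?thesis
      using pc ih by (intro fixed_by_square) (simp_all add: act_hyp_closure)
  qed
  then have sub: "act (inv\<^bsub>Sp n\<^esub> h) ` E \<subseteq> E" by blast
  moreover have "inj_on (act (inv\<^bsub>Sp n\<^esub> h)) E"
    using act_inv(1) [OF h] E_closure by (intro inj_on_inverseI [of _ "act h"]) blast
  ultimately have "act (inv\<^bsub>Sp n\<^esub> h) ` E = E" by (intro endo_inj_surj) auto
  then have "act h ` E = act h ` (act (inv\<^bsub>Sp n\<^esub> h) ` E)" by simp
  also have "\<dots> = E" unfolding image_image using act_inv(1) [OF h] E_closure by force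
  finally show ?thesis .
qed

text \<open>A permutation of two points is an involution. Pulled back by \<open>t\<close>, the
  square of \<open>g\<close> fixes the preimage \<open>q\<close> of \<open>p\<close>; by
  \<open>fixed_by_square\<close> so does \<open>g\<close>, and hence the conjugate fixes
  \<open>p\<close>.\<close>

lemma conj_preserves_E_imp_fixes:
  assumes t: "t \<in> carrier (Sp n)" and E: "act (t * g * inv\<^bsub>Sp n\<^esub> t) ` E = E" and p: "p \<in> E"
  shows "act (t * g * inv\<^bsub>Sp n\<^esub> t) p = p"
proof -
  define f where "f = act (t * g * inv\<^bsub>Sp n\<^esub> t)"
  have it: "inv\<^bsub>Sp n\<^esub> t \<in> carrier (Sp n)" using t by (rule Sp_inv_closed)
  have f: "f q = act t (act g (act (inv\<^bsub>Sp n\<^esub> t) q))" if "q \<in> hyp_closure n" for q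
    using that t g it by (simp add: f_def act_mult [of _ n] Sp_m_closed act_hyp_closure)
  have "inj_on f E"
    using E unfolding f_def by (intro eq_card_imp_inj_on) auto
  moreover have "f (proj U) \<in> E" "f (proj W) \<in> E" using E by (auto simp: f_def)
  ultimately have ff: "f (f p) = p"
    using p E_distinct unfolding inj_on_def by auto
  define q where "q = act (inv\<^bsub>Sp n\<^esub> t) p"
  have pc: "p \<in> hyp_closure n" using p E_closure by blast
  have q: "q \<in> hyp_closure n" using pc it by (simp add: q_def act_hyp_closure)
  have gq: "act g q \<in> hyp_closure n" "act g (act g q) \<in> hyp_closure n" using q g by (simp_all add: act_hyp_closure)
  have "f (f p) = act t (act g (act g q))"
    using gq t by (simp add: f [OF pc] f [OF act_hyp_closure] act_inv(2) flip: q_def)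
  then have "act g (act g q) = q"
    using ff gq t by (metis act_inv(2) q_def)
  then have "act g q = q" using fixed_by_square [OF q] g_fixes_E by blast
  then have "f p = p" using f [OF pc] act_inv(1) [OF t pc] by (simp add: q_def)
  then show ?thesis by (simp add: f_def)
qed

lemma preserves_E_elementary:
  assumes h: "h \<in> carrier (Sp n)" and hE: "act h ` E = E"
  shows "elementary n (generate (Sp n) {g, h})"
proof -
  interpret group "Sp n" by (rule Sp_group)
  have gE: "act g ` E = E" using g_fixes_E by (simp add: image_def)
  have inv_E: "act (inv\<^bsub>Sp n\<^esub> A) ` E = E" if "A \<in> carrier (Sp n)" "act A ` E = E" for A
  proof -
    have "act (inv\<^bsub>Sp n\<^esub> A) ` E = act (inv\<^bsub>Sp n\<^esub> A) ` (act A ` E)" using that by simp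
    also have "\<dots> = E" unfolding image_image using act_inv(2) [OF that(1)] E_closure by force
    finally show ?thesis .
  qed
  have "A \<in> carrier (Sp n) \<and> act A ` E = E" if "A \<in> generate (Sp n) {g, h}" for A
    using that
  proof induction
    case one
    have "act (1\<^sub>m (n + 1)) ` E = E" using act_one E_closure by (force simp: image_def)
    then show ?case by (simp add: Sp_one_closed)
  next
    case (incl A)
    then show ?case using g h gE hE by auto
  next
    case (inv A)
    then have "A \<in> carrier (Sp n)" "act A ` E = E" using g h gE hE by auto
    then show ?case using inv_E by simp
  next
    case (eng A B)
    then have AB: "A \<in> carrier (Sp n)" "B \<in> carrier (Sp n)" by auto
    have "act (A * B) ` E = (\<lambda>p. act A (act B p)) ` E"
      by (rule image_cong [OF refl], rule act_mult [OF AB]) (use E_closure in blast)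
    also have "\<dots> = E" using eng by (metis image_image)
    finally show ?case using AB by (simp add: Sp_m_closed)
  qed
  then have "(\<lambda>A. act A (proj U)) ` generate (Sp n) {g, h} \<subseteq> E" by blast
  then have "finite ((\<lambda>A. act A (proj U)) ` generate (Sp n) {g, h})"
    by (rule finite_subset) simp
  moreover have "proj U \<in> hyp_space n \<union> hyp_boundary n"
    using E_closure by (simp add: hyp_closure_def)
  ultimately show ?thesis unfolding elementary_def by blast
qed

text \<open>In the eigenbasis \<open>t\<close> becomes \<open>F\<close>, to which
  \<open>Sp_entries_bounded\<close> applies; changing back costs factors depending only on
  \<open>P\<close>. Inversion merely exchanges \<open>ca\<close> and \<open>cd\<close>, so the
  inverse obeys the same bound.\<close>

lemma corners_bound_entries:
  obtains K where "\<And>t i j. t \<in> carrier (Sp n) \<Longrightarrow>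
      (ca t \<le> C \<and> cb t \<le> C \<and> cc t \<le> C \<and> cd t \<le> C) \<Longrightarrow> i < n + 1 \<Longrightarrow> j < n + 1 \<Longrightarrow>
      norm (t $$ (i, j)) \<le> K \<and> norm ((inv\<^bsub>Sp n\<^esub> t) $$ (i, j)) \<le> K"
proof -
  interpret group "Sp n" by (rule Sp_group)
  define Q where "Q = inv\<^bsub>Sp n\<^esub> P"
  have Q: "Q \<in> carrier (Sp n)" using P by (simp add: Q_def)
  have bd: "\<exists>p. \<forall>i<n + 1. \<forall>j<n + 1. norm (A $$ (i, j)) \<le> p" for A :: "quat mat"
  proof -
    have "norm (A $$ (i, j)) \<le> (\<Sum>(i, j)\<in>{..<n + 1} \<times> {..<n + 1}. norm (A $$ (i, j)))"
      if "i < n + 1" "j < n + 1" for i j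
      using that member_le_sum [of "(i, j)" "{..<n + 1} \<times> {..<n + 1}" "\<lambda>(i, j). norm (A $$ (i, j))"]
      by auto
    then show ?thesis by blast
  qed
  obtain p q where p: "\<And>i j. i < n + 1 \<Longrightarrow> j < n + 1 \<Longrightarrow> norm (P $$ (i, j)) \<le> p"
    and q: "\<And>i j. i < n + 1 \<Longrightarrow> j < n + 1 \<Longrightarrow> norm (Q $$ (i, j)) \<le> q"
    using bd [of P] bd [of Q] by blast
  define K where "K = real (n + 1) * (q * (real (n + 1) * ((1 + 8 * C) * p)))"
  have main: "norm (t $$ (i, j)) \<le> K"
    if t: "t \<in> carrier (Sp n)" and c: "ca t \<le> C" "cb t \<le> C" "cc t \<le> C" "cd t \<le> C"
      and ij: "i < n + 1" "j < n + 1" for t i j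
  proof -
    define F where "F = P * (t * Q)"
    have F: "F \<in> carrier (Sp n)" using P t Q by (simp add: F_def Sp_m_closed)
    note car = P [THEN Sp_carrierD(1)] Q [THEN Sp_carrierD(1)] t [THEN Sp_carrierD(1)] F [THEN Sp_carrierD(1)]
    have QP: "Q * P = 1\<^sub>m (n + 1)" using l_inv [OF P] by (simp add: Q_def)
    have "Q * (F * P) = (Q * P) * (t * (Q * P))"
      unfolding F_def using car by (simp add: assoc_mult_mat [of _ "n+1" "n+1" _ "n+1" _ "n+1"])
    then have t_eq: "t = Q * (F * P)"
      using car by (simp add: QP)
    have corner: "norm (form n (F *\<^sub>v unit_vec (n + 1) i) (unit_vec (n + 1) j)) \<le> C"
      if "i \<in> {n - 1, n}" "j \<in> {n - 1, n}" for i j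
    proof -
      have "form n (F *\<^sub>v x) y = form n (t *\<^sub>v (Q *\<^sub>v x)) (Q *\<^sub>v y)"
        if "x \<in> carrier_vec (n + 1)" "y \<in> carrier_vec (n + 1)" for x y
        using P t Q that
        by (simp add: F_def Sp_mult_mult_vec [of _ n] Sp_m_closed Sp_mult_vec Q_def Sp_form_inv)
      then show ?thesis
        using that c by (auto simp: ca_def cb_def cc_def cd_def U_def W_def simp flip: Q_def)
    qed
    have Fe: "norm (F $$ (i, j)) \<le> 1 + 8 * C" if "i < n + 1" "j < n + 1" for i j
      using Sp_entries_bounded [OF n F corner that] by blast
    have FP: "norm ((F * P) $$ (i, j)) \<le> real (n + 1) * ((1 + 8 * C) * p)" if "i < n + 1" "j < n + 1" for i j
      by (rule mult_mat_entry_bound [OF car(4,1) Fe p that])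
    show ?thesis
      unfolding t_eq K_def by (rule mult_mat_entry_bound [OF car(2) _ q FP ij]) (use car in auto)
  qed
  show thesis
  proof (rule that [of K], rule conjI)
    fix t i j
    assume t: "t \<in> carrier (Sp n)" and c: "ca t \<le> C \<and> cb t \<le> C \<and> cc t \<le> C \<and> cd t \<le> C"
      and ij: "i < n + 1" "j < n + 1"
    show "norm (t $$ (i, j)) \<le> K" using main t c ij by blast
    have "ca (inv\<^bsub>Sp n\<^esub> t) = cd t" "cb (inv\<^bsub>Sp n\<^esub> t) = cb t" "cc (inv\<^bsub>Sp n\<^esub> t) = cc t"
      "cd (inv\<^bsub>Sp n\<^esub> t) = ca t"
      using corner_inv [OF t] by (simp_all add: ca_def cb_def cc_def cd_def)
    then show "norm ((inv\<^bsub>Sp n\<^esub> t) $$ (i, j)) \<le> K"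
      using main [of "inv\<^bsub>Sp n\<^esub> t"] t c ij by simp
  qed
qed

section \<open>Conjugation by powers of \<open>g\<close> and the sequence of conjugates\<close>

lemma pow_eigen:
  "g [^]\<^bsub>Sp n\<^esub> (k :: nat) \<in> carrier (Sp n)"
  "(g [^]\<^bsub>Sp n\<^esub> k) *\<^sub>v U = rscale U (lam ^ k)" "(g [^]\<^bsub>Sp n\<^esub> k) *\<^sub>v W = rscale W (mu ^ k)"
proof -
  interpret group "Sp n" by (rule Sp_group)
  show pc: "g [^]\<^bsub>Sp n\<^esub> k \<in> carrier (Sp n)" for k :: nat using g by simp
  show "(g [^]\<^bsub>Sp n\<^esub> k) *\<^sub>v U = rscale U (lam ^ k)"
    using UW_carrier g pc
    by (induction k) (simp_all add: Sp_mult_mult_vec [of _ n] g_eigen Sp_rscale [of _ n] rscale_rscale power_Suc2 del: power_Suc)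
  show "(g [^]\<^bsub>Sp n\<^esub> k) *\<^sub>v W = rscale W (mu ^ k)"
    using UW_carrier g pc
    by (induction k) (simp_all add: Sp_mult_mult_vec [of _ n] g_eigen Sp_rscale [of _ n] rscale_rscale power_Suc2 del: power_Suc)
qed

text \<open>Each corner is multiplied by the moduli of the eigenvalues of both its vectors. For
  \<open>ca\<close> and \<open>cd\<close> these cancel, \<open>|lam| |mu|\<close> being
  \<open>1\<close>; for \<open>cb\<close> and \<open>cc\<close> the same eigenvalue occurs
  twice.\<close>

lemma corner_pow_conj:
  fixes k :: nat
  assumes h: "h \<in> carrier (Sp n)"
  defines "t \<equiv> inv\<^bsub>Sp n\<^esub> (g [^]\<^bsub>Sp n\<^esub> k) * (h * (g [^]\<^bsub>Sp n\<^esub> k))"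
  shows "t \<in> carrier (Sp n)" "ca t = ca h" "cd t = cd h"
    "cb t = cb h / norm lam ^ (2 * k)" "cc t = cc h * norm lam ^ (2 * k)"
proof -
  note pc = pow_eigen(1) [of k]
  show t: "t \<in> carrier (Sp n)" using h pc by (simp add: t_def Sp_m_closed Sp_inv_closed)
  have tf: "form n (t *\<^sub>v x) y = form n (h *\<^sub>v ((g [^]\<^bsub>Sp n\<^esub> k) *\<^sub>v x)) ((g [^]\<^bsub>Sp n\<^esub> k) *\<^sub>v y)"
    if "x \<in> carrier_vec (n + 1)" "y \<in> carrier_vec (n + 1)" for x y
    using h pc that by (simp add: t_def Sp_mult_mult_vec [of _ n] Sp_m_closed Sp_inv_closed Sp_mult_vec Sp_form_inv)
  have L: "norm lam ^ k \<noteq> 0" using norm_lam by auto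
  have *: "norm lam ^ (2 * k) = norm lam ^ k * norm lam ^ k" by (simp add: mult_2 power_add)
  show "ca t = ca h" "cd t = cd h" "cb t = cb h / norm lam ^ (2 * k)" "cc t = cc h * norm lam ^ (2 * k)"
    unfolding * using UW_carrier h n L
    by (simp_all add: ca_def cb_def cc_def cd_def tf pow_eigen Sp_rscale [of _ n] form_rscale_left
      form_rscale_right Sp_mult_vec norm_mult norm_power norm_mu power_one_over)
qed

definition conj_seq :: "quat mat \<Rightarrow> nat \<Rightarrow> quat mat" where
  "conj_seq h = rec_nat h (\<lambda>_ f. f * g * inv\<^bsub>Sp n\<^esub> f)"

lemma conj_seq_simps [simp]:
  "conj_seq h 0 = h" "conj_seq h (Suc k) = conj_seq h k * g * inv\<^bsub>Sp n\<^esub> (conj_seq h k)"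
  by (simp_all add: conj_seq_def)

text \<open>Along the sequence \<open>cb\<close> may grow while \<open>cc\<close> decays; conjugating the \<open>2k\<close>-th term with \<open>g\<^sup>k\<close>
  balances the two.\<close>

theorem jorgensen:
  assumes h: "h \<in> carrier (Sp n)" and M1: "M < 1"
    and small: "M\<^sup>2 * (sqrt (ca h * cd h) * sqrt (cb h * cc h)) < 1 - M"
    and disc: "discrete_group (generate (Sp n) {g, h})"
  shows "elementary n (generate (Sp n) {g, h})"
proof -
  interpret group "Sp n" by (rule Sp_group)
  let ?G = "generate (Sp n) {g, h}"
  have sub: "subgroup ?G (Sp n)" using g h by (intro generate_is_subgroup) auto
  have gG: "g \<in> ?G" by (rule generate.incl) simp
  have mG: "A * B \<in> ?G" if "A \<in> ?G" "B \<in> ?G" for A B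
    using subgroup.m_closed [OF sub that] by simp
  have iG: "inv\<^bsub>Sp n\<^esub> A \<in> ?G" if "A \<in> ?G" for A
    using subgroup.m_inv_closed [OF sub that] .
  define f where "f = conj_seq h"
  have fG: "f k \<in> ?G" for k
    by (induction k) (auto simp: f_def intro!: mG iG gG intro: generate.incl)
  have fS: "f k \<in> carrier (Sp n)" for k using fG subgroup.subset [OF sub] by blast
  have fSuc: "f (Suc k) = f k * g * inv\<^bsub>Sp n\<^esub> (f k)" for k by (simp add: f_def)
  have X: "sqrt (ca (f k) * cd (f k)) \<le> 1 + sqrt (cb (f k) * cc (f k))" for k
    by (rule corner_product(1) [OF fS])
  note seq = corner_sequences [of "\<lambda>k. ca (f k)" "\<lambda>k. cb (f k)" "\<lambda>k. cc (f k)" "\<lambda>k. cd (f k)" M "norm lam",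
    OF corner_nonneg M_pos M1 norm_lam X]
  have start: "M\<^sup>2 * (sqrt (ca (f 0) * cd (f 0)) * sqrt (cb (f 0) * cc (f 0))) < 1 - M"
    using small by (simp add: f_def)
  note step = corner_conj [OF fS, folded fSuc]
  have b_lim: "(\<lambda>k. cb (f k) / norm lam ^ k) \<longlonglongrightarrow> 0"
    and c_lim: "(\<lambda>k. cc (f k) * norm lam ^ k) \<longlonglongrightarrow> 0"
    and ad_bd: "\<exists>C. \<forall>k. ca (f k) \<le> C \<and> cd (f k) \<le> C"
    by (rule seq; use step start in simp)+
  define t where "t k = inv\<^bsub>Sp n\<^esub> (g [^]\<^bsub>Sp n\<^esub> k) * (f (2 * k) * (g [^]\<^bsub>Sp n\<^esub> k))" for k :: nat
  have tc: "t k \<in> carrier (Sp n)" "ca (t k) = ca (f (2 * k))" "cd (t k) = cd (f (2 * k))"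
    "cb (t k) = cb (f (2 * k)) / norm lam ^ (2 * k)" "cc (t k) = cc (f (2 * k)) * norm lam ^ (2 * k)" for k
    unfolding t_def by (rule corner_pow_conj [OF fS])+
  have gpow: "g [^]\<^bsub>Sp n\<^esub> k \<in> ?G" for k :: nat
  proof (induction k)
    case 0
    show ?case using subgroup.one_closed [OF sub] by simp
  next
    case (Suc k)
    then show ?case using mG gG by simp
  qed
  have tG: "t k \<in> ?G" for k unfolding t_def by (intro mG iG gpow fG)
  have tb: "(\<lambda>k. cb (t k)) \<longlonglongrightarrow> 0" and tcc: "(\<lambda>k. cc (t k)) \<longlonglongrightarrow> 0"
    unfolding tc
    using LIMSEQ_subseq_LIMSEQ [OF b_lim, of "\<lambda>k. 2 * k"] LIMSEQ_subseq_LIMSEQ [OF c_lim, of "\<lambda>k. 2 * k"]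
    by (simp_all add: strict_mono_def o_def)
  obtain C1 where C1: "\<And>k. ca (f k) \<le> C1 \<and> cd (f k) \<le> C1" using ad_bd by blast
  obtain C2 where C2: "\<And>k. norm (cb (t k)) \<le> C2"
    using convergent_imp_Bseq [OF convergentI [OF tb]] by (auto simp: Bseq_def)
  obtain C3 where C3: "\<And>k. norm (cc (t k)) \<le> C3"
    using convergent_imp_Bseq [OF convergentI [OF tcc]] by (auto simp: Bseq_def)
  define C where "C = max C1 (max C2 C3)"
  have tC: "ca (t k) \<le> C \<and> cb (t k) \<le> C \<and> cc (t k) \<le> C \<and> cd (t k) \<le> C" for k
    using C1 [of "2 * k"] C2 [of k] C3 [of k] unfolding C_def tc(2,3)
    by (auto simp: le_max_iff_disj)
  obtain K where K: "\<And>t i j. t \<in> carrier (Sp n) \<Longrightarrow>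
      (ca t \<le> C \<and> cb t \<le> C \<and> cc t \<le> C \<and> cd t \<le> C) \<Longrightarrow> i < n + 1 \<Longrightarrow> j < n + 1 \<Longrightarrow>
      norm (t $$ (i, j)) \<le> K \<and> norm ((inv\<^bsub>Sp n\<^esub> t) $$ (i, j)) \<le> K"
    using corners_bound_entries by blast
  have fin: "finite (range t)"
  proof (rule discrete_bounded_finite [OF sub disc])
    fix A i j assume A: "A \<in> range t" and ij: "i < n + 1" "j < n + 1"
    then obtain k where "A = t k" by blast
    then show "norm (A $$ (i, j)) \<le> K" "norm ((inv\<^bsub>Sp n\<^esub> A) $$ (i, j)) \<le> K"
      using K [OF tc(1) tC ij, of k] by auto
  qed (use tG in blast)
  have "finite (range (\<lambda>k. cb (t k)))" "finite (range (\<lambda>k. cc (t k)))"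
    using finite_imageI [OF fin, of cb] finite_imageI [OF fin, of cc] by (simp_all add: image_image)
  then have "eventually (\<lambda>k. cb (t k) = 0) sequentially" "eventually (\<lambda>k. cc (t k) = 0) sequentially"
    using tb tcc by (auto intro: finite_range_tendsto_eventually_eq)
  then have "eventually (\<lambda>k. cb (t k) = 0 \<and> cc (t k) = 0) sequentially"
    by (rule eventually_conj)
  then obtain N where N: "\<And>k. k \<ge> N \<Longrightarrow> cb (t k) = 0 \<and> cc (t k) = 0"
    by (auto simp: eventually_sequentially)
  \<comment> \<open>\<open>Suc N\<close> rather than \<open>N\<close> makes \<open>m\<close>
    positive, so that \<open>f m\<close> is a genuine conjugate and \<open>descend\<close>
    applies.\<close>
  define m where "m = 2 * Suc N"
  have "cb (f m) = 0" "cc (f m) = 0"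
    using N [of "Suc N"] norm_lam unfolding m_def tc(4,5) by auto
  then have m0: "form n (f m *\<^sub>v W) W = 0" "form n (f m *\<^sub>v U) U = 0"
    by (simp_all add: cb_def cc_def)
  have "proj (f m *\<^sub>v U) = proj U" "proj (f m *\<^sub>v W) = proj W"
    by (rule null_orth [OF n Sp_V_null [OF fS UW_null(1)] UW_null(1) m0(2)],
      rule null_orth [OF n Sp_V_null [OF fS UW_null(2)] UW_null(2) m0(1)])
  then have fixm: "\<forall>p\<in>E. act (f m) p = p"
    using UW_carrier fS by (simp add: act_proj_Sp [of _ n])
  \<comment> \<open>Fixing \<open>E\<close> pointwise descends by one index only as preservation of
    \<open>E\<close>. While that term is still a conjugate of \<open>g\<close>, preservation
    upgrades to fixing; at \<open>h\<close> it does not, which is why the conclusion is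
    weaker.\<close>
  have descend: "act h ` E = E" if "\<forall>p\<in>E. act (f (Suc k)) p = p" for k
    using that
  proof (induction k)
    case 0
    then have "act (f 0) ` E = E"
      using conj_fixes_E [OF fS [of 0]] fSuc [of 0] by metis
    then show ?case by (simp add: f_def)
  next
    case (Suc k)
    have "act (f (Suc k)) ` E = E"
      using conj_fixes_E [OF fS [of "Suc k"]] Suc.prems fSuc [of "Suc k"] by metis
    then have "\<forall>p\<in>E. act (f (Suc k)) p = p"
      using conj_preserves_E_imp_fixes [OF fS [of k]] fSuc [of k] by metis
    then show ?case by (rule Suc.IH)
  qed
  have "m = Suc (2 * N + 1)" by (simp add: m_def One_nat_def)
  then have "act h ` E = E" using descend fixm by metis
  then show ?thesis by (rule preserves_E_elementary [OF h])
qed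

text \<open>Which of \<open>u\<close>, \<open>v\<close> is the attracting point is immaterial:
  exchanging \<open>U\<close> and \<open>W\<close> exchanges \<open>ca\<close> with
  \<open>cd\<close> and \<open>cb\<close> with \<open>cc\<close>. The last claim guards against
  division by zero yielding \<open>0\<close>.\<close>

lemma cross_ratios:
  assumes h: "h \<in> carrier (Sp n)" and uv: "{u, v} = E" "u \<noteq> v"
  shows "cross_ratio_abs n (act h u) v u (act h v) = cb h * cc h"
    and "cross_ratio_abs n (act h u) u v (act h v) = ca h * cd h"
    and "cross_ratio_abs n u v (act h u) (act h v) = cb h * cc h / (ca h * cd h)"
    and "cross_ratio_defined n u v (act h u) (act h v) \<Longrightarrow> ca h * cd h \<noteq> 0"
proof -
  have c: "U \<in> carrier_vec (n + 1)" "W \<in> carrier_vec (n + 1)"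
    "h *\<^sub>v U \<in> carrier_vec (n + 1)" "h *\<^sub>v W \<in> carrier_vec (n + 1)"
    using UW_carrier h by (simp_all add: Sp_mult_vec)
  have hUW: "form n (h *\<^sub>v U) (h *\<^sub>v W) = -1" "form n (h *\<^sub>v W) (h *\<^sub>v U) = -1"
    using h UW_carrier form_UW by (simp_all add: Sp_carrierD(2))
  have "(u = proj U \<and> v = proj W) \<or> (u = proj W \<and> v = proj U)"
    using uv by (auto simp: doubleton_eq_iff)
  then show "cross_ratio_abs n (act h u) v u (act h v) = cb h * cc h"
    and "cross_ratio_abs n (act h u) u v (act h v) = ca h * cd h"
    and "cross_ratio_abs n u v (act h u) (act h v) = cb h * cc h / (ca h * cd h)"
    and "cross_ratio_defined n u v (act h u) (act h v) \<Longrightarrow> ca h * cd h \<noteq> 0"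
    using h n c form_UW hUW
    by (auto simp: act_proj_Sp [of _ n] cross_ratio_proj ca_def cb_def cc_def cd_def
      norm_form_commute [of n U] norm_form_commute [of n W] mult.commute)
qed

end

text \<open>In the first three cases one of \<open>M * x\<close>, \<open>M * y\<close> is below
  \<open>1 - M\<close> and the other at most \<open>1\<close>, by
  \<open>\<bar>x - y\<bar> \<le> 1\<close>; in the third,
  \<open>x \<le> 1 + y < 1 + (1 - M) * x\<close> gives \<open>M * x < 1\<close>. The fourth is
  \<open>2 * (x * y) \<le> x\<^sup>2 + y\<^sup>2\<close>.\<close>

lemma jorgensen_conditions:
  fixes x y M :: real
  assumes M: "0 < M" "M < 1" and xy: "x \<ge> 0" "y \<ge> 0" "x \<le> 1 + y" "y \<le> 1 + x"
    and c: "y < (1 - M) / M \<or> x < (1 - M) / M \<or> y < (1 - M) * x \<or> x\<^sup>2 + y\<^sup>2 < 2 * (1 - M) / M\<^sup>2"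
  shows "M\<^sup>2 * (x * y) < 1 - M"
proof -
  have prod: "M\<^sup>2 * (s * t) < 1 - M" if "s \<ge> 0" "t \<ge> 0" "M * t < 1 - M" "M * s \<le> 1" for s t
  proof -
    have "M\<^sup>2 * (s * t) = (M * s) * (M * t)" by (simp add: power2_eq_square)
    also have "\<dots> \<le> 1 * (M * t)" using that M by (intro mult_right_mono) auto
    finally show ?thesis using that by simp
  qed
  from c consider "y < (1 - M) / M" | "x < (1 - M) / M" | "y < (1 - M) * x"
    | "x\<^sup>2 + y\<^sup>2 < 2 * (1 - M) / M\<^sup>2" by blast
  then show ?thesis
  proof cases
    case 1
    then have "M * y < 1 - M" using M by (simp add: field_simps)
    moreover have "M * x \<le> M * (1 + y)" using xy M by (intro mult_left_mono) auto
    ultimately show ?thesis using xy by (intro prod) (auto simp: distrib_left)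
  next
    case 2
    then have "M * x < 1 - M" using M by (simp add: field_simps)
    moreover have "M * y \<le> M * (1 + x)" using xy M by (intro mult_left_mono) auto
    ultimately have "M\<^sup>2 * (y * x) < 1 - M" using xy by (intro prod) (auto simp: distrib_left)
    then show ?thesis by (simp add: mult.commute)
  next
    case 3
    then have "M * x < 1" using xy by (simp add: algebra_simps)
    moreover have "M * y < M * ((1 - M) * x)" using 3 M by (intro mult_strict_left_mono)
    moreover have "(1 - M) * (M * x) \<le> (1 - M) * 1"
      using calculation(1) M by (intro mult_left_mono) auto
    ultimately show ?thesis using xy by (intro prod) (auto simp: mult_ac)
  next
    case 4
    have "0 \<le> (x - y)\<^sup>2" by simp
    then have "2 * (x * y) \<le> x\<^sup>2 + y\<^sup>2" by (simp add: power2_diff)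
    then have "M\<^sup>2 * (2 * (x * y)) \<le> M\<^sup>2 * (x\<^sup>2 + y\<^sup>2)" by (intro mult_left_mono) auto
    also have "\<dots> < 2 * (1 - M)" using 4 M by (simp add: field_simps)
    finally show ?thesis by simp
  qed
qed

theorem corollary1p2:
  fixes n :: nat and g h :: "quat mat" and u v :: "quat vec set"
  assumes "n \<ge> 1"
    and "loxodromic n g"
    and "M_inv n g < 1"
    and "u \<in> hyp_boundary n" and "v \<in> hyp_boundary n" and "u \<noteq> v"
    and "act g u = u" and "act g v = v"
    and "h \<in> carrier (Sp n)" and "h \<noteq> g"
    and "sqrt (cross_ratio_abs n (act h u) v u (act h v)) < (1 - M_inv n g) / M_inv n g \<or>
         sqrt (cross_ratio_abs n (act h u) u v (act h v)) < (1 - M_inv n g) / M_inv n g \<or>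
         (cross_ratio_defined n u v (act h u) (act h v) \<and>
           sqrt (cross_ratio_abs n u v (act h u) (act h v)) < 1 - M_inv n g) \<or>
         cross_ratio_abs n (act h u) u v (act h v) + cross_ratio_abs n (act h u) v u (act h v)
           < 2 * (1 - M_inv n g) / (M_inv n g)\<^sup>2"
  shows "elementary n (generate (Sp n) {g, h}) \<or> \<not> discrete_group (generate (Sp n) {g, h})"
proof -
  interpret group "Sp n" by (rule Sp_group)
  have g: "g \<in> carrier (Sp n)" using assms(2) by (simp add: loxodromic_def)
  have "diagonal_form n g (eigenvalues_of n g)"
    unfolding eigenvalues_of_def using loxodromic_diagonal_form [OF assms(1,2)] by (rule someI_ex)
  then obtain P where P: "P \<in> carrier (Sp n)"
    and l: "\<And>i. i < n - 1 \<Longrightarrow> norm (eigenvalues_of n g i) = 1" "norm (eigenvalues_of n g (n - 1)) > 1"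
    and diag: "P * g * inv\<^bsub>Sp n\<^esub> P = mat_diag (n + 1)
      (\<lambda>i. if i < n then eigenvalues_of n g i else inverse (qcnj (eigenvalues_of n g (n - 1))))"
    by (auto simp: diagonal_form_def)
  have delta: "norm (eigenvalues_of n g i - 1) \<le> delta_inv n g" if "i < n - 1" for i
    unfolding delta_inv_def using that by (intro Max_ge) auto
  have delta0: "delta_inv n g \<ge> 0" unfolding delta_inv_def by (intro Max_ge) auto
  interpret diagonal_loxodromic n g P "eigenvalues_of n g" "delta_inv n g"
    by unfold_locales (use assms(1) g P l diag delta delta0 in auto)
  have M_eq: "M_inv n g = M" by (simp add: M_inv_def M_def mu_def lam_def)
  have h: "h \<in> carrier (Sp n)" by fact
  have "{u, v} \<subseteq> E"
    using assms(4,5,7,8) unfolding fixed_points_g [symmetric] by (auto simp: fixed_points_def)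
  then have uv: "{u, v} = E" using \<open>u \<noteq> v\<close> by auto
  note cr = cross_ratios [OF h uv \<open>u \<noteq> v\<close>]
  define x where "x = sqrt (ca h * cd h)"
  define y where "y = sqrt (cb h * cc h)"
  have x2: "ca h * cd h = x\<^sup>2" and y2: "cb h * cc h = y\<^sup>2" and xy: "x \<ge> 0" "y \<ge> 0"
    by (simp_all add: x_def y_def corner_nonneg)
  have third: "y < (1 - M) * x" if "x\<^sup>2 \<noteq> 0" "sqrt (y\<^sup>2 / x\<^sup>2) < 1 - M"
  proof -
    have "y / x < 1 - M" using that xy by (simp add: real_sqrt_divide)
    then show ?thesis using that xy by (simp add: field_simps)
  qed
  have "y < (1 - M) / M \<or> x < (1 - M) / M \<or> y < (1 - M) * x \<or> x\<^sup>2 + y\<^sup>2 < 2 * (1 - M) / M\<^sup>2"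
    using assms(11) third cr(4) xy unfolding cr(1-3) M_eq x2 y2 by auto
  then have "M\<^sup>2 * (x * y) < 1 - M"
    using M_pos assms(3) xy corner_product [OF h] unfolding M_eq x_def [symmetric] y_def [symmetric]
    by (intro jorgensen_conditions) auto
  then show ?thesis
    using jorgensen [OF h] assms(3) unfolding M_eq x_def y_def by blast
qed

end
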